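(* Let $n\ge1$, $g>0$, and let $\lambda=(\lambda_1,\dots,\lambda_n)\in\mathbb{N}^n$, $\lambda_1\ge\dots\ge\lambda_n\ge0$, be a partition. Put $a_i=\lambda_{n,i}+1-(n-i+1)g$ ($i=1,\dots,n$), $b_i=a_i+g$ ($i=1,\dots,n-1$), and let $f_\lambda(z)$ be the polynomial $$f_\lambda(z)=z^{\lambda_n}(1-z)^{1-ng}\,{}_nF_{n-1}\left(\begin{matrix}a_1,\dots,a_n\\ b_1,\dots,b_{n-1}\end{matrix};z\right).$$ Let $q_\lambda(z)$ be the eigenvalue of $Q_z$ on the Jack polynomial $P_\lambda^{(1/g)}$, i.e. $Q_zP_\lambda^{(1/g)}=q_\lambda(z)P_\lambda^{(1/g)}$. Then the polynomials $f_\lambda(z)$ and $q_\lambda(z)$ are proportional: $$f_\lambda(z)=\beta_\lambda\,q_\lambda(z),\qquad \beta_\lambda=\prod_{i=1}^{n-1}\beta_\lambda^{(i)},\qquad \beta_\lambda^{(i)}=\frac{((n-i+1)g)_{\lambda_{i,n}}}{((n-i)g)_{\lambda_{i,n}}}\,.$$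
   Context: Notation: $\lambda_{i,j}=\lambda_i-\lambda_j$; $(\alpha)_k=\alpha(\alpha+1)\cdots(\alpha+k-1)$ is the Pochhammer symbol; ${}_nF_{n-1}$ is the generalised hypergeometric series $\sum_{m\ge0}\frac{(a_1)_m\cdots(a_n)_m}{(b_1)_m\cdots(b_{n-1})_m}\frac{z^m}{m!}$; $\Delta_n(\mathbf{x})=\prod_{1\le i<j\le n}(x_j-x_i)$; $\mathbb{C}[\mathbf{x}]^{S_n}$ is the ring of symmetric polynomials in $\mathbf{x}=(x_1,\dots,x_n)$. The function $f_\lambda$ is a polynomial, given by the finite multiple sum $$f_\lambda(z)=z^{\lambda_n}\sum_{k_1=0}^{\lambda_{1,2}}\cdots\sum_{k_{n-1}=0}^{\lambda_{n-1,n}}\ \prod_{i=1}^{n-1}(1-z)^{\lambda_{i,i+1}}\Big(\frac{z}{z-1}\Big)^{k_i}\frac{(-\lambda_{i,i+1})_{k_i}}{k_i!}\,\frac{(1-(n-i+1)g-\lambda_{i,n})_{k_i+\dots+k_{n-1}}}{(1-(n-i)g-\lambda_{i,n})_{k_i+\dots+k_{n-1}}}\,.$$ The operator $Q_z$. For $g>0$, real $z>1$, reals $0<y_1<\dots<y_n$, and $p\in\mathbb{C}[\mathbf{x}]^{S_n}$ put $$[Q_zp](\mathbf{y})=\frac{\Gamma(ng)}{\Gamma(g)^n}\,\frac{(z-1)^{1-ng}}{\Delta_n(\mathbf{y})\prod_{i=1}^n y_i^{g-1}}\int_{\Omega_{\mathbf{x}}}d\mathbf{x}\;\delta(x_1\cdots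 x_n-z\,y_1\cdots y_n)\,\Delta_n(\mathbf{x})\Big[\prod_{i=1}^n\xi_i^{g-1}\Big]p(\mathbf{x}),$$ where $\Omega_{\mathbf{x}}=\{\mathbf{x}\in\mathbb{R}^n: 0<y_1<x_1<y_2<\dots<x_{n-1}<y_n<x_n<\infty\}$, $\xi_i=\prod_{k=1}^n(x_k-y_i)\big/\prod_{k\ne i}(y_k-y_i)>0$, and $\delta$ is the Dirac delta function. The function $[Q_zp](\mathbf{y})$ is a polynomial in $z$ and a symmetric polynomial in $\mathbf{y}$; accordingly $Q_z$ is extended to all $z\in\mathbb{C}$ and (renaming $\mathbf{y}$ as $\mathbf{x}$) regarded as a linear operator on $\mathbb{C}[\mathbf{x}]^{S_n}$. The Jack polynomials are eigenfunctions of $Q_z$, with eigenvalues $q_\lambda(z)\in\mathbb{C}(g)[z]$. Jack polynomials. For partitions $\mu,\lambda$ with $n$ parts (zeros allowed), $\mu\preceq\lambda$ means $\sum_{j=1}^n\mu_j=\sum_{j=1}^n\lambda_j$ and $\sum_{j=1}^k\mu_j\le\sum_{j=1}^k\lambda_j$ for $k=1,\dots,n-1$. $m_\lambda(\mathbf{x})$ is the sum of $x_1^{\nu_1}\cdots x_n^{\nu_n}$ over all distinct permutations $\nu$ of $\lambda$. The Jack polynomials $P_\lambda^{(1/g)}(\mathbf{x})\in\mathbb{C}(g)[\mathbf{x}]^{S_n}$ are the unique symmetric polynomials of the form $P_\lambda^{(1/g)}=m_\lambda+\sum_{\mu\prec\lambda}v_{\lambda\mu}(g)m_\mu$ such that $D(u;g)P_\lambda^{(1/g)}=\big[\prod_{i=1}^n(\lambda_i+(n-i)g+u)\big]P_\lambda^{(1/g)}$,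 where $$D(u;g)=\frac{(-1)^{n(n-1)/2}}{\Delta_n(\mathbf{x})}\det\Big[x_i^{n-j}\Big(x_i\frac{\partial}{\partial x_i}+(n-j)g+u\Big)\Big]_{i,j=1}^n .$$ *)

theory Defs
  imports
    "HOL-Analysis.Analysis"
    "HOL-Combinatorics.Permutations"
    "HOL-Library.Poly_Mapping"
    "HOL-Library.Nonpos_Ints"
begin

section \<open>Polynomials in several variables\<close>

text \<open>
  A multivariate polynomial is a finitely supported map from exponent vectors to coefficients.
  All objects with n components (partitions, points, variables) are indexed by 1, ..., n.
\<close>

type_synonym mpoly = "(nat \<Rightarrow>\<^sub>0 nat) \<Rightarrow>\<^sub>0 complex"

definition const :: "complex \<Rightarrow> mpoly" where
  "const c = Poly_Mapping.single 0 c"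

definition var :: "nat \<Rightarrow> mpoly" where
  "var i = Poly_Mapping.single (Poly_Mapping.single i 1) 1"

definition eval_mpoly :: "(nat \<Rightarrow> complex) \<Rightarrow> mpoly \<Rightarrow> complex" where
  "eval_mpoly x p =
    (\<Sum>e\<in>Poly_Mapping.keys p. Poly_Mapping.lookup p e *
       (\<Prod>i\<in>Poly_Mapping.keys e. x i ^ Poly_Mapping.lookup e i))"

definition partial_deriv :: "nat \<Rightarrow> mpoly \<Rightarrow> mpoly" where
  "partial_deriv i p =
    (\<Sum>e\<in>Poly_Mapping.keys p.
       Poly_Mapping.single (e - Poly_Mapping.single i 1)
         (of_nat (Poly_Mapping.lookup e i) * Poly_Mapping.lookup p e))"

definition sym_polys :: "nat \<Rightarrow> mpoly set" where
  "sym_polys n = {p.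
     (\<forall>e\<in>Poly_Mapping.keys p. Poly_Mapping.keys e \<subseteq> {1..n}) \<and>
     (\<forall>\<sigma>. \<sigma> permutes {1..n} \<longrightarrow>
        (\<forall>e. Poly_Mapping.lookup p (Poly_Mapping.map_key \<sigma> e) = Poly_Mapping.lookup p e))}"

definition Vandermonde :: "nat \<Rightarrow> (nat \<Rightarrow> 'a) \<Rightarrow> 'a::comm_ring_1" where
  "Vandermonde n x = (\<Prod>j\<in>{1..n}. \<Prod>i\<in>{1..<j}. x j - x i)"


section \<open>Partitions and Jack polynomials\<close>

text \<open>
  Partitions are extended by 0 outside of \<open>{1..n}\<close>, so that each one is represented exactly once.
\<close>

definition partitions :: "nat \<Rightarrow> (nat \<Rightarrow> nat) set" where
  "partitions n = {lam. (\<forall>i\<in>{1..<n}. lam (i + 1) \<le> lam i) \<and> (\<forall>i. i \<notin> {1..n} \<longrightarrow> lam i = 0)}"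

definition dominated :: "nat \<Rightarrow> (nat \<Rightarrow> nat) \<Rightarrow> (nat \<Rightarrow> nat) \<Rightarrow> bool" where
  "dominated n mu lam \<longleftrightarrow>
     (\<Sum>j\<in>{1..n}. mu j) = (\<Sum>j\<in>{1..n}. lam j) \<and>
     (\<forall>k\<in>{1..<n}. (\<Sum>j\<in>{1..k}. mu j) \<le> (\<Sum>j\<in>{1..k}. lam j))"

definition exponent :: "nat \<Rightarrow> (nat \<Rightarrow> nat) \<Rightarrow> (nat \<Rightarrow>\<^sub>0 nat)" where
  "exponent n nu = (\<Sum>i\<in>{1..n}. Poly_Mapping.single i (nu i))"

text \<open>The sum runs over a set of exponent vectors, hence over distinct permutations.\<close>

definition monomial_sym :: "nat \<Rightarrow> (nat \<Rightarrow> nat) \<Rightarrow> mpoly" where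
  "monomial_sym n lam =
    (\<Sum>e\<in>{exponent n (lam \<circ> \<sigma>) | \<sigma>. \<sigma> permutes {1..n}}. Poly_Mapping.single e 1)"

definition sekiguchi_entry :: "nat \<Rightarrow> real \<Rightarrow> complex \<Rightarrow> nat \<Rightarrow> nat \<Rightarrow> mpoly \<Rightarrow> mpoly" where
  "sekiguchi_entry n g u i j p =
     var i ^ (n - j) * (var i * partial_deriv i p + const (of_real (real (n - j) * g) + u) * p)"

text \<open>
  Determinant of the matrix of operators: operators in different rows commute, so the
  order of the factors in the Leibniz formula is immaterial.
\<close>

definition sekiguchi_det :: "nat \<Rightarrow> real \<Rightarrow> complex \<Rightarrow> mpoly \<Rightarrow> mpoly" where
  "sekiguchi_det n g u p =
     (\<Sum>\<sigma> | \<sigma> permutes {1..n}.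
        of_int (sign \<sigma>) * fold (\<lambda>i. sekiguchi_entry n g u i (\<sigma> i)) [1..<Suc n] p)"

text \<open>
  The division by the Vandermonde determinant takes place in the polynomial ring, an integral
  domain; on symmetric \<open>p\<close> the determinant is alternating and hence divisible.
\<close>

definition sekiguchi_op :: "nat \<Rightarrow> real \<Rightarrow> complex \<Rightarrow> mpoly \<Rightarrow> mpoly" where
  "sekiguchi_op n g u p =
     (THE r. Vandermonde n var * r = (- 1) ^ (n * (n - 1) div 2) * sekiguchi_det n g u p)"

text \<open>
  \<open>is_jack n g lam P\<close> says that \<open>P\<close> is the Jack polynomial with parameter \<open>1/g\<close>, for a real
  number \<open>g\<close>. For \<open>g > 0\<close> the eigenvalues of distinct partitions are distinct as polynomials
  in \<open>u\<close>, so that \<open>P\<close> is unique.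
\<close>

definition is_jack :: "nat \<Rightarrow> real \<Rightarrow> (nat \<Rightarrow> nat) \<Rightarrow> mpoly \<Rightarrow> bool" where
  "is_jack n g lam P \<longleftrightarrow>
     (\<exists>v. P = monomial_sym n lam +
          (\<Sum>mu | mu \<in> partitions n \<and> dominated n mu lam \<and> mu \<noteq> lam.
             const (v mu) * monomial_sym n mu)) \<and>
     (\<forall>u. sekiguchi_op n g u P =
          const (\<Prod>i\<in>{1..n}. of_nat (lam i) + of_real (real (n - i) * g) + u) * P)"


section \<open>The operator \<open>Q\<^sub>z\<close>\<close>

text \<open>
  The integral of \<open>\<delta>(h(x)) F(x)\<close> over \<open>n\<close>-dimensional space. In the last
  coordinate \<open>t\<close> the composition rule
  \<open>\<delta>(\<phi>(t)) = \<Sum> \<delta>(t - t\<^sub>0) / \<bar>\<phi>'(t\<^sub>0)\<bar>\<close>, summed over the zeros \<open>t\<^sub>0\<close> of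
  \<open>\<phi>\<close>, is applied; the remaining coordinates are integrated against Lebesgue measure.
\<close>

definition delta_integral ::
  "nat \<Rightarrow> ((nat \<Rightarrow> real) \<Rightarrow> real) \<Rightarrow> ((nat \<Rightarrow> real) \<Rightarrow> complex) \<Rightarrow> complex" where
  "delta_integral n h F =
     (\<integral>x. (\<Sum>t | h (x(n := t)) = 0.
             F (x(n := t)) / of_real \<bar>deriv (\<lambda>s. h (x(n := s))) t\<bar>)
        \<partial>(\<Pi>\<^sub>M i\<in>{1..<n}. lborel))"

definition chain :: "nat \<Rightarrow> (nat \<Rightarrow> real) \<Rightarrow> bool" where
  "chain n y \<longleftrightarrow> 0 < y 1 \<and> (\<forall>i\<in>{1..<n}. y i < y (i + 1))"

definition Omega :: "nat \<Rightarrow> (nat \<Rightarrow> real) \<Rightarrow> (nat \<Rightarrow> real) set" where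
  "Omega n y = {x. (\<forall>i\<in>{1..n}. y i < x i) \<and> (\<forall>i\<in>{1..<n}. x i < y (i + 1))}"

definition xi :: "nat \<Rightarrow> (nat \<Rightarrow> real) \<Rightarrow> (nat \<Rightarrow> real) \<Rightarrow> nat \<Rightarrow> real" where
  "xi n y x i = (\<Prod>k\<in>{1..n}. x k - y i) / (\<Prod>k\<in>{1..n} - {i}. y k - y i)"

definition Q_integral :: "nat \<Rightarrow> real \<Rightarrow> real \<Rightarrow> mpoly \<Rightarrow> (nat \<Rightarrow> real) \<Rightarrow> complex" where
  "Q_integral n g z p y =
     of_real (Gamma (real n * g) / Gamma g ^ n *
       ((z - 1) powr (1 - real n * g) /
         (Vandermonde n y * (\<Prod>i\<in>{1..n}. y i powr (g - 1))))) *
     delta_integral n (\<lambda>x. (\<Prod>i\<in>{1..n}. x i) - z * (\<Prod>i\<in>{1..n}. y i))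
       (\<lambda>x. if x \<in> Omega n y
            then of_real (Vandermonde n x * (\<Prod>i\<in>{1..n}. xi n y x i powr (g - 1))) *
                 eval_mpoly (\<lambda>i. of_real (x i)) p
            else 0)"

text \<open>
  \<open>Q_poly n g p\<close> is the polynomial in \<open>z\<close>, with symmetric polynomials as coefficients, that
  interpolates the integral; \<open>Q_op n g z\<close> is its value at an arbitrary complex \<open>z\<close>.
\<close>

definition Q_poly :: "nat \<Rightarrow> real \<Rightarrow> mpoly \<Rightarrow> mpoly poly" where
  "Q_poly n g p =
     (THE R. (\<forall>i. coeff R i \<in> sym_polys n) \<and>
        (\<forall>z>1. \<forall>y. chain n y \<longrightarrow>
           eval_mpoly (\<lambda>i. of_real (y i)) (poly R (const (of_real z))) = Q_integral n g z p y))"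

definition Q_op :: "nat \<Rightarrow> real \<Rightarrow> complex \<Rightarrow> mpoly \<Rightarrow> mpoly" where
  "Q_op n g z p = poly (Q_poly n g p) (const z)"


section \<open>The polynomial \<open>f\<^sub>\<lambda>\<close>\<close>

definition f_coeff :: "nat \<Rightarrow> real \<Rightarrow> (nat \<Rightarrow> nat) \<Rightarrow> (nat \<Rightarrow> nat) \<Rightarrow> nat \<Rightarrow> real" where
  "f_coeff n g lam k i =
     pochhammer (- real (lam i - lam (i + 1))) (k i) / fact (k i) *
     (pochhammer (1 - real (n - i + 1) * g - real (lam i - lam n)) (\<Sum>j\<in>{i..<n}. k j) /
      pochhammer (1 - real (n - i) * g - real (lam i - lam n)) (\<Sum>j\<in>{i..<n}. k j))"

text \<open>
  The multiple sum for \<open>f\<^sub>\<lambda>\<close>. To have a polynomial, including its value at \<open>z = 1\<close>, the factor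
  \<open>(1 - z)\<^sup>d (z / (z - 1))\<^sup>k\<close> with \<open>k \<le> d\<close> is written as \<open>(1 - z)\<^sup>d\<^sup>-\<^sup>k (- z)\<^sup>k\<close>.
  The denominators of the coefficients do not vanish for any \<open>g > 0\<close>.
\<close>

definition f_poly :: "nat \<Rightarrow> real \<Rightarrow> (nat \<Rightarrow> nat) \<Rightarrow> complex poly" where
  "f_poly n g lam =
     [:0, 1:] ^ lam n *
     (\<Sum>k\<in>(\<Pi>\<^sub>E i\<in>{1..<n}. {0..lam i - lam (i + 1)}).
        \<Prod>i\<in>{1..<n}.
          smult (of_real (f_coeff n g lam k i))
            ([:1, - 1:] ^ (lam i - lam (i + 1) - k i) * [:0, - 1:] ^ k i))"

lemma poly_f_poly:
  assumes "z \<noteq> 1"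
  shows "poly (f_poly n g lam) z =
     z ^ lam n *
     (\<Sum>k\<in>(\<Pi>\<^sub>E i\<in>{1..<n}. {0..lam i - lam (i + 1)}).
        \<Prod>i\<in>{1..<n}.
          (1 - z) ^ (lam i - lam (i + 1)) * (z / (z - 1)) ^ k i * of_real (f_coeff n g lam k i))"
proof -
  have *: "(1 - z) ^ (d - k) * (- z) ^ k = (1 - z) ^ d * (z / (z - 1)) ^ k" if "k \<le> d" for d k
  proof -
    have "(1 - z) ^ d = (1 - z) ^ (d - k) * (1 - z) ^ k"
      using that by (simp flip: power_add)
    moreover have "(1 - z) * (z / (z - 1)) = - z"
      using assms by (simp add: field_simps)
    ultimately show ?thesis
      by (metis (no_types, lifting) mult.assoc power_mult_distrib)
  qed
  have "of_real (f_coeff n g lam k i) *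
        ((1 - z) ^ (lam i - lam (i + 1) - k i) * (- z) ^ k i) =
      (1 - z) ^ (lam i - lam (i + 1)) * (z / (z - 1)) ^ k i * of_real (f_coeff n g lam k i)"
    if "k \<in> (\<Pi>\<^sub>E i\<in>{1..<n}. {0..lam i - lam (i + 1)})" "i \<in> {1..<n}" for k i
  proof -
    have "k i \<le> lam i - lam (i + 1)"
      using that by (auto simp: PiE_iff)
    from *[OF this] show ?thesis
      by (simp only: mult.commute)
  qed
  then have "(\<Sum>k\<in>(\<Pi>\<^sub>E i\<in>{1..<n}. {0..lam i - lam (i + 1)}). \<Prod>i\<in>{1..<n}.
          of_real (f_coeff n g lam k i) *
          ((1 - z) ^ (lam i - lam (i + 1) - k i) * (- z) ^ k i)) =
      (\<Sum>k\<in>(\<Pi>\<^sub>E i\<in>{1..<n}. {0..lam i - lam (i + 1)}). \<Prod>i\<in>{1..<n}.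
          (1 - z) ^ (lam i - lam (i + 1)) * (z / (z - 1)) ^ k i * of_real (f_coeff n g lam k i))"
    by (intro sum.cong prod.cong refl) blast
  then show ?thesis
    by (simp add: f_poly_def poly_sum poly_prod)
qed

definition hyp_a :: "nat \<Rightarrow> real \<Rightarrow> (nat \<Rightarrow> nat) \<Rightarrow> nat \<Rightarrow> real" where
  "hyp_a n g lam i = real (lam n) - real (lam i) + 1 - real (n - i + 1) * g"

definition hyp_b :: "nat \<Rightarrow> real \<Rightarrow> (nat \<Rightarrow> nat) \<Rightarrow> nat \<Rightarrow> real" where
  "hyp_b n g lam i = hyp_a n g lam i + g"

definition f_hyp :: "nat \<Rightarrow> real \<Rightarrow> (nat \<Rightarrow> nat) \<Rightarrow> complex \<Rightarrow> complex" where
  "f_hyp n g lam z =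
     z ^ lam n * (1 - z) powr of_real (1 - real n * g) *
     eval_fps (fps_hypergeo (map (\<lambda>i. of_real (hyp_a n g lam i)) [1..<Suc n])
                            (map (\<lambda>i. of_real (hyp_b n g lam i)) [1..<n]) 1) z"

definition beta :: "nat \<Rightarrow> real \<Rightarrow> (nat \<Rightarrow> nat) \<Rightarrow> real" where
  "beta n g lam =
     (\<Prod>i\<in>{1..<n}. pochhammer (real (n - i + 1) * g) (lam i - lam n) /
                    pochhammer (real (n - i) * g) (lam i - lam n))"

end

theory Submission
  imports Defs
begin

text \<open>
  Put \<open>F(u) = \<Prod>k. (x k - u) / (y k - u) = 1 + (\<Sum>i. \<xi> i / (y i - u))\<close>. The value \<open>F(0)\<close> turns the
  constraint \<open>\<Prod>k. x k = z * (\<Prod>k. y k)\<close> into \<open>\<Sum>i. \<xi> i / y i = z - 1\<close>, and the Jacobian of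
  \<open>x \<mapsto> \<xi>\<close> is \<open>\<Delta>(x) / \<Delta>(y)\<close>. Hence in the simplex coordinates \<open>\<eta> i = \<xi> i / (y i * (z - 1))\<close> the
  integral \<open>Q\<^sub>z p\<close> is the expectation of \<open>p(x)\<close> under the Dirichlet distribution with all parameters
  equal to \<open>g\<close>. The elementary symmetric functions of \<open>x\<close> are polynomials in \<open>y\<close>, \<open>z\<close> and \<open>\<eta>\<close>, which
  makes \<open>Q\<^sub>z p\<close> a symmetric polynomial in \<open>y\<close> and a polynomial in \<open>z\<close>.

  The eigenvalue is read off at widely separated points \<open>y i = t ^ (2 * i)\<close>, \<open>t \<rightarrow> \<infinity>\<close>, where only the
  leading monomial of the Jack polynomial survives. Evaluating \<open>F\<close> between \<open>y (n - r)\<close> and \<open>y (n - r + 1)\<close>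
  shows that \<open>\<Prod>i>n - r. x i / y i\<close> tends to \<open>z + (1 - z) * (\<eta> 1 + \<dots> + \<eta> (n - r))\<close>, so that \<open>q\<^sub>\<lambda>(z)\<close>
  is \<open>z\<close> to the power \<open>\<lambda> n\<close> times the expectation of the product of the powers \<open>\<lambda> r - \<lambda> (r + 1)\<close> of these
  limits. The binomial theorem and the moments of the partial sums of \<open>\<eta>\<close> turn this into the multiple sum.
  The hypergeometric form arises by applying the factors \<open>(a i)\<^sub>j / (b i)\<^sub>j\<close> of the coefficients one after the
  other to the functions \<open>z\<^sup>K (1 - z)\<^sup>-\<^sup>c\<^sup>-\<^sup>K\<close>, which they map to functions of the same form.
\<close>

section \<open>Change of variables on a slice\<close>

text \<open>The obstacle is the Jacobian of \<open>x \<mapsto> \<xi>\<close> together with the image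
  of the slice. Both come from peeling: dividing \<open>F\<close> by its factor with zero
  \<open>x m\<close> and pole \<open>y m\<close> leaves a function of the same kind in fewer
  variables. Only one-dimensional substitution, Fubini and diagonal scaling are then used, on
  nonnegative integrands, where integrability is no issue. Because the Dirichlet distribution
  involves neither \<open>y\<close> nor \<open>z\<close>, the expectation of a polynomial in \<eta>
  may be computed at any convenient chain. This is used twice: for the symmetry of the coefficients
  of \<open>Q_poly\<close>, and to let \<open>t\<close> tend to infinity while the expectation of
  the ladder product stays fixed. The estimates are uniform over the slice, so no limit passes under
  an integral sign. The constant \<open>beta\<close> is the value of \<open>f_poly\<close> at 1,
  since at \<open>z = 1\<close> every ladder factor is 1. In the computation it is what remains of
  the coefficients of \<open>f_poly\<close> when their Pochhammer symbols are reflected, which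
  trades partial sums of \<open>k\<close> for partial sums of \<open>d - k\<close>.\<close>

lemma nn_integral_PiM_lborel_scale:
  fixes c :: "'i \<Rightarrow> real"
  assumes "finite I" "\<And>i. i \<in> I \<Longrightarrow> 0 < c i"
    and "f \<in> borel_measurable (Pi\<^sub>M I (\<lambda>_. lborel))"
  shows "(\<integral>\<^sup>+u. f u \<partial>Pi\<^sub>M I (\<lambda>_. lborel)) =
    ennreal (\<Prod>i\<in>I. c i) * (\<integral>\<^sup>+u. f (\<lambda>i\<in>I. c i * u i) \<partial>Pi\<^sub>M I (\<lambda>_. lborel))"
  using assms
proof (induction I arbitrary: f rule: finite_induct)
  case empty
  interpret product_sigma_finite "\<lambda>_. lborel :: real measure" by standard
  show ?case by (subst (1 2) nn_integral_empty) (auto simp: restrict_def)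
next
  case (insert i I)
  interpret product_sigma_finite "\<lambda>_. lborel :: real measure" by standard
  note [simp] = insert.hyps
  note [measurable] = insert.prems(2)
  have c: "0 < c i" "\<And>j. j \<in> I \<Longrightarrow> 0 < c j" using insert.prems by auto
  have meas_f: "(\<lambda>(u, t). f (u(i := t))) \<in> borel_measurable (Pi\<^sub>M I (\<lambda>_. lborel) \<Otimes>\<^sub>M lborel)"
    by measurable
  have meas_scale: "(\<lambda>u. f (\<lambda>j\<in>insert i I. c j * u j)) \<in> borel_measurable (Pi\<^sub>M (insert i I) (\<lambda>_. lborel))"
    by (rule measurable_compose[OF _ insert.prems(2)]) measurable
  have "(\<integral>\<^sup>+u. f u \<partial>Pi\<^sub>M (insert i I) (\<lambda>_. lborel)) =
      (\<integral>\<^sup>+t. (\<integral>\<^sup>+u. f (u(i := t)) \<partial>Pi\<^sub>M I (\<lambda>_. lborel)) \<partial>lborel)"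
    by (rule product_nn_integral_insert_rev) auto
  also have "\<dots> = (\<integral>\<^sup>+t. ennreal (\<Prod>j\<in>I. c j) *
      (\<integral>\<^sup>+u. f ((\<lambda>j\<in>I. c j * u j)(i := t)) \<partial>Pi\<^sub>M I (\<lambda>_. lborel)) \<partial>lborel)"
  proof (rule nn_integral_cong)
    fix t :: real
    have "(\<lambda>u. f (u(i := t))) \<in> borel_measurable (Pi\<^sub>M I (\<lambda>_. lborel))"
      by measurable
    from insert.IH[OF c(2) this]
    show "(\<integral>\<^sup>+u. f (u(i := t)) \<partial>Pi\<^sub>M I (\<lambda>_. lborel)) = ennreal (\<Prod>j\<in>I. c j) *
      (\<integral>\<^sup>+u. f ((\<lambda>j\<in>I. c j * u j)(i := t)) \<partial>Pi\<^sub>M I (\<lambda>_. lborel))" .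
  qed
  also have "\<dots> = ennreal (\<Prod>j\<in>I. c j) * (\<integral>\<^sup>+t.
      (\<integral>\<^sup>+u. f ((\<lambda>j\<in>I. c j * u j)(i := t)) \<partial>Pi\<^sub>M I (\<lambda>_. lborel)) \<partial>lborel)"
  proof (rule nn_integral_cmult)
    interpret I: finite_product_sigma_finite "\<lambda>_. lborel :: real measure" I by standard simp
    interpret P: pair_sigma_finite lborel "Pi\<^sub>M I (\<lambda>_. lborel :: real measure)"
      by (simp add: local.sigma_finite pair_sigma_finite.intro lborel.sigma_finite_measure_axioms)
    have "(\<lambda>(t, u). f ((\<lambda>j\<in>I. c j * u j)(i := t))) \<in> borel_measurable (lborel \<Otimes>\<^sub>M Pi\<^sub>M I (\<lambda>_. lborel))"
      by measurable
    then show "(\<lambda>t. \<integral>\<^sup>+u. f ((\<lambda>j\<in>I. c j * u j)(i := t)) \<partial>Pi\<^sub>M I (\<lambda>_. lborel)) \<in> borel_measurable lborel"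
      by measurable
  qed
  also have "(\<integral>\<^sup>+t. (\<integral>\<^sup>+u. f ((\<lambda>j\<in>I. c j * u j)(i := t)) \<partial>Pi\<^sub>M I (\<lambda>_. lborel)) \<partial>lborel) =
      ennreal (c i) * (\<integral>\<^sup>+t. (\<integral>\<^sup>+u. f ((\<lambda>j\<in>I. c j * u j)(i := c i * t)) \<partial>Pi\<^sub>M I (\<lambda>_. lborel)) \<partial>lborel)"
  proof (subst nn_integral_real_affine[where c = "c i" and t = 0])
    interpret I: finite_product_sigma_finite "\<lambda>_. lborel :: real measure" I by standard simp
    have "(\<lambda>(t, u). f ((\<lambda>j\<in>I. c j * u j)(i := t))) \<in> borel_measurable (lborel \<Otimes>\<^sub>M Pi\<^sub>M I (\<lambda>_. lborel))"
      by measurable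
    then show "(\<lambda>t. \<integral>\<^sup>+u. f ((\<lambda>j\<in>I. c j * u j)(i := t)) \<partial>Pi\<^sub>M I (\<lambda>_. lborel)) \<in> borel_measurable borel"
      by measurable
  qed (use c in auto)
  also have "(\<integral>\<^sup>+t. (\<integral>\<^sup>+u. f ((\<lambda>j\<in>I. c j * u j)(i := c i * t)) \<partial>Pi\<^sub>M I (\<lambda>_. lborel)) \<partial>lborel) =
    (\<integral>\<^sup>+t. (\<integral>\<^sup>+u. f (\<lambda>j\<in>insert i I. c j * (u(i := t)) j) \<partial>Pi\<^sub>M I (\<lambda>_. lborel)) \<partial>lborel)"
    by (intro nn_integral_cong arg_cong[where f = f]) (auto simp: fun_eq_iff)
  also have "\<dots> = (\<integral>\<^sup>+u. f (\<lambda>j\<in>insert i I. c j * u j) \<partial>Pi\<^sub>M (insert i I) (\<lambda>_. lborel))"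
    by (rule product_nn_integral_insert_rev[symmetric]) (use meas_scale in auto)
  finally have eq: "(\<integral>\<^sup>+u. f u \<partial>Pi\<^sub>M (insert i I) (\<lambda>_. lborel)) = ennreal (\<Prod>j\<in>I. c j) *
    (ennreal (c i) * (\<integral>\<^sup>+u. f (\<lambda>j\<in>insert i I. c j * u j) \<partial>Pi\<^sub>M (insert i I) (\<lambda>_. lborel)))" .
  have "ennreal (\<Prod>j\<in>insert i I. c j) = ennreal (\<Prod>j\<in>I. c j) * ennreal (c i)"
    using c by (simp add: ennreal_mult prod_nonneg less_imp_le mult.commute)
  then show ?case unfolding eq by (simp only: mult.assoc)
qed

text \<open>Reduced to the increasing rule by reflecting the target variable. The decreasing form is
  needed because the zero \<open>x m\<close> moves to the left as the coefficient at
  \<open>y (Suc m)\<close> grows.\<close>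

lemma nn_integral_substitution_decreasing:
  fixes f :: "real \<Rightarrow> ennreal" and g h :: "real \<Rightarrow> real"
  assumes f: "f \<in> borel_measurable borel"
    and deriv: "\<And>x. x \<in> {a..b} \<Longrightarrow> (g has_real_derivative - h x) (at x)"
    and cont: "continuous_on {a..b} h"
    and nonneg: "\<And>x. x \<in> {a..b} \<Longrightarrow> 0 \<le> h x" and "a < b"
  shows "(\<integral>\<^sup>+t. f t * indicator {g b..g a} t \<partial>lborel) =
    (\<integral>\<^sup>+x. f (g x) * ennreal (h x) * indicator {a..b} x \<partial>lborel)"
proof -
  have "(\<integral>\<^sup>+t. f t * indicator {g b..g a} t \<partial>lborel) =
    (\<integral>\<^sup>+t. f (- t) * indicator {g b..g a} (- t) \<partial>lborel)"
    using f by (subst nn_integral_real_affine[of _ "-1" 0]) auto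
  also have "\<dots> = (\<integral>\<^sup>+t. f (- t) * indicator {- g a..- g b} t \<partial>lborel)"
    by (intro nn_integral_cong) (auto simp: indicator_def)
  also have "\<dots> = (\<integral>\<^sup>+x. f (- (- g x)) * ennreal (h x) * indicator {a..b} x \<partial>lborel)"
    using f \<open>a < b\<close> nonneg cont
    by (intro nn_integral_substitution_aux[where g = "\<lambda>x. - g x" and f = "\<lambda>t. f (- t)"])
       (auto intro!: derivative_eq_intros deriv)
  finally show ?thesis by simp
qed

section \<open>Partial fractions and the one-dimensional substitution\<close>

text \<open>Coefficient of \<open>1 / (y i - u)\<close> in the partial fraction expansion, that is,
  minus the residue at \<open>y i\<close>. It is \<open>xi\<close> for an arbitrary index set and
  field: peeling shrinks the index set, and the generating polynomial of the elementary symmetric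
  functions needs complex entries.\<close>

definition residue_coord :: "nat set \<Rightarrow> (nat \<Rightarrow> 'a) \<Rightarrow> (nat \<Rightarrow> 'a) \<Rightarrow> nat \<Rightarrow> 'a::field" where
  "residue_coord I y x i = (\<Prod>k\<in>I. x k - y i) / (\<Prod>k\<in>I - {i}. y k - y i)"

text \<open>Induction on the number of poles: a new factor \<open>(x a - u) / (y a - u)\<close>
  multiplies each old coefficient by the value of that factor at \<open>y i\<close>, and the new
  coefficient is \<open>x a - y a\<close> times the old function at \<open>y a\<close>, which the
  induction hypothesis expands.\<close>

lemma partial_fractions:
  fixes x y :: "nat \<Rightarrow> 'a::field"
  assumes "finite I" "inj_on y I" "u \<notin> y ` I"
  shows "(\<Prod>k\<in>I. (x k - u) / (y k - u)) = 1 + (\<Sum>i\<in>I. residue_coord I y x i / (y i - u))"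
  using assms
proof (induction I arbitrary: u rule: finite_induct)
  case (insert a I)
  have inj: "inj_on y I" "y a \<notin> y ` I" using insert by auto
  have ya: "y i - y a \<noteq> 0" "y i \<noteq> y a" "y i \<noteq> u" if "i \<in> I" for i
  proof -
    show "y i \<noteq> y a" using inj(2) that by (metis imageI)
    then show "y i - y a \<noteq> 0" by simp
    show "y i \<noteq> u" using that insert.prems(2) by auto
  qed
  have yau: "y a \<noteq> u" using insert by auto
  have a: "residue_coord (insert a I) y x a = (x a - y a) * (1 + (\<Sum>i\<in>I. residue_coord I y x i / (y i - y a)))"
    unfolding insert.IH[OF inj, symmetric] using insert.hyps by (simp add: residue_coord_def prod_dividef)
  have i: "residue_coord (insert a I) y x i = residue_coord I y x i * (x a - y i) / (y a - y i)"
    if "i \<in> I" for i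
  proof -
    have "insert a I - {i} = insert a (I - {i})" using that insert.hyps by auto
    then show ?thesis using insert.hyps by (simp add: residue_coord_def mult.commute)
  qed
  have "(\<Prod>k\<in>insert a I. (x k - u) / (y k - u)) =
      (x a - u) / (y a - u) * (1 + (\<Sum>i\<in>I. residue_coord I y x i / (y i - u)))"
    using insert by simp
  also have "\<dots> = 1 + (x a - y a) / (y a - u) + (\<Sum>i\<in>I. residue_coord I y x i * ((x a - u) / ((y a - u) * (y i - u))))"
  proof -
    have r: "(x a - u) / (y a - u) = 1 + (x a - y a) / (y a - u)" using yau by (simp add: divide_simps)
    have s: "(x a - u) / (y a - u) * (\<Sum>i\<in>I. residue_coord I y x i / (y i - u)) =
      (\<Sum>i\<in>I. residue_coord I y x i * ((x a - u) / ((y a - u) * (y i - u))))"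
      by (simp add: sum_distrib_left mult.commute)
    show ?thesis unfolding distrib_left mult_1_right s unfolding r ..
  qed
  \<comment> \<open>The product of two simple poles in \<open>u\<close> is separated; the parts with
    pole \<open>y a\<close> are collected into the new coefficient afterwards.\<close>
  also have "(\<Sum>i\<in>I. residue_coord I y x i * ((x a - u) / ((y a - u) * (y i - u)))) =
     (\<Sum>i\<in>I. residue_coord I y x i * ((x a - y i) / ((y a - y i) * (y i - u)) + (x a - y a) / ((y i - y a) * (y a - u))))"
  proof (intro sum.cong refl arg_cong2[where f = "(*)"])
    fix i assume "i \<in> I"
    have *: "(p - u) / ((q - u) * (r - u)) = (p - r) / ((q - r) * (r - u)) + (p - q) / ((r - q) * (q - u))"
      if "q \<noteq> u" "r \<noteq> u" "r \<noteq> q" for p q r :: 'a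
    proof -
      have "(p - r) / ((q - r) * (r - u)) = (r - p) / ((r - q) * (r - u))"
        by (metis minus_diff_eq minus_divide_divide minus_mult_left)
      moreover have "q - u \<noteq> 0" "r - u \<noteq> 0" "r - q \<noteq> 0" using that by auto
      ultimately show ?thesis by (simp add: divide_simps) (simp add: algebra_simps)
    qed
    show "(x a - u) / ((y a - u) * (y i - u)) =
        (x a - y i) / ((y a - y i) * (y i - u)) + (x a - y a) / ((y i - y a) * (y a - u))"
      using * ya[OF \<open>i \<in> I\<close>] yau by blast
  qed
  also have "\<dots> = (\<Sum>i\<in>I. residue_coord (insert a I) y x i / (y i - u)) +
      (x a - y a) / (y a - u) * (\<Sum>i\<in>I. residue_coord I y x i / (y i - y a))"
    unfolding sum_distrib_left sum.distrib[symmetric]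
    by (intro sum.cong refl) (simp add: i distrib_left mult.commute)
  also have "1 + (x a - y a) / (y a - u) + \<dots> =
    1 + residue_coord (insert a I) y x a / (y a - u) + (\<Sum>i\<in>I. residue_coord (insert a I) y x i / (y i - u))"
    unfolding a by (simp add: distrib_left add_divide_distrib)
  finally show ?case using insert.hyps by (simp add: add.assoc)
qed simp

text \<open>Fix all coefficients except those at the two smallest poles \<open>y0\<close> and
  \<open>y1\<close>, and let the constraint determine the one at \<open>y0\<close> as
  \<open>y0 * (C - t / y1)\<close>. The equation saying that \<open>a\<close> is a zero of the
  partial fraction function, solved for the coefficient \<open>t\<close> at \<open>y1\<close>, reads
  \<open>t = g a\<close>, and \<open>h\<close> is minus the derivative of \<open>g\<close>. Thus the
  coordinate \<open>t\<close> is replaced by the zero \<open>a\<close> between \<open>y0\<close> and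
  \<open>y1\<close>.\<close>

lemma nn_integral_slice_substitution:
  fixes C y0 y1 :: real and v w :: "nat \<Rightarrow> real"
  assumes y: "0 < y0" "y0 < y1" and I: "finite I" "\<And>i. i \<in> I \<Longrightarrow> y1 < v i" "\<And>i. i \<in> I \<Longrightarrow> 0 < w i"
    and f: "f \<in> borel_measurable borel"
  defines "b \<equiv> \<lambda>a. y0 * C - (a - y0) * (1 + (\<Sum>i\<in>I. w i / (v i - a)))"
  defines "g \<equiv> \<lambda>a. y1 / (y1 - y0) * ((y1 - a) / a * b a)"
  defines "h \<equiv> \<lambda>a. y1 / (y1 - y0) *
    (y1 / a\<^sup>2 * b a + (y1 - a) / a * (1 + (\<Sum>i\<in>I. w i * (v i - y0) / (v i - a)\<^sup>2)))"
  shows "(\<integral>\<^sup>+t. f t * indicator {0<..<y1 * C} t \<partial>lborel) =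
    (\<integral>\<^sup>+a. f (g a) * ennreal (h a) * indicator {a. y0 < a \<and> a < y1 \<and> 0 < b a} a \<partial>lborel)"
proof (cases "0 < C")
  case False
  have "\<not> 0 < b a" if "y0 < a" "a < y1" for a
  proof -
    have "0 \<le> (\<Sum>i\<in>I. w i / (v i - a))" using I that by (intro sum_nonneg) (force simp: field_simps)
    then have "0 \<le> (a - y0) * (1 + (\<Sum>i\<in>I. w i / (v i - a)))" using that by auto
    moreover have "y0 * C \<le> 0" using False y by (simp add: mult_le_0_iff)
    ultimately show ?thesis by (simp add: b_def)
  qed
  then have *: "{a. y0 < a \<and> a < y1 \<and> 0 < b a} = {}" by auto
  have "y1 * C \<le> 0" using False y by (intro mult_nonneg_nonpos) auto
  then have **: "{0<..<y1 * C} = {}" by auto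
  show ?thesis unfolding * ** by simp
next
  case C: True
  have b_less: "b a' < b a" if "y0 \<le> a" "a < a'" "a' \<le> y1" for a a'
  proof -
    have nn: "0 \<le> w i / (v i - a)" "w i / (v i - a) \<le> w i / (v i - a')" if "i \<in> I" for i
      using I(2,3)[OF that] \<open>a < a'\<close> \<open>a' \<le> y1\<close> by (auto simp: less_imp_le intro!: divide_left_mono)
    have "0 \<le> (\<Sum>i\<in>I. w i / (v i - a))" "(\<Sum>i\<in>I. w i / (v i - a)) \<le> (\<Sum>i\<in>I. w i / (v i - a'))"
      using nn by (auto intro: sum_nonneg sum_mono)
    then have "(a - y0) * (1 + (\<Sum>i\<in>I. w i / (v i - a))) < (a' - y0) * (1 + (\<Sum>i\<in>I. w i / (v i - a')))"
      using that by (intro mult_less_le_imp_less) auto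
    then show ?thesis by (simp add: b_def)
  qed
  have deriv_b: "(b has_real_derivative - (1 + (\<Sum>i\<in>I. w i * (v i - y0) / (v i - a)\<^sup>2))) (at a)"
    if "y0 \<le> a" "a \<le> y1" for a
  proof -
    have va: "v i - a \<noteq> 0" "v i \<noteq> a" "a \<noteq> v i" if "i \<in> I" for i using I(2)[OF that] \<open>a \<le> y1\<close> by auto
    have "(b has_real_derivative 0 - (1 * (1 + (\<Sum>i\<in>I. w i / (v i - a))) +
        (0 + (\<Sum>i\<in>I. w i / (v i - a)\<^sup>2)) * (a - y0))) (at a)"
      unfolding b_def
      by (intro DERIV_diff DERIV_const DERIV_mult DERIV_add DERIV_sum)
        (auto intro!: derivative_eq_intros dest: va simp: power2_eq_square)
    also have "0 - (1 * (1 + (\<Sum>i\<in>I. w i / (v i - a))) + (0 + (\<Sum>i\<in>I. w i / (v i - a)\<^sup>2)) * (a - y0)) =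
       - (1 + (\<Sum>i\<in>I. w i / (v i - a) + w i / (v i - a)\<^sup>2 * (a - y0)))"
      by (simp add: sum.distrib sum_distrib_right)
    also have "(\<Sum>i\<in>I. w i / (v i - a) + w i / (v i - a)\<^sup>2 * (a - y0)) = (\<Sum>i\<in>I. w i * (v i - y0) / (v i - a)\<^sup>2)"
    proof (intro sum.cong refl)
      fix i assume "i \<in> I"
      then have "w i / (v i - a) = w i * (v i - a) / (v i - a)\<^sup>2" using va by (simp add: power2_eq_square)
      then show "w i / (v i - a) + w i / (v i - a)\<^sup>2 * (a - y0) = w i * (v i - y0) / (v i - a)\<^sup>2"
        by (simp add: algebra_simps flip: add_divide_distrib diff_divide_distrib)
    qed
    finally show ?thesis .
  qed
  have deriv_g: "(g has_real_derivative - h a) (at a)" if "y0 \<le> a" "a \<le> y1" for a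
  proof -
    have a: "a \<noteq> 0" using that y by auto
    have 1: "((\<lambda>a. (y1 - a) / a) has_real_derivative - (y1 / a\<^sup>2)) (at a)"
      using a by (auto intro!: derivative_eq_intros simp: divide_simps power2_eq_square)
    have *: "c * (- p * q + - s * r) = - (c * (p * q + r * s))" for c p q r s :: real
      by (simp add: algebra_simps)
    show ?thesis unfolding g_def h_def
      by (rule DERIV_cong[OF DERIV_cmult[OF DERIV_mult[OF 1 deriv_b[OF that]]]]) (rule *)
  qed
  have cont_b: "continuous_on {y0..y1} b"
    using deriv_b by (intro DERIV_continuous_on) (auto intro: has_field_derivative_at_within)
  have cont_h: "continuous_on {y0..y1} h"
    unfolding h_def using cont_b y I(2)
    by (intro continuous_intros) (auto dest!: I(2))
  have b0: "0 < b y0" using C y by (simp add: b_def)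
  \<comment> \<open>Right end of the range of \<open>a\<close>: \<open>g\<close> contains the factor
    \<open>(y1 - a) * b a\<close>, so it reaches 0 at \<open>y1\<close> or at the zero of
    \<open>b\<close>, whichever comes first.\<close>
  define s where "s = (if 0 \<le> b y1 then y1 else SOME s. y0 \<le> s \<and> s \<le> y1 \<and> b s = 0)"
  have s: "y0 < s \<and> s \<le> y1 \<and> g s = 0 \<and> (\<forall>a. y0 < a \<and> a < y1 \<longrightarrow> (0 < b a \<longleftrightarrow> a < s)) \<and> 0 \<le> b s"
  proof (cases "0 \<le> b y1")
    case True
    then have "s = y1" by (simp add: s_def)
    moreover have "0 < b a" if "y0 < a" "a < y1" for a using b_less[of a y1] True that by auto
    ultimately show ?thesis using y True by (auto simp: g_def)
  next
    case False
    have "\<exists>s\<ge>y0. s \<le> y1 \<and> b s = 0"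
      by (rule IVT2') (use False b0 y cont_b in auto)
    then have "\<exists>s. y0 \<le> s \<and> s \<le> y1 \<and> b s = 0" by blast
    then have *: "y0 \<le> s \<and> s \<le> y1 \<and> b s = 0" using False someI_ex[of "\<lambda>s. y0 \<le> s \<and> s \<le> y1 \<and> b s = 0"]
      by (simp add: s_def)
    then have "y0 < s" using b0 by (cases "s = y0") auto
    moreover have "0 < b a \<longleftrightarrow> a < s" if "y0 < a" "a < y1" for a
      using b_less[of a s] b_less[of s a] * that by (cases a s rule: linorder_cases) auto
    ultimately show ?thesis using * by (auto simp: g_def)
  qed
  have b_nonneg: "0 \<le> b a" if "y0 \<le> a" "a \<le> s" for a
    using b_less[of a s] s that by (cases "a = s") auto
  have h_nonneg: "0 \<le> h a" if "a \<in> {y0..s}" for a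
  proof -
    have "0 \<le> (\<Sum>i\<in>I. w i * (v i - y0) / (v i - a)\<^sup>2)"
    proof (intro sum_nonneg divide_nonneg_nonneg mult_nonneg_nonneg)
      fix i assume "i \<in> I"
      then show "0 \<le> w i" "0 \<le> v i - y0" using I y by (auto intro: less_imp_le less_trans)
    qed simp
    then show ?thesis using b_nonneg[of a] that s y unfolding h_def
      by (intro mult_nonneg_nonneg add_nonneg_nonneg divide_nonneg_nonneg) auto
  qed
  have gy0: "g y0 = y1 * C" using y by (simp add: g_def b_def)
  have "(\<integral>\<^sup>+t. f t * indicator {0<..<y1 * C} t \<partial>lborel) = (\<integral>\<^sup>+t. f t * indicator {g s..g y0} t \<partial>lborel)"
  proof (rule nn_integral_cong_AE)
    have "AE t in lborel. t \<noteq> 0" "AE t in lborel. t \<noteq> y1 * C" by (auto intro: AE_lborel_singleton)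
    then show "AE t in lborel. f t * indicator {0<..<y1 * C} t = f t * indicator {g s..g y0} t"
      by eventually_elim (auto simp: s gy0 indicator_def)
  qed
  also have "\<dots> = (\<integral>\<^sup>+x. f (g x) * ennreal (h x) * indicator {y0..s} x \<partial>lborel)"
  proof (rule nn_integral_substitution_decreasing[OF f])
    show "continuous_on {y0..s} h" by (rule continuous_on_subset[OF cont_h]) (use s in auto)
  qed (use s deriv_g h_nonneg in auto)
  also have "\<dots> = (\<integral>\<^sup>+a. f (g a) * ennreal (h a) * indicator {a. y0 < a \<and> a < y1 \<and> 0 < b a} a \<partial>lborel)"
  proof (rule nn_integral_cong_AE)
    have "AE t in lborel. t \<noteq> y0" "AE t in lborel. t \<noteq> s" by (auto intro: AE_lborel_singleton)
    then show "AE x in lborel. f (g x) * ennreal (h x) * indicator {y0..s} x =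
        f (g x) * ennreal (h x) * indicator {a. y0 < a \<and> a < y1 \<and> 0 < b a} x"
      by eventually_elim (use s in \<open>auto simp: indicator_def\<close>)
  qed
  finally show ?thesis .
qed

text \<open>
  The indices run from \<open>m\<close> to \<open>n\<close> because the induction splits off the smallest coordinate.
  On a slice \<open>\<Prod>i. x i = Z * (\<Prod>i. y i)\<close> the free coordinates are \<open>x m, \<dots>, x (n - 1)\<close>, whereas
  on the corresponding simplex \<open>\<Sum>i. \<xi> i / y i = Z - 1\<close> they are \<open>\<xi> (m + 1), \<dots>, \<xi> n\<close>. With this
  choice the coordinate \<open>x m\<close> replaces \<open>\<xi> (m + 1)\<close> in a monotone way.
\<close>

definition vandermonde_on :: "nat \<Rightarrow> nat \<Rightarrow> (nat \<Rightarrow> real) \<Rightarrow> real" where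
  "vandermonde_on m n x = (\<Prod>j\<in>{m..n}. \<Prod>i\<in>{m..<j}. x j - x i)"

definition slice_point :: "nat \<Rightarrow> nat \<Rightarrow> (nat \<Rightarrow> real) \<Rightarrow> real \<Rightarrow> (nat \<Rightarrow> real) \<Rightarrow> nat \<Rightarrow> real" where
  "slice_point m n y Z x = x(n := Z * (\<Prod>i\<in>{m..n}. y i) / (\<Prod>i\<in>{m..<n}. x i))"

definition interlaced :: "nat \<Rightarrow> nat \<Rightarrow> (nat \<Rightarrow> real) \<Rightarrow> (nat \<Rightarrow> real) set" where
  "interlaced m n y = {x. (\<forall>i\<in>{m..n}. y i < x i) \<and> (\<forall>i\<in>{m..<n}. x i < y (Suc i))}"

text \<open>The quotient of Vandermonde products is the Jacobian of the residue coordinates; the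
  divisor is the derivative of the product constraint in the last coordinate, left behind by the
  delta function. An arbitrary nonnegative \<open>F\<close> of the residue coordinates is carried
  along so that the induction can modify it.\<close>

definition slice_integrand ::
  "nat \<Rightarrow> nat \<Rightarrow> (nat \<Rightarrow> real) \<Rightarrow> real \<Rightarrow> ((nat \<Rightarrow> real) \<Rightarrow> ennreal) \<Rightarrow> (nat \<Rightarrow> real) \<Rightarrow> ennreal" where
  "slice_integrand m n y Z F x =
     indicator (interlaced m n y) (slice_point m n y Z x) *
     ennreal (vandermonde_on m n (slice_point m n y Z x) / vandermonde_on m n y / (\<Prod>i\<in>{m..<n}. x i)) *
     F (\<lambda>i\<in>{m..n}. residue_coord {m..n} y (slice_point m n y Z x) i)"

text \<open>The constraint, multiplied by the product of all \<open>y i\<close>, is solved for the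
  coefficient at \<open>y m\<close>. Its derivative in that coefficient is the product of the
  remaining \<open>y i\<close>, which explains the divisor.\<close>

definition simplex_integrand ::
  "nat \<Rightarrow> nat \<Rightarrow> (nat \<Rightarrow> real) \<Rightarrow> real \<Rightarrow> ((nat \<Rightarrow> real) \<Rightarrow> ennreal) \<Rightarrow> (nat \<Rightarrow> real) \<Rightarrow> ennreal" where
  "simplex_integrand m n y Z F u =
     indicator {u. (\<forall>i\<in>{Suc m..n}. 0 < u i) \<and> (\<Sum>i\<in>{Suc m..n}. u i / y i) < Z - 1} u *
     ennreal (1 / (\<Prod>i\<in>{Suc m..n}. y i)) *
     F (\<lambda>i\<in>{m..n}. if i = m then y m * (Z - 1 - (\<Sum>i\<in>{Suc m..n}. u i / y i)) else u i)"

definition chain_on :: "nat \<Rightarrow> nat \<Rightarrow> (nat \<Rightarrow> real) \<Rightarrow> bool" where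
  "chain_on m n y \<longleftrightarrow> 0 < y m \<and> (\<forall>i\<in>{m..<n}. y i < y (Suc i))"

lemma chain_on_less:
  assumes "chain_on m n y" "m \<le> i" "i < j" "j \<le> n" shows "y i < y j"
  using assms(3,4)
proof (induction j)
  case (Suc j)
  then have "y j < y (Suc j)" using assms by (auto simp: chain_on_def)
  with Suc show ?case by (cases "i = j") auto
qed simp

lemma chain_on_pos:
  assumes "chain_on m n y" "m \<le> i" "i \<le> n" shows "0 < y i"
  using assms chain_on_less[of m n y m i] by (cases "i = m") (auto simp: chain_on_def intro: less_trans)

lemma chain_on_Suc: "chain_on m n y \<Longrightarrow> m < n \<Longrightarrow> chain_on (Suc m) n y"
  using chain_on_pos[of m n y "Suc m"] by (auto simp: chain_on_def)

lemma chain_on_inj: "chain_on m n y \<Longrightarrow> inj_on y {m..n}"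
  using chain_on_less[of m n y] by (intro linorder_inj_onI) (auto simp: less_le)

lemma vandermonde_on_Suc:
  assumes "m < n"
  shows "vandermonde_on m n x = (\<Prod>k\<in>{Suc m..n}. x k - x m) * vandermonde_on (Suc m) n x"
proof -
  have "vandermonde_on m n x = (\<Prod>j\<in>{Suc m..n}. \<Prod>i\<in>{m..<j}. x j - x i)"
    using assms by (simp add: vandermonde_on_def atLeastAtMost_insertL[symmetric] del: atLeastAtMost_insertL)
  also have "\<dots> = (\<Prod>j\<in>{Suc m..n}. (x j - x m) * (\<Prod>i\<in>{Suc m..<j}. x j - x i))"
    by (intro prod.cong refl) (simp add: prod.atLeast_Suc_lessThan)
  finally show ?thesis by (simp add: prod.distrib vandermonde_on_def)
qed

lemma vandermonde_on_pos:
  assumes "\<And>i j. m \<le> i \<Longrightarrow> i < j \<Longrightarrow> j \<le> n \<Longrightarrow> x i < x j"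
  shows "0 < vandermonde_on m n x"
  unfolding vandermonde_on_def using assms by (intro prod_pos) auto

lemma slice_integrand_measurable:
  assumes F: "F \<in> borel_measurable (Pi\<^sub>M {m..n} (\<lambda>_. borel))" and "m \<le> n"
  shows "slice_integrand m n y Z F \<in> borel_measurable (Pi\<^sub>M {m..<n} (\<lambda>_. lborel))"
proof -
  have [measurable]: "(\<lambda>x. slice_point m n y Z x i) \<in> borel_measurable (Pi\<^sub>M {m..<n} (\<lambda>_. lborel))"
    if "i \<in> {m..n}" for i
  proof (cases "i = n")
    case False
    then have "i \<in> {m..<n}" using that by auto
    then show ?thesis using False by (simp add: slice_point_def)
  qed (simp add: slice_point_def)
  have [measurable]: "(\<lambda>x. F (\<lambda>i\<in>{m..n}. residue_coord {m..n} y (slice_point m n y Z x) i))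
     \<in> borel_measurable (Pi\<^sub>M {m..<n} (\<lambda>_. lborel))"
    by (rule measurable_compose[OF _ F]) (unfold residue_coord_def, measurable)
  have [measurable]: "(\<lambda>x. vandermonde_on m n (slice_point m n y Z x)) \<in> borel_measurable (Pi\<^sub>M {m..<n} (\<lambda>_. lborel))"
    unfolding vandermonde_on_def by (intro borel_measurable_prod borel_measurable_diff) auto
  have [measurable]: "Measurable.pred (Pi\<^sub>M {m..<n} (\<lambda>_. lborel)) (\<lambda>x. slice_point m n y Z x \<in> interlaced m n y)"
    unfolding interlaced_def mem_Collect_eq
    by (intro pred_intros_logic pred_intros_finite finite_atLeastAtMost finite_atLeastLessThan
        borel_measurable_pred_less borel_measurable_const) auto
  have eq: "indicator (interlaced m n y) (slice_point m n y Z x) =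
     (indicator {x. slice_point m n y Z x \<in> interlaced m n y} x :: ennreal)" for x
    by (simp add: indicator_def)
  show ?thesis unfolding slice_integrand_def eq by measurable
qed

lemma simplex_integrand_measurable:
  assumes F: "F \<in> borel_measurable (Pi\<^sub>M {m..n} (\<lambda>_. borel))" and "m \<le> n"
  shows "simplex_integrand m n y Z F \<in> borel_measurable (Pi\<^sub>M {Suc m..n} (\<lambda>_. lborel))"
proof -
  have [measurable]: "(\<lambda>u. F (\<lambda>i\<in>{m..n}. if i = m then y m * (Z - 1 - (\<Sum>i\<in>{Suc m..n}. u i / y i)) else u i))
     \<in> borel_measurable (Pi\<^sub>M {Suc m..n} (\<lambda>_. lborel))"
  proof (rule measurable_compose[OF measurable_restrict F])
    fix i assume i: "i \<in> {m..n}"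
    show "(\<lambda>u. if i = m then y m * (Z - 1 - (\<Sum>i\<in>{Suc m..n}. u i / y i)) else u i)
      \<in> borel_measurable (Pi\<^sub>M {Suc m..n} (\<lambda>_. lborel))"
    proof (cases "i = m")
      case False
      then have "i \<in> {Suc m..n}" using i by auto
      with False show ?thesis by simp
    qed simp
  qed
  show ?thesis unfolding simplex_integrand_def by measurable
qed

text \<open>
  Dividing \<open>1 - (\<Sum>i. \<xi> i / (u - y i))\<close> by \<open>(u - a) / (u - y m)\<close>, where \<open>a = x m\<close>, leaves a function of
  the same kind with residues \<open>\<zeta> i = \<xi> i * (y i - y m) / (y i - a)\<close>.
\<close>

definition peeled ::
  "nat \<Rightarrow> nat \<Rightarrow> (nat \<Rightarrow> real) \<Rightarrow> ((nat \<Rightarrow> real) \<Rightarrow> ennreal) \<Rightarrow> real \<Rightarrow> (nat \<Rightarrow> real) \<Rightarrow> ennreal" where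
  "peeled m n y F a u =
     ennreal (1 + (\<Sum>i\<in>{Suc m..n}. u i / (y i - a))) *
     F (\<lambda>i\<in>{m..n}. if i = m then (a - y m) * (1 + (\<Sum>i\<in>{Suc m..n}. u i / (y i - y m)))
                   else u i * ((y i - a) / (y i - y m)))"

lemma peeled_measurable:
  assumes F: "F \<in> borel_measurable (Pi\<^sub>M {m..n} (\<lambda>_. borel))" and "m \<le> n"
  shows "peeled m n y F a \<in> borel_measurable (Pi\<^sub>M {Suc m..n} (\<lambda>_. borel))"
proof -
  have [measurable]: "(\<lambda>u. F (\<lambda>i\<in>{m..n}. if i = m then (a - y m) * (1 + (\<Sum>i\<in>{Suc m..n}. u i / (y i - y m)))
                   else u i * ((y i - a) / (y i - y m)))) \<in> borel_measurable (Pi\<^sub>M {Suc m..n} (\<lambda>_. borel))"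
  proof (rule measurable_compose[OF measurable_restrict F])
    fix i assume i: "i \<in> {m..n}"
    show "(\<lambda>u. if i = m then (a - y m) * (1 + (\<Sum>i\<in>{Suc m..n}. u i / (y i - y m)))
                   else u i * ((y i - a) / (y i - y m))) \<in> borel_measurable (Pi\<^sub>M {Suc m..n} (\<lambda>_. borel))"
    proof (cases "i = m")
      case False
      then have "i \<in> {Suc m..n}" using i by auto
      with False show ?thesis by simp
    qed simp
  qed
  show ?thesis unfolding peeled_def by measurable
qed

section \<open>Peeling off the smallest coordinate\<close>

text \<open>With \<open>x m = a\<close> fixed, the remaining coordinates satisfy the product
  constraint with \<open>Z * y m / a\<close>. The Vandermonde quotient sheds the factors
  \<open>(q k - a) / (y k - y m)\<close>. Each is split into \<open>(y k - a) / (y k - y m)\<close>,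
  which goes into the constant, and \<open>(q k - a) / (y k - a)\<close>; the product of the latter
  is the partial fraction function of the remaining points at \<open>a\<close>, the first factor of
  \<open>peeled\<close>.\<close>

lemma slice_integrand_peel:
  assumes y: "chain_on m n y" and "m < n" and a: "y m < a" "a < y (Suc m)"
  shows "slice_integrand m n y Z F (x(m := a)) =
    ennreal ((\<Prod>i\<in>{Suc m..n}. (y i - a) / (y i - y m)) / a) *
    slice_integrand (Suc m) n y (Z * y m / a) (peeled m n y F a) x"
proof -
  define p where "p = slice_point m n y Z (x(m := a))"
  define q where "q = slice_point (Suc m) n y (Z * y m / a) x"
  have a0: "0 < a" using chain_on_pos[OF y, of m] a \<open>m < n\<close> by auto
  have "(\<Prod>i\<in>{m..n}. y i) = y m * (\<Prod>i\<in>{Suc m..n}. y i)"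
    using \<open>m < n\<close> by (simp add: prod.atLeast_Suc_atMost)
  moreover have "(\<Prod>i\<in>{m..<n}. (x(m := a)) i) = a * (\<Prod>i\<in>{Suc m..<n}. x i)"
    using \<open>m < n\<close> by (simp add: prod.atLeast_Suc_lessThan)
  ultimately have pq: "p = q(m := a)"
    using \<open>m < n\<close> by (auto simp: p_def q_def slice_point_def)
  have inter: "p \<in> interlaced m n y \<longleftrightarrow> q \<in> interlaced (Suc m) n y"
  proof -
    have *: "{m..n} = insert m {Suc m..n}" "{m..<n} = insert m {Suc m..<n}" using \<open>m < n\<close> by auto
    show ?thesis unfolding interlaced_def * using a by (auto simp: pq)
  qed
  show ?thesis
  proof (cases "q \<in> interlaced (Suc m) n y")
    case False
    then show ?thesis using inter by (simp add: slice_integrand_def p_def q_def)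
  next
    case True
    have yy: "y i < q i" "y (Suc m) \<le> y i" "y m < y i" "a < y i" "0 < q i" if "i \<in> {Suc m..n}" for i
    proof -
      show 1: "y i < q i" using that True by (auto simp: interlaced_def)
      show 2: "y (Suc m) \<le> y i" using that chain_on_less[OF y, of "Suc m" i] by (cases "i = Suc m") auto
      show 3: "y m < y i" using that chain_on_less[OF y, of m i] by auto
      show "a < y i" using 2 a by simp
      show "0 < q i" using 1 chain_on_pos[OF y, of i] that by auto
    qed
    have inj: "inj_on y {Suc m..n}" using chain_on_inj[OF y] by (rule inj_on_subset) auto
    let ?r = "residue_coord {Suc m..n} y q"
    let ?r' = "\<lambda>i\<in>{Suc m..n}. ?r i"
    have pf: "(\<Prod>k\<in>{Suc m..n}. (q k - u) / (y k - u)) = 1 + (\<Sum>i\<in>{Suc m..n}. ?r i / (y i - u))"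
      if "u < y (Suc m)" for u
      by (rule partial_fractions) (use inj yy(2) that in force)+
    have ins: "{m..n} = insert m {Suc m..n}" using \<open>m < n\<close> by auto
    have r_m: "residue_coord {m..n} y p m = (a - y m) * (1 + (\<Sum>i\<in>{Suc m..n}. ?r i / (y i - y m)))"
    proof -
      have "residue_coord {m..n} y p m = (a - y m) * (\<Prod>k\<in>{Suc m..n}. (q k - y m) / (y k - y m))"
        by (simp add: residue_coord_def ins pq prod_dividef)
      then show ?thesis using pf[of "y m"] a by simp
    qed
    have r_i: "residue_coord {m..n} y p i = ?r i * ((y i - a) / (y i - y m))" if "i \<in> {Suc m..n}" for i
    proof -
      have *: "{m..n} - {i} = insert m ({Suc m..n} - {i})" using that \<open>m < n\<close> by auto
      have 1: "(\<Prod>k\<in>{m..n}. p k - y i) = (a - y i) * (\<Prod>k\<in>{Suc m..n}. q k - y i)"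
        by (simp add: ins pq)
      have 2: "(\<Prod>k\<in>{m..n} - {i}. y k - y i) = (y m - y i) * (\<Prod>k\<in>{Suc m..n} - {i}. y k - y i)"
        unfolding * by simp
      have 3: "(a - y i) / (y m - y i) = (y i - a) / (y i - y m)"
        by (metis minus_diff_eq minus_divide_divide)
      show ?thesis
        unfolding residue_coord_def 1 2 times_divide_times_eq[symmetric] 3 by (rule mult.commute)
    qed
    have F: "F (\<lambda>i\<in>{m..n}. residue_coord {m..n} y p i) =
       F (\<lambda>i\<in>{m..n}. if i = m then (a - y m) * (1 + (\<Sum>i\<in>{Suc m..n}. ?r' i / (y i - y m)))
                   else ?r' i * ((y i - a) / (y i - y m)))"
    proof (rule arg_cong[where f = F], rule ext)
      fix i
      show "(\<lambda>i\<in>{m..n}. residue_coord {m..n} y p i) i =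
        (\<lambda>i\<in>{m..n}. if i = m then (a - y m) * (1 + (\<Sum>i\<in>{Suc m..n}. ?r' i / (y i - y m)))
                   else ?r' i * ((y i - a) / (y i - y m))) i"
        using \<open>m < n\<close> r_m r_i[of i] by (cases "i = m"; cases "i \<in> {Suc m..n}") auto
    qed
    have vd: "vandermonde_on m n p = (\<Prod>k\<in>{Suc m..n}. q k - a) * vandermonde_on (Suc m) n q"
    proof -
      have "vandermonde_on (Suc m) n p = vandermonde_on (Suc m) n q"
        unfolding vandermonde_on_def by (intro prod.cong refl) (auto simp: pq)
      moreover have "(\<Prod>k\<in>{Suc m..n}. p k - p m) = (\<Prod>k\<in>{Suc m..n}. q k - a)"
        by (intro prod.cong refl) (auto simp: pq)
      ultimately show ?thesis using \<open>m < n\<close> by (simp add: vandermonde_on_Suc)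
    qed
    have vpos: "0 < vandermonde_on (Suc m) n q" "0 < vandermonde_on (Suc m) n y"
    proof -
      show "0 < vandermonde_on (Suc m) n y"
        by (rule vandermonde_on_pos) (use chain_on_less[OF y] in auto)
      have "q i < q j" if "Suc m \<le> i" "i < j" "j \<le> n" for i j
      proof -
        have "q i < y (Suc i)" using True that by (auto simp: interlaced_def)
        also have "y (Suc i) \<le> y j" using chain_on_less[OF y, of "Suc i" j] that by (cases "Suc i = j") auto
        also have "y j < q j" using yy(1) that by auto
        finally show ?thesis .
      qed
      then show "0 < vandermonde_on (Suc m) n q" by (rule vandermonde_on_pos)
    qed
    have xpos: "0 < (\<Prod>i\<in>{Suc m..<n}. x i)"
    proof (rule prod_pos)
      fix i assume i: "i \<in> {Suc m..<n}"
      then have "q i = x i" by (auto simp: q_def slice_point_def)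
      then show "0 < x i" using yy(5)[of i] i by auto
    qed
    let ?S = "1 + (\<Sum>i\<in>{Suc m..n}. ?r i / (y i - a))"
    let ?c = "\<Prod>i\<in>{Suc m..n}. (y i - a) / (y i - y m)"
    have S: "?S = (\<Prod>k\<in>{Suc m..n}. q k - a) / (\<Prod>k\<in>{Suc m..n}. y k - a)"
      using pf[OF a(2)] by (simp add: prod_dividef)
    have prod_pos': "0 < (\<Prod>k\<in>{Suc m..n}. y k - a)" "0 < (\<Prod>k\<in>{Suc m..n}. q k - a)"
      "0 < (\<Prod>k\<in>{Suc m..n}. y k - y m)"
      using yy by (intro prod_pos; force)+
    have "vandermonde_on m n p / vandermonde_on m n y / (\<Prod>i\<in>{m..<n}. (x(m := a)) i) =
      ?c / a * (vandermonde_on (Suc m) n q / vandermonde_on (Suc m) n y / (\<Prod>i\<in>{Suc m..<n}. x i)) * ?S"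
    proof -
      have *: "v * Q / (w * V) / (b * X) = c / w / b * (Q / V / X) * (v / c)" if "c \<noteq> 0"
        for v Q w V b X c :: real using that by (simp add: field_simps)
      show ?thesis
        unfolding vd S vandermonde_on_Suc[OF \<open>m < n\<close>, of y] prod_dividef
        \<open>(\<Prod>i\<in>{m..<n}. (x(m := a)) i) = _\<close>
        by (rule *) (use prod_pos'(1) in linarith)
    qed
    then have "ennreal (vandermonde_on m n p / vandermonde_on m n y / (\<Prod>i\<in>{m..<n}. (x(m := a)) i)) =
      ennreal (?c / a) * ennreal (vandermonde_on (Suc m) n q / vandermonde_on (Suc m) n y / (\<Prod>i\<in>{Suc m..<n}. x i)) * ennreal ?S"
    proof -
      have c0: "0 \<le> ?c / a" using prod_pos' a0 by (simp add: prod_dividef)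
      have v0: "0 \<le> vandermonde_on (Suc m) n q / vandermonde_on (Suc m) n y / (\<Prod>i\<in>{Suc m..<n}. x i)"
        using vpos xpos by simp
      have S0: "0 \<le> ?S" unfolding S using prod_pos' by simp
      show ?thesis
        unfolding \<open>vandermonde_on m n p / _ / _ = _\<close> by (subst ennreal_mult[OF mult_nonneg_nonneg[OF c0 v0] S0], subst ennreal_mult[OF c0 v0], rule refl)
    qed
    moreover have "peeled m n y F a ?r' = ennreal ?S * F (\<lambda>i\<in>{m..n}. residue_coord {m..n} y p i)"
      unfolding peeled_def F by simp
    ultimately show ?thesis
      using True inter unfolding slice_integrand_def p_def[symmetric] q_def[symmetric]
      by (simp add: mult.assoc)
  qed
qed

lemma slice_integrand_outside:
  assumes "m < n" and "\<not> (y m < a \<and> a < y (Suc m))"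
  shows "slice_integrand m n y Z F (x(m := a)) = 0"
proof -
  have "slice_point m n y Z (x(m := a)) \<notin> interlaced m n y"
  proof
    assume *: "slice_point m n y Z (x(m := a)) \<in> interlaced m n y"
    have "slice_point m n y Z (x(m := a)) m = a" using \<open>m < n\<close> by (simp add: slice_point_def)
    with * assms show False by (force simp: interlaced_def)
  qed
  then show ?thesis by (simp add: slice_integrand_def)
qed

text \<open>The counterpart on the simplex side. The scaling \<open>c i\<close> inverts the passage
  from \<xi> to the coordinates of the smaller simplex, and \<open>t\<close> is the coefficient at
  \<open>y (Suc m)\<close> for which \<open>a\<close> is a zero. In these coordinates region and
  density become those of the smaller simplex with \<open>Z * y m / a\<close>.\<close>

lemma simplex_integrand_peel:
  fixes y :: "nat \<Rightarrow> real" and Z :: real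
  assumes y: "chain_on m n y" and "m < n" and a: "y m < a" "a < y (Suc m)"
    and u: "\<forall>i\<in>{Suc (Suc m)..n}. 0 < u i"
  defines "J \<equiv> {Suc (Suc m)..n}"
  defines "c \<equiv> \<lambda>i. (y i - a) / (y i - y m)"
  defines "C \<equiv> Z - 1 - (\<Sum>i\<in>J. c i * u i / y i)"
  defines "b \<equiv> y m * C - (a - y m) * (1 + (\<Sum>i\<in>J. c i * u i / (y i - a)))"
  defines "t \<equiv> y (Suc m) / (y (Suc m) - y m) * ((y (Suc m) - a) / a * b)"
  defines "h \<equiv> y (Suc m) / (y (Suc m) - y m) * (y (Suc m) / a\<^sup>2 * b + (y (Suc m) - a) / a *
     (1 + (\<Sum>i\<in>J. c i * u i * (y i - y m) / (y i - a)\<^sup>2)))"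
  shows "ennreal (\<Prod>i\<in>J. c i) * (ennreal (1 / (\<Prod>i\<in>{Suc m..n}. y i)) *
      (F (\<lambda>i\<in>{m..n}. if i = m then y m * (C - t / y (Suc m)) else if i = Suc m then t else c i * u i) *
       ennreal h * (if 0 < b then 1 else 0))) =
    ennreal ((\<Prod>i\<in>{Suc m..n}. (y i - a) / (y i - y m)) / a) *
      simplex_integrand (Suc m) n y (Z * y m / a) (peeled m n y F a) u"
proof -
  define C' where "C' = Z * y m / a - 1 - (\<Sum>i\<in>J. u i / y i)"
  define y0 y1 where "y0 = y m" and "y1 = y (Suc m)"
  have y0: "0 < y0" "y0 < a" "a < y1" "y0 < y1" "0 < a" "0 < y1"
    using chain_on_pos[OF y, of m] a \<open>m < n\<close> by (auto simp: y0_def y1_def)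
  have yi: "y1 < y i" "0 < y i" "y i \<noteq> 0" "y i - y0 \<noteq> 0" "y i - a \<noteq> 0" "0 < c i" if "i \<in> J" for i
  proof -
    show 1: "y1 < y i" using that chain_on_less[OF y, of "Suc m" i] by (auto simp: y1_def J_def)
    then show "0 < y i" "y i \<noteq> 0" "y i - y0 \<noteq> 0" "y i - a \<noteq> 0" using y0 by auto
    show "0 < c i" using 1 y0 by (simp add: c_def flip: y0_def)
  qed
  have ins: "{Suc m..n} = insert (Suc m) J" "Suc m \<notin> J" "finite J"
    using \<open>m < n\<close> by (auto simp: J_def)
  \<comment> \<open>\<open>C'\<close> is the slack of the smaller simplex, so positivity of
    \<open>b\<close> is precisely its defining inequality.\<close>
  have b: "b = a * C'"
  proof -
    have "y0 * (c i * u i / y i) + (a - y0) * (c i * u i / (y i - a)) = a * (u i / y i)" if "i \<in> J" for i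
    proof -
      have *: "y0 * ((p - a) / (p - y0) * v / p) + (a - y0) * ((p - a) / (p - y0) * v / (p - a)) = a * (v / p)"
        if "p \<noteq> 0" "p - y0 \<noteq> 0" "p - a \<noteq> 0" for p v
        using that by (simp add: divide_simps) (simp add: algebra_simps)
      show ?thesis unfolding c_def y0_def[symmetric] using * yi[OF that] by blast
    qed
    then have "y0 * (\<Sum>i\<in>J. c i * u i / y i) + (a - y0) * (\<Sum>i\<in>J. c i * u i / (y i - a)) = a * (\<Sum>i\<in>J. u i / y i)"
      unfolding sum_distrib_left sum.distrib[symmetric] by (rule sum.cong[OF refl])
    moreover have "a * C' = Z * y0 - a - a * (\<Sum>i\<in>J. u i / y i)"
      using y0 by (simp add: C'_def algebra_simps flip: y0_def)
    ultimately show ?thesis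
      unfolding b_def C_def y0_def[symmetric] by (simp add: algebra_simps)
  qed
  have t: "t = y1 * C' * ((y1 - a) / (y1 - y0))"
    using y0 by (simp add: t_def b flip: y0_def y1_def)
  have uc: "c i * u i / (y i - a) = u i / (y i - y0)" if "i \<in> J" for i
    using yi[OF that] by (simp add: c_def flip: y0_def)
  have S0: "1 + (\<Sum>i\<in>J. c i * u i / (y i - a)) = 1 + (\<Sum>i\<in>J. u i / (y i - y0))"
    using uc by simp
  \<comment> \<open>Full coordinate vector of the smaller simplex, with the eliminated entry at
    \<open>Suc m\<close> restored from its constraint.\<close>
  define w where "w = (\<lambda>i\<in>{Suc m..n}. if i = Suc m then y (Suc m) * (Z * y m / a - 1 - (\<Sum>i\<in>J. u i / y i)) else u i)"
  have w: "w (Suc m) = y1 * C'" "\<And>i. i \<in> J \<Longrightarrow> w i = u i"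
    using ins by (auto simp: w_def C'_def y1_def)
  have sum_w: "(\<Sum>i\<in>{Suc m..n}. w i / (y i - v)) = y1 * C' / (y1 - v) + (\<Sum>i\<in>J. u i / (y i - v))" for v
    unfolding ins(1) using ins(2,3) w by (simp add: y1_def)
  have h: "h = (y1 - a) / (y1 - y0) * y1 / a * (1 + (\<Sum>i\<in>{Suc m..n}. w i / (y i - a)))"
  proof -
    have "c i * u i * (y i - y m) / (y i - a)\<^sup>2 = u i / (y i - a)" if "i \<in> J" for i
      using yi[OF that] by (simp add: c_def power2_eq_square flip: y0_def)
    then have "(\<Sum>i\<in>J. c i * u i * (y i - y m) / (y i - a)\<^sup>2) = (\<Sum>i\<in>J. u i / (y i - a))"
      by (rule sum.cong[OF refl])
    moreover have "y1 / (y1 - y0) * (y1 / a\<^sup>2 * (a * C') + (y1 - a) / a * (1 + S)) =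
      (y1 - a) / (y1 - y0) * y1 / a * (1 + (y1 * C' / (y1 - a) + S))" for S
    proof -
      have "y1 - a \<noteq> 0" "y1 - y0 \<noteq> 0" "a \<noteq> 0" using y0 by auto
      then show ?thesis by (simp add: divide_simps power2_eq_square) (simp add: algebra_simps)
    qed
    ultimately show ?thesis
      unfolding h_def sum_w b y0_def[symmetric] y1_def[symmetric] by simp
  qed
  \<comment> \<open>The eliminated coefficient at \<open>y m\<close> has to come out as
    \<open>peeled\<close> prescribes: \<open>a - y m\<close> times the smaller partial fraction
    function at \<open>y m\<close>.\<close>
  have first: "y m * (C - t / y (Suc m)) = (a - y m) * (1 + (\<Sum>i\<in>{Suc m..n}. w i / (y i - y m)))"
  proof -
    have "y0 * C = b + (a - y0) * (1 + (\<Sum>i\<in>J. c i * u i / (y i - a)))"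
      unfolding b_def y0_def by simp
    then have y0C: "y0 * C = b + (a - y0) * (1 + (\<Sum>i\<in>J. u i / (y i - y0)))"
      unfolding S0 .
    then have "y0 * (C - t / y1) = a * C' - y0 * C' * ((y1 - a) / (y1 - y0)) + (a - y0) * (1 + (\<Sum>i\<in>J. u i / (y i - y0)))"
    proof -
      have "t / y1 = C' * ((y1 - a) / (y1 - y0))" using y0 by (simp add: t)
      with y0C show ?thesis by (simp only: right_diff_distrib b mult.assoc)
    qed
    also have "a * C' - y0 * C' * ((y1 - a) / (y1 - y0)) = (a - y0) * (y1 * C' / (y1 - y0))"
    proof -
      have "y1 - y0 \<noteq> 0" using y0 by auto
      then show ?thesis by (simp add: divide_simps) (simp add: algebra_simps)
    qed
    finally show ?thesis unfolding y0_def[symmetric] sum_w y1_def[symmetric]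
      by (simp add: distrib_left)
  qed
  have F: "F (\<lambda>i\<in>{m..n}. if i = m then y m * (C - t / y (Suc m)) else if i = Suc m then t else c i * u i) =
    F (\<lambda>i\<in>{m..n}. if i = m then (a - y m) * (1 + (\<Sum>i\<in>{Suc m..n}. w i / (y i - y m)))
                   else w i * ((y i - a) / (y i - y m)))"
  proof (rule arg_cong[where f = F], rule ext)
    fix i
    show "(\<lambda>i\<in>{m..n}. if i = m then y m * (C - t / y (Suc m)) else if i = Suc m then t else c i * u i) i =
      (\<lambda>i\<in>{m..n}. if i = m then (a - y m) * (1 + (\<Sum>i\<in>{Suc m..n}. w i / (y i - y m)))
                   else w i * ((y i - a) / (y i - y m))) i"
    proof (cases "i = m \<or> i = Suc m \<or> i \<notin> {m..n}")
      case True
      then show ?thesis using first by (auto simp: w t y0_def y1_def)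
    next
      case False
      then have "i \<in> J" by (auto simp: J_def)
      with False show ?thesis by (simp add: w c_def mult.commute)
    qed
  qed
  have peel: "peeled m n y F a w = ennreal (1 + (\<Sum>i\<in>{Suc m..n}. w i / (y i - a))) *
    F (\<lambda>i\<in>{m..n}. if i = m then y m * (C - t / y (Suc m)) else if i = Suc m then t else c i * u i)"
    unfolding F peeled_def by simp
  have cond: "0 < b \<longleftrightarrow> (\<Sum>i\<in>J. u i / y i) < Z * y m / a - 1"
    using y0 by (simp add: b C'_def zero_less_mult_iff)
  have ind: "indicator {u. (\<forall>i\<in>{Suc (Suc m)..n}. 0 < u i) \<and> (\<Sum>i\<in>{Suc (Suc m)..n}. u i / y i) < Z * y m / a - 1} u =
    (if 0 < b then 1 else 0 :: ennreal)"
    using u cond by (simp add: J_def indicator_def)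
  show ?thesis
  proof (cases "0 < b")
    case False
    then show ?thesis unfolding simplex_integrand_def ind by simp
  next
    case True
    then have C': "0 < C'" using y0 by (simp add: b zero_less_mult_iff)
    define S where "S = 1 + (\<Sum>i\<in>{Suc m..n}. w i / (y i - a))"
    have S: "0 \<le> S"
    proof -
      have "0 \<le> (\<Sum>i\<in>J. u i / (y i - a))"
        using u yi y0 by (intro sum_nonneg divide_nonneg_nonneg) (auto simp: J_def intro: less_imp_le less_trans)
      then show ?thesis unfolding S_def sum_w using C' y0 by simp
    qed
    have pos: "0 < (\<Prod>i\<in>J. c i)" "0 < (\<Prod>i\<in>J. y i)" using yi by (auto intro: prod_pos)
    have yprod: "(\<Prod>i\<in>{Suc m..n}. y i) = y1 * (\<Prod>i\<in>J. y i)"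
      and cprod: "(\<Prod>i\<in>{Suc m..n}. (y i - a) / (y i - y m)) = (y1 - a) / (y1 - y0) * (\<Prod>i\<in>J. c i)"
      unfolding ins(1) using ins(2,3) by (simp_all add: y1_def y0_def c_def)
    have weight: "ennreal (\<Prod>i\<in>J. c i) * (ennreal (1 / (\<Prod>i\<in>{Suc m..n}. y i)) * ennreal h) =
      ennreal ((\<Prod>i\<in>{Suc m..n}. (y i - a) / (y i - y m)) / a) * (ennreal (1 / (\<Prod>i\<in>J. y i)) * ennreal S)"
    proof -
      have "(\<Prod>i\<in>J. c i) * (1 / (y1 * (\<Prod>i\<in>J. y i)) * ((y1 - a) / (y1 - y0) * y1 / a * S)) =
        ((y1 - a) / (y1 - y0) * (\<Prod>i\<in>J. c i)) / a * (1 / (\<Prod>i\<in>J. y i) * S)"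
        using y0 by (simp add: ac_simps)
      moreover have "0 \<le> (y1 - a) / (y1 - y0) * y1 / a * S" using y0 S by simp
      ultimately show ?thesis
        unfolding yprod cprod h S_def[symmetric] using y0 S pos
        by (simp add: less_imp_le flip: ennreal_mult)
    qed
    have eq: "ennreal (\<Prod>i\<in>J. c i) * (ennreal (1 / (\<Prod>i\<in>{Suc m..n}. y i)) * (f * ennreal h * 1)) =
      ennreal ((\<Prod>i\<in>{Suc m..n}. (y i - a) / (y i - y m)) / a) * (1 * ennreal (1 / (\<Prod>i\<in>J. y i)) * (ennreal S * f))" for f
    proof -
      have "p * (q * (f * r * 1)) = p * (q * r) * f" "p * (1 * q * (r * f)) = p * (q * r) * f" for p q r :: ennreal
        by (simp_all add: ac_simps)
      then show ?thesis by (simp only: weight)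
    qed
    have "simplex_integrand (Suc m) n y (Z * y m / a) (peeled m n y F a) u =
      1 * ennreal (1 / (\<Prod>i\<in>J. y i)) * peeled m n y F a w"
      unfolding simplex_integrand_def ind w_def J_def using True by simp
    then show ?thesis
      unfolding peel S_def[symmetric] using True eq by simp
  qed
qed

section \<open>Assembly of the change of variables\<close>

lemma slice_change_of_variables_base:
  assumes "chain_on n n y" and F: "F \<in> borel_measurable (Pi\<^sub>M {n..n} (\<lambda>_. borel))"
  shows "(\<integral>\<^sup>+x. slice_integrand n n y Z F x \<partial>Pi\<^sub>M {n..<n} (\<lambda>_. lborel)) =
    (\<integral>\<^sup>+u. simplex_integrand n n y Z F u \<partial>Pi\<^sub>M {Suc n..n} (\<lambda>_. lborel))"
proof -
  interpret product_sigma_finite "\<lambda>_. lborel :: real measure" by standard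
  have y: "0 < y n" using assms by (simp add: chain_on_def)
  have "slice_integrand n n y Z F u = simplex_integrand n n y Z F u" for u
  proof -
    have "y n < Z * y n \<longleftrightarrow> 1 < Z" using y by simp
    then have "(indicator (interlaced n n y) (slice_point n n y Z u) :: ennreal) =
      indicator {u. (\<forall>i\<in>{Suc n..n}. 0 < u i) \<and> (\<Sum>i\<in>{Suc n..n}. u i / y i) < Z - 1} u"
      by (auto simp: interlaced_def slice_point_def indicator_def)
    moreover have "(\<lambda>i\<in>{n..n}. residue_coord {n..n} y (slice_point n n y Z u) i) =
       (\<lambda>i\<in>{n..n}. if i = n then y n * (Z - 1 - (\<Sum>i\<in>{Suc n..n}. u i / y i)) else u i)"
      by (auto simp: fun_eq_iff residue_coord_def slice_point_def algebra_simps)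
    ultimately show ?thesis
      by (simp add: slice_integrand_def simplex_integrand_def vandermonde_on_def)
  qed
  then show ?thesis by simp
qed

text \<open>Downward induction on \<open>m\<close>, starting from a single point; \<open>Z\<close>
  and \<open>F\<close> are generalised because peeling changes both. On the simplex side the
  coordinate \<open>u (Suc m)\<close> is exchanged for the zero \<open>a\<close>. Once Fubini has
  moved \<open>a\<close> outermost, the other coordinates can be rescaled by factors depending on
  \<open>a\<close>, and the induction hypothesis applies for each fixed \<open>a\<close>.\<close>

theorem slice_change_of_variables:
  assumes "m \<le> n" "chain_on m n y" and "F \<in> borel_measurable (Pi\<^sub>M {m..n} (\<lambda>_. borel))"
  shows "(\<integral>\<^sup>+x. slice_integrand m n y Z F x \<partial>Pi\<^sub>M {m..<n} (\<lambda>_. lborel)) =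
    (\<integral>\<^sup>+u. simplex_integrand m n y Z F u \<partial>Pi\<^sub>M {Suc m..n} (\<lambda>_. lborel))"
  using assms
proof (induction arbitrary: Z F rule: inc_induct)
  case base
  then show ?case by (rule slice_change_of_variables_base)
next
  case (step m)
  interpret product_sigma_finite "\<lambda>_. lborel :: real measure" by standard
  note y = \<open>chain_on m n y\<close>
  note F = \<open>F \<in> borel_measurable (Pi\<^sub>M {m..n} (\<lambda>_. borel))\<close>
  define J where "J = {Suc (Suc m)..n}"
  define y0 y1 where "y0 = y m" and "y1 = y (Suc m)"
  have y0: "0 < y0" "y0 < y1"
    using chain_on_pos[OF y, of m] chain_on_less[OF y, of m "Suc m"] \<open>m < n\<close> by (auto simp: y0_def y1_def)
  have yJ: "y1 < y i" if "i \<in> J" for i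
    using that chain_on_less[OF y, of "Suc m" i] by (auto simp: y1_def J_def)
  have ins: "{Suc m..n} = insert (Suc m) J" "Suc m \<notin> J" "finite J"
    using \<open>m < n\<close> by (auto simp: J_def)
  interpret PJ: finite_product_sigma_finite "\<lambda>_. lborel :: real measure" J by standard (rule ins)
  interpret P: pair_sigma_finite lborel "Pi\<^sub>M J (\<lambda>_. lborel :: real measure)"
    by (simp add: PJ.sigma_finite_measure_axioms pair_sigma_finite.intro lborel.sigma_finite_measure_axioms)
  define C where "C = (\<lambda>u. Z - 1 - (\<Sum>i\<in>J. u i / y i))"
  define b where "b = (\<lambda>a u. y0 * C u - (a - y0) * (1 + (\<Sum>i\<in>J. u i / (y i - a))))"
  define t where "t = (\<lambda>a u. y1 / (y1 - y0) * ((y1 - a) / a * b a u))"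
  define h where "h = (\<lambda>a u. y1 / (y1 - y0) * (y1 / a\<^sup>2 * b a u + (y1 - a) / a *
     (1 + (\<Sum>i\<in>J. u i * (y i - y0) / (y i - a)\<^sup>2))))"
  define G where "G = (\<lambda>s u. F (\<lambda>i\<in>{m..n}. if i = m then y0 * (C u - s / y1) else if i = Suc m then s else u i))"
  define K where "K = 1 / (\<Prod>i\<in>{Suc m..n}. y i)"
  \<comment> \<open>The integrand in mixed coordinates \<open>(a, u)\<close>: the coordinate at
    \<open>Suc m\<close> is already replaced by \<open>a\<close>, the others are not yet
    rescaled.\<close>
  define H where "H = (\<lambda>a u. indicator {u. \<forall>i\<in>J. 0 < u i} u *
     (ennreal K * (G (t a u) u * ennreal (h a u) * indicator {a. y0 < a \<and> a < y1 \<and> 0 < b a u} a)))"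
  have C_meas [measurable]: "C \<in> borel_measurable (Pi\<^sub>M J (\<lambda>_. lborel))" unfolding C_def by measurable
  have b_meas [measurable]: "(\<lambda>(a, u). b a u) \<in> borel_measurable (lborel \<Otimes>\<^sub>M Pi\<^sub>M J (\<lambda>_. lborel))"
    unfolding b_def by measurable
  have t_meas [measurable]: "(\<lambda>(a, u). t a u) \<in> borel_measurable (lborel \<Otimes>\<^sub>M Pi\<^sub>M J (\<lambda>_. lborel))"
    unfolding t_def by measurable
  have h_meas [measurable]: "(\<lambda>(a, u). h a u) \<in> borel_measurable (lborel \<Otimes>\<^sub>M Pi\<^sub>M J (\<lambda>_. lborel))"
    unfolding h_def by measurable
  have G_meas [measurable]: "(\<lambda>(s, u). G s u) \<in> borel_measurable (lborel \<Otimes>\<^sub>M Pi\<^sub>M J (\<lambda>_. lborel))"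
    unfolding G_def split_beta
  proof (rule measurable_compose[OF measurable_restrict F])
    fix i assume "i \<in> {m..n}"
    then consider "i = m" | "i = Suc m" "i \<noteq> m" | "i \<in> J" "i \<noteq> Suc m" "i \<noteq> m" by (force simp: J_def)
    then show "(\<lambda>p. if i = m then y0 * (C (snd p) - fst p / y1) else if i = Suc m then fst p else snd p i)
      \<in> borel_measurable (lborel \<Otimes>\<^sub>M Pi\<^sub>M J (\<lambda>_. lborel))"
    proof cases
      case 3
      then have "(\<lambda>p. snd p i) \<in> borel_measurable (lborel \<Otimes>\<^sub>M Pi\<^sub>M J (\<lambda>_. lborel :: real measure))"
        by measurable
      with 3 show ?thesis by simp
    qed auto
  qed
  have Gt_meas [measurable]: "(\<lambda>(a, u). G (t a u) u) \<in> borel_measurable (lborel \<Otimes>\<^sub>M Pi\<^sub>M J (\<lambda>_. lborel))"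
  proof -
    have "(\<lambda>(a, u). (t a u, u)) \<in> lborel \<Otimes>\<^sub>M Pi\<^sub>M J (\<lambda>_. lborel) \<rightarrow>\<^sub>M lborel \<Otimes>\<^sub>M Pi\<^sub>M J (\<lambda>_. lborel)"
      by measurable
    from measurable_compose[OF this G_meas] show ?thesis by (simp add: split_beta)
  qed
  have H_meas: "(\<lambda>(a, u). H a u) \<in> borel_measurable (lborel \<Otimes>\<^sub>M Pi\<^sub>M J (\<lambda>_. lborel))"
    unfolding H_def indicator_def of_bool_def mem_Collect_eq by measurable

  have "(\<integral>\<^sup>+u. simplex_integrand m n y Z F u \<partial>Pi\<^sub>M {Suc m..n} (\<lambda>_. lborel)) =
    (\<integral>\<^sup>+u. (\<integral>\<^sup>+s. simplex_integrand m n y Z F (u(Suc m := s)) \<partial>lborel) \<partial>Pi\<^sub>M J (\<lambda>_. lborel))"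
    using simplex_integrand_measurable[OF F, of y Z] ins \<open>m < n\<close> unfolding ins(1)
    by (intro product_nn_integral_insert) auto
  also have "\<dots> = (\<integral>\<^sup>+u. (\<integral>\<^sup>+a. H a u \<partial>lborel) \<partial>Pi\<^sub>M J (\<lambda>_. lborel))"
  proof (rule nn_integral_cong)
    fix u assume u: "u \<in> space (Pi\<^sub>M J (\<lambda>_. lborel :: real measure))"
    have [measurable]: "G_u \<in> borel_measurable borel" if "G_u = (\<lambda>s. G s u)" for G_u
      using measurable_compose[OF measurable_Pair2'[OF u] G_meas] that by simp
    have Hu: "(\<lambda>a. G (t a u) u * ennreal (h a u) * indicator {a. y0 < a \<and> a < y1 \<and> 0 < b a u} a) \<in> borel_measurable lborel"
    proof -
      have "(\<lambda>(a, u). G (t a u) u * ennreal (h a u) * indicator {a. y0 < a \<and> a < y1 \<and> 0 < b a u} a)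
         \<in> borel_measurable (lborel \<Otimes>\<^sub>M Pi\<^sub>M J (\<lambda>_. lborel))"
        unfolding indicator_def of_bool_def mem_Collect_eq by measurable
      from measurable_compose[OF measurable_Pair2'[OF u] this] show ?thesis by simp
    qed
    have eq: "simplex_integrand m n y Z F (u(Suc m := s)) =
      indicator {u. \<forall>i\<in>J. 0 < u i} u * (ennreal K * (G s u * indicator {0<..<y1 * C u} s))" for s
    proof -
      have sum: "(\<Sum>i\<in>{Suc m..n}. (u(Suc m := s)) i / y i) = s / y1 + (\<Sum>i\<in>J. u i / y i)"
      proof -
        have "(\<Sum>i\<in>J. (u(Suc m := s)) i / y i) = (\<Sum>i\<in>J. u i / y i)"
          by (intro sum.cong refl) (use ins(2) in auto)
        then show ?thesis unfolding ins(1) using ins(2,3) by (simp add: y1_def)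
      qed
      have F_eq: "F (\<lambda>i\<in>{m..n}. if i = m then y m * (Z - 1 - (\<Sum>i\<in>{Suc m..n}. (u(Suc m := s)) i / y i)) else (u(Suc m := s)) i) = G s u"
        unfolding G_def sum by (rule arg_cong[where f = F]) (auto simp: fun_eq_iff C_def y0_def algebra_simps)
      have "(\<forall>i\<in>{Suc m..n}. 0 < (u(Suc m := s)) i) \<longleftrightarrow> 0 < s \<and> (\<forall>i\<in>J. 0 < u i)"
        unfolding ins(1) using ins(2) by auto
      moreover have "s / y1 + (\<Sum>i\<in>J. u i / y i) < Z - 1 \<longleftrightarrow> s < y1 * C u"
        using y0 by (auto simp: C_def field_simps)
      ultimately have "indicator {u. (\<forall>i\<in>{Suc m..n}. 0 < u i) \<and> (\<Sum>i\<in>{Suc m..n}. u i / y i) < Z - 1} (u(Suc m := s)) =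
        (indicator {u. \<forall>i\<in>J. 0 < u i} u * indicator {0<..<y1 * C u} s :: ennreal)"
        unfolding indicator_def mem_Collect_eq sum by auto
      then show ?thesis
        unfolding simplex_integrand_def F_eq K_def[symmetric] by (simp add: ac_simps)
    qed
    show "(\<integral>\<^sup>+s. simplex_integrand m n y Z F (u(Suc m := s)) \<partial>lborel) = (\<integral>\<^sup>+a. H a u \<partial>lborel)"
    proof (cases "\<forall>i\<in>J. 0 < u i")
      case False
      then show ?thesis unfolding eq H_def by simp
    next
      case True
      have "(\<integral>\<^sup>+s. G s u * indicator {0<..<y1 * C u} s \<partial>lborel) =
         (\<integral>\<^sup>+a. G (t a u) u * ennreal (h a u) * indicator {a. y0 < a \<and> a < y1 \<and> 0 < b a u} a \<partial>lborel)"
        unfolding t_def h_def b_def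
        by (rule nn_integral_slice_substitution) (use y0 yJ True ins in auto)
      then show ?thesis
        unfolding eq H_def using True Hu by (simp add: nn_integral_cmult)
    qed
  qed
  also have "\<dots> = (\<integral>\<^sup>+a. (\<integral>\<^sup>+u. H a u \<partial>Pi\<^sub>M J (\<lambda>_. lborel)) \<partial>lborel)"
    by (rule P.Fubini') (rule H_meas)
  also have "\<dots> = (\<integral>\<^sup>+a. (\<integral>\<^sup>+x. slice_integrand m n y Z F (x(m := a)) \<partial>Pi\<^sub>M {Suc m..<n} (\<lambda>_. lborel)) \<partial>lborel)"
  proof (rule nn_integral_cong)
    fix a :: real
    show "(\<integral>\<^sup>+u. H a u \<partial>Pi\<^sub>M J (\<lambda>_. lborel)) =
      (\<integral>\<^sup>+x. slice_integrand m n y Z F (x(m := a)) \<partial>Pi\<^sub>M {Suc m..<n} (\<lambda>_. lborel))"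
    proof (cases "y0 < a \<and> a < y1")
      case False
      then have "H a u = 0" for u by (auto simp: H_def indicator_def)
      moreover have "slice_integrand m n y Z F (x(m := a)) = 0" for x
        using slice_integrand_outside[OF \<open>m < n\<close>] False by (simp add: y0_def y1_def)
      ultimately show ?thesis by simp
    next
      case True
      define c where "c = (\<lambda>i. (y i - a) / (y i - y0))"
      define c' where "c' = (\<Prod>i\<in>{Suc m..n}. (y i - a) / (y i - y m)) / a"
      have c: "0 < c i" if "i \<in> J" for i using yJ[OF that] True y0 by (auto simp: c_def)
      note peel_meas = peeled_measurable[OF F less_imp_le[OF \<open>m < n\<close>], of y a]
      have chain': "chain_on (Suc m) n y" using y \<open>m < n\<close> by (rule chain_on_Suc)
      have Ha: "H a \<in> borel_measurable (Pi\<^sub>M J (\<lambda>_. lborel))"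
        using measurable_compose[OF measurable_Pair1' H_meas, of a] by simp
      have "(\<integral>\<^sup>+u. H a u \<partial>Pi\<^sub>M J (\<lambda>_. lborel)) =
        ennreal (\<Prod>i\<in>J. c i) * (\<integral>\<^sup>+u. H a (\<lambda>i\<in>J. c i * u i) \<partial>Pi\<^sub>M J (\<lambda>_. lborel))"
        by (rule nn_integral_PiM_lborel_scale) (use ins c Ha in auto)
      also have "\<dots> = (\<integral>\<^sup>+u. ennreal (\<Prod>i\<in>J. c i) * H a (\<lambda>i\<in>J. c i * u i) \<partial>Pi\<^sub>M J (\<lambda>_. lborel))"
        by (rule nn_integral_cmult[symmetric], rule measurable_compose[OF _ Ha]) measurable
      also have "\<dots> = (\<integral>\<^sup>+u. ennreal c' * simplex_integrand (Suc m) n y (Z * y m / a) (peeled m n y F a) u \<partial>Pi\<^sub>M J (\<lambda>_. lborel))"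
      proof (rule nn_integral_cong)
        fix u :: "nat \<Rightarrow> real"
        let ?u = "\<lambda>i\<in>J. c i * u i"
        have iff: "(\<forall>i\<in>J. 0 < ?u i) \<longleftrightarrow> (\<forall>i\<in>J. 0 < u i)"
          using c by (auto simp: zero_less_mult_iff) (meson less_asym)+
        show "ennreal (\<Prod>i\<in>J. c i) * H a ?u = ennreal c' * simplex_integrand (Suc m) n y (Z * y m / a) (peeled m n y F a) u"
        proof (cases "\<forall>i\<in>J. 0 < u i")
          case False
          then show ?thesis using iff by (simp add: H_def simplex_integrand_def J_def)
        next
          case u: True
          have G: "G s ?u = F (\<lambda>i\<in>{m..n}. if i = m then y m * (C ?u - s / y (Suc m)) else if i = Suc m then s else c i * u i)" for s
            unfolding G_def by (rule arg_cong[where f = F]) (auto simp: fun_eq_iff J_def y0_def y1_def)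
          have sums: "C ?u = Z - 1 - (\<Sum>i\<in>J. c i * u i / y i)"
            "(\<Sum>i\<in>J. ?u i / (y i - a)) = (\<Sum>i\<in>J. c i * u i / (y i - a))"
            "(\<Sum>i\<in>J. ?u i * (y i - y0) / (y i - a)\<^sup>2) = (\<Sum>i\<in>J. c i * u i * (y i - y0) / (y i - a)\<^sup>2)"
            by (auto simp: C_def)
          have "H a ?u = ennreal K * (G (t a ?u) ?u * ennreal (h a ?u) * (if 0 < b a ?u then 1 else 0))"
            using u iff True unfolding H_def by (simp add: indicator_def)
          then show ?thesis
            using simplex_integrand_peel[OF y \<open>m < n\<close>, where a = a and u = u and Z = Z and F = F] True u
            unfolding G K_def c'_def t_def h_def b_def sums unfolding c_def J_def y0_def y1_def by simp
        qed
      qed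
      also have "\<dots> = ennreal c' * (\<integral>\<^sup>+u. simplex_integrand (Suc m) n y (Z * y m / a) (peeled m n y F a) u \<partial>Pi\<^sub>M J (\<lambda>_. lborel))"
        unfolding J_def
        by (rule nn_integral_cmult) (use simplex_integrand_measurable[OF peel_meas] \<open>m < n\<close> in auto)
      also have "\<dots> = ennreal c' * (\<integral>\<^sup>+x. slice_integrand (Suc m) n y (Z * y m / a) (peeled m n y F a) x \<partial>Pi\<^sub>M {Suc m..<n} (\<lambda>_. lborel))"
        unfolding J_def by (subst step.IH[OF chain' peel_meas]) simp
      also have "\<dots> = (\<integral>\<^sup>+x. ennreal c' * slice_integrand (Suc m) n y (Z * y m / a) (peeled m n y F a) x \<partial>Pi\<^sub>M {Suc m..<n} (\<lambda>_. lborel))"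
        by (rule nn_integral_cmult[symmetric]) (use slice_integrand_measurable[OF peel_meas] \<open>m < n\<close> in auto)
      also have "\<dots> = (\<integral>\<^sup>+x. slice_integrand m n y Z F (x(m := a)) \<partial>Pi\<^sub>M {Suc m..<n} (\<lambda>_. lborel))"
        using slice_integrand_peel[OF y \<open>m < n\<close>] True unfolding c'_def y0_def y1_def by simp
      finally show ?thesis .
    qed
  qed
  also have "\<dots> = (\<integral>\<^sup>+x. slice_integrand m n y Z F x \<partial>Pi\<^sub>M {m..<n} (\<lambda>_. lborel))"
  proof -
    have *: "{m..<n} = insert m {Suc m..<n}" using \<open>m < n\<close> by auto
    show ?thesis
      using slice_integrand_measurable[OF F, of y Z] \<open>m < n\<close> unfolding *
      by (intro product_nn_integral_insert_rev[symmetric]) auto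
  qed
  finally show ?case by (rule sym)
qed

section \<open>The Dirichlet integral\<close>

lemma nn_integral_Beta_scaled:
  fixes s S c y :: real
  assumes s: "0 < s" "0 < S" and y: "0 < y"
  shows "(\<integral>\<^sup>+t. ennreal (t powr (s - 1) * (c - t / y) powr (S - 1)) * indicator {t. 0 < t \<and> t / y < c} t \<partial>lborel) =
    ennreal (y powr s * c powr (s + S - 1) * Beta s S) * indicator {0<..} c"
proof (cases "0 < c")
  case False
  then have "\<not> (0 < t \<and> t / y < c)" for t
    using y False divide_pos_pos[of t y] by (smt (verit))
  then have "{t. 0 < t \<and> t / y < c} = {}" by blast
  with False show ?thesis by simp
next
  case c: True
  define f where "f = (\<lambda>t. ennreal (t powr (s - 1) * (c - t / y) powr (S - 1)) * indicator {t. 0 < t \<and> t / y < c} t)"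
  have f: "f \<in> borel_measurable borel" unfolding f_def by measurable
  have "(\<integral>\<^sup>+t. f t \<partial>lborel) = ennreal \<bar>y * c\<bar> * (\<integral>\<^sup>+t. f (0 + y * c * t) \<partial>lborel)"
    by (rule nn_integral_real_affine) (use f y c in auto)
  also have "\<dots> = ennreal (y * c) * (\<integral>\<^sup>+t. ennreal ((y * c) powr (s - 1) * c powr (S - 1)) *
      (ennreal (t powr (s - 1) * (1 - t) powr (S - 1)) * indicator {0<..<1} t) \<partial>lborel)"
  proof -
    have "f (0 + y * c * t) = ennreal ((y * c) powr (s - 1) * c powr (S - 1)) *
      (ennreal (t powr (s - 1) * (1 - t) powr (S - 1)) * indicator {0<..<1} t)" for t
    proof (cases "0 < t \<and> t < 1")
      case True
      have "c - y * c * t / y = c * (1 - t)" using y by (simp add: algebra_simps)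
      then have "(y * c * t) powr (s - 1) * (c - y * c * t / y) powr (S - 1) =
         ((y * c) powr (s - 1) * c powr (S - 1)) * (t powr (s - 1) * (1 - t) powr (S - 1))"
        using True y c by (simp add: powr_mult)
      then show ?thesis using True y c by (simp add: f_def indicator_def flip: ennreal_mult)
    next
      case False
      moreover have "0 < y * c * t \<longleftrightarrow> 0 < t"
        using zero_less_mult_pos[OF _ mult_pos_pos[OF y c], of t] mult_pos_pos[OF mult_pos_pos[OF y c], of t] by blast
      moreover have "y * c * t / y < c \<longleftrightarrow> t < 1"
      proof -
        have "y * c * t / y = c * t" using y by simp
        then show ?thesis using c by simp
      qed
      ultimately show ?thesis by (auto simp: f_def indicator_def)
    qed
    then show ?thesis using y c by simp
  qed
  also have "\<dots> = ennreal (y * c) * (ennreal ((y * c) powr (s - 1) * c powr (S - 1)) * ennreal (Beta s S))"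
  proof -
    have "((\<lambda>t. t powr (s - 1) * (1 - t) powr (S - 1)) has_integral Beta s S) {0<..<1}"
      using has_integral_Beta_real[OF s] by (simp add: has_integral_Icc_iff_Ioo)
    then have "(\<integral>\<^sup>+t. ennreal (t powr (s - 1) * (1 - t) powr (S - 1)) * indicator {0<..<1} t \<partial>lborel) = ennreal (Beta s S)"
      by (intro nn_integral_has_integral_lebesgue') auto
    then show ?thesis by (simp add: nn_integral_cmult)
  qed
  also have "\<dots> = ennreal (y powr s * c powr (s + S - 1) * Beta s S)"
  proof -
    have "(y * c) * (y * c) powr (s - 1) = (y * c) powr s"
      using y c powr_add[of "y * c" 1 "s - 1"] by simp
    also have "\<dots> = y powr s * c powr s" using y c by (simp add: powr_mult)
    finally have "(y * c) * ((y * c) powr (s - 1) * c powr (S - 1)) = y powr s * (c powr s * c powr (S - 1))"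
      by simp
    also have "c powr s * c powr (S - 1) = c powr (s + S - 1)" by (simp flip: powr_add add: algebra_simps)
    finally have eq: "(y * c) * ((y * c) powr (s - 1) * c powr (S - 1)) = y powr s * c powr (s + S - 1)" .
    have "0 < Beta s S" using s by (simp add: Beta_def Gamma_real_pos)
    then show ?thesis
      using y c by (simp add: eq[symmetric] ennreal_mult mult.assoc)
  qed
  finally show ?thesis using c by (simp add: f_def)
qed

text \<open>For a fixed value \<open>t\<close> of one coordinate the others form a Dirichlet
  integral with slack lowered by \<open>t / y j\<close>, hence a power of the lowered slack; the
  integral over \<open>t\<close> is then of Beta type. The indicator on the right lets the induction
  hypothesis be applied to slacks that are not positive.\<close>

lemma Dirichlet_nn_integral:
  fixes s y :: "'i \<Rightarrow> real" and s0 c :: real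
  assumes "finite I" "\<And>i. i \<in> I \<Longrightarrow> 0 < s i" "\<And>i. i \<in> I \<Longrightarrow> 0 < y i" "0 < s0"
  shows "(\<integral>\<^sup>+u. indicator {u. (\<forall>i\<in>I. 0 < u i) \<and> (\<Sum>i\<in>I. u i / y i) < c} u *
      ennreal ((c - (\<Sum>i\<in>I. u i / y i)) powr (s0 - 1) * (\<Prod>i\<in>I. u i powr (s i - 1))) \<partial>Pi\<^sub>M I (\<lambda>_. lborel)) =
    ennreal (c powr (s0 + (\<Sum>i\<in>I. s i) - 1) * (\<Prod>i\<in>I. y i powr s i) *
      (Gamma s0 * (\<Prod>i\<in>I. Gamma (s i)) / Gamma (s0 + (\<Sum>i\<in>I. s i)))) * indicator {0<..} c"
  using assms
proof (induction I arbitrary: c rule: finite_induct)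
  case empty
  interpret product_sigma_finite "\<lambda>_. lborel :: real measure" by standard
  have "Gamma s0 \<noteq> 0" using Gamma_real_pos[OF \<open>0 < s0\<close>] by linarith
  then show ?case by (subst nn_integral_empty) (auto simp: indicator_def)
next
  case (insert j I)
  interpret product_sigma_finite "\<lambda>_. lborel :: real measure" by standard
  define S where "S = s0 + (\<Sum>i\<in>I. s i)"
  have S: "0 < S" unfolding S_def using insert.prems by (intro add_pos_nonneg sum_nonneg) (auto simp: less_imp_le)
  define A where "A = (\<Prod>i\<in>I. y i powr s i) * (Gamma s0 * (\<Prod>i\<in>I. Gamma (s i)) / Gamma S)"
  have A: "0 \<le> A" unfolding A_def using insert.prems S
    by (intro mult_nonneg_nonneg divide_nonneg_nonneg prod_nonneg) (auto simp: Gamma_real_pos less_imp_le)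
  have sj: "0 < s j" "0 < y j" using insert.prems by auto
  let ?f = "\<lambda>I c u. indicator {u. (\<forall>i\<in>I. 0 < u i) \<and> (\<Sum>i\<in>I. u i / y i) < c} u *
      ennreal ((c - (\<Sum>i\<in>I. u i / y i)) powr (s0 - 1) * (\<Prod>i\<in>I. u i powr (s i - 1)))"
  have meas: "?f J c' \<in> borel_measurable (Pi\<^sub>M J (\<lambda>_. lborel))" if "finite J" for J c'
    using that by measurable
  have "(\<integral>\<^sup>+u. ?f (insert j I) c u \<partial>Pi\<^sub>M (insert j I) (\<lambda>_. lborel)) =
    (\<integral>\<^sup>+t. (\<integral>\<^sup>+u. ?f (insert j I) c (u(j := t)) \<partial>Pi\<^sub>M I (\<lambda>_. lborel)) \<partial>lborel)"
    by (rule product_nn_integral_insert_rev) (use insert.hyps meas[of "insert j I" c] in auto)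
  also have "\<dots> = (\<integral>\<^sup>+t. ennreal A * (ennreal (t powr (s j - 1) * (c - t / y j) powr (S - 1)) * indicator {t. 0 < t \<and> t / y j < c} t) \<partial>lborel)"
  proof (rule nn_integral_cong)
    fix t :: real
    have *: "?f (insert j I) c (u(j := t)) = (indicator {0<..} t * ennreal (t powr (s j - 1))) * ?f I (c - t / y j) u" for u
    proof -
      have 1: "(\<Sum>i\<in>insert j I. (u(j := t)) i / y i) = t / y j + (\<Sum>i\<in>I. u i / y i)"
        using insert.hyps by (auto intro!: sum.cong)
      have 2: "(\<Prod>i\<in>insert j I. (u(j := t)) i powr (s i - 1)) = t powr (s j - 1) * (\<Prod>i\<in>I. u i powr (s i - 1))"
        using insert.hyps by (auto intro!: prod.cong)
      have 3: "(\<forall>i\<in>insert j I. 0 < (u(j := t)) i) \<longleftrightarrow> 0 < t \<and> (\<forall>i\<in>I. 0 < u i)"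
        using insert.hyps by auto
      have 4: "t / y j + r < c \<longleftrightarrow> r < c - t / y j" "c - (t / y j + r) = c - t / y j - r" for r by auto
      have 5: "ennreal (p * (q * r)) = ennreal q * ennreal (p * r)" if "0 \<le> q" "0 \<le> p * r" for p q r :: real
        using ennreal_mult[OF that] by (simp add: ac_simps)
      have 6: "indicator {u. (\<forall>i\<in>insert j I. 0 < u i) \<and> (\<Sum>i\<in>insert j I. u i / y i) < c} (u(j := t)) =
        (indicator {0<..} t * indicator {u. (\<forall>i\<in>I. 0 < u i) \<and> (\<Sum>i\<in>I. u i / y i) < c - t / y j} u :: ennreal)"
        unfolding indicator_def mem_Collect_eq 1 3 4 by auto
      show ?thesis unfolding 6 unfolding 1 2 4
        by (subst 5) (auto simp: ac_simps intro!: mult_nonneg_nonneg prod_nonneg)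
    qed
    have "(\<integral>\<^sup>+u. ?f (insert j I) c (u(j := t)) \<partial>Pi\<^sub>M I (\<lambda>_. lborel)) =
      (indicator {0<..} t * ennreal (t powr (s j - 1))) * (\<integral>\<^sup>+u. ?f I (c - t / y j) u \<partial>Pi\<^sub>M I (\<lambda>_. lborel))"
      unfolding * by (rule nn_integral_cmult[OF meas[OF \<open>finite I\<close>]])
    also have "(\<integral>\<^sup>+u. ?f I (c - t / y j) u \<partial>Pi\<^sub>M I (\<lambda>_. lborel)) =
      ennreal ((c - t / y j) powr (S - 1) * A) * indicator {0<..} (c - t / y j)"
      using insert.IH[of "c - t / y j"] insert.prems by (simp add: S_def A_def mult.assoc)
    also have "(indicator {0<..} t * ennreal (t powr (s j - 1))) * \<dots> =
      ennreal A * (ennreal (t powr (s j - 1) * (c - t / y j) powr (S - 1)) * indicator {t. 0 < t \<and> t / y j < c} t)"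
      using A by (auto simp: indicator_def ennreal_mult ac_simps)
    finally show "(\<integral>\<^sup>+u. ?f (insert j I) c (u(j := t)) \<partial>Pi\<^sub>M I (\<lambda>_. lborel)) = \<dots>" .
  qed
  also have "\<dots> = ennreal A * (ennreal (y j powr s j * c powr (s j + S - 1) * Beta (s j) S) * indicator {0<..} c)"
    by (subst nn_integral_cmult) (use nn_integral_Beta_scaled[OF sj(1) S sj(2)] in auto)
  also have "\<dots> = ennreal (A * (y j powr s j * c powr (s j + S - 1) * Beta (s j) S)) * indicator {0<..} c"
  proof -
    have "0 < Beta (s j) S" using sj S by (simp add: Beta_def Gamma_real_pos)
    then show ?thesis using A by (simp add: ennreal_mult mult.assoc)
  qed
  also have "A * (y j powr s j * c powr (s j + S - 1) * Beta (s j) S) =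
     c powr (s0 + (\<Sum>i\<in>insert j I. s i) - 1) * (\<Prod>i\<in>insert j I. y i powr s i) *
      (Gamma s0 * (\<Prod>i\<in>insert j I. Gamma (s i)) / Gamma (s0 + (\<Sum>i\<in>insert j I. s i)))"
  proof -
    have e: "s0 + (\<Sum>i\<in>insert j I. s i) = s j + S" using insert.hyps by (simp add: S_def)
    have "Gamma S \<noteq> 0" using Gamma_real_pos[OF S] by linarith
    then show ?thesis unfolding e using insert.hyps by (simp add: A_def Beta_def)
  qed
  finally show ?case .
qed

section \<open>The integral operator as an expectation\<close>

lemma chain_on_iff_chain [simp]: "chain_on (Suc 0) n y \<longleftrightarrow> chain n y"
  by (simp add: chain_on_def chain_def)

lemma interlaced_eq_Omega: "interlaced 1 n y = Omega n y"
  by (simp add: interlaced_def Omega_def)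

lemma vandermonde_on_eq: "vandermonde_on 1 n x = Vandermonde n x"
  by (simp add: vandermonde_on_def Vandermonde_def)

lemma residue_coord_eq_xi: "residue_coord {1..n} y x i = xi n y x i"
  by (simp add: residue_coord_def xi_def)

text \<open>Interlacing puts \<open>x k\<close> and \<open>y k\<close> on the same side of
  \<open>y i\<close> whenever \<open>k \<noteq> i\<close>, so that all quotients are
  positive.\<close>

lemma xi_pos:
  assumes y: "chain n y" and x: "x \<in> Omega n y" and i: "i \<in> {1..n}"
  shows "0 < xi n y x i"
proof -
  have y': "chain_on 1 n y" using y by simp
  have "xi n y x i = (x i - y i) * (\<Prod>k\<in>{1..n} - {i}. (x k - y i) / (y k - y i))"
    unfolding xi_def prod_dividef using i by (subst prod.remove[of "{1..n}" i]) auto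
  moreover have "0 < (x k - y i) / (y k - y i)" if "k \<in> {1..n} - {i}" for k
  proof (cases "k < i")
    case True
    have "x k < y (k + 1)" using x True that i by (auto simp: Omega_def)
    also have "y (k + 1) \<le> y i"
      using chain_on_less[OF y', of "k + 1" i] True that i by (cases "k + 1 = i") auto
    finally have "x k < y i" .
    moreover have "y k < y i" using chain_on_less[OF y', of k i] True that i by auto
    ultimately show ?thesis by (intro divide_neg_neg) auto
  next
    case False
    then have "y i < y k" using chain_on_less[OF y', of i k] that i by auto
    moreover have "y k < x k" using x that by (auto simp: Omega_def)
    ultimately show ?thesis by auto
  qed
  moreover have "0 < x i - y i" using x i by (auto simp: Omega_def)
  ultimately show ?thesis by (simp only: mult_pos_pos prod_pos)
qed

section \<open>The kernel of the operator as a density\<close>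

text \<open>All of \<open>Q_integral\<close> except the polynomial, in the free coordinates that
  remain after the delta function has fixed the last one.\<close>

definition weight :: "nat \<Rightarrow> real \<Rightarrow> (nat \<Rightarrow> real) \<Rightarrow> real \<Rightarrow> (nat \<Rightarrow> real) \<Rightarrow> real" where
  "weight n g y z x =
    (let p = slice_point 1 n y z x in
     if p \<in> Omega n y
     then Gamma (real n * g) / Gamma g ^ n *
       ((z - 1) powr (1 - real n * g) / (Vandermonde n y * (\<Prod>i\<in>{1..n}. y i powr (g - 1)))) *
       (Vandermonde n p * (\<Prod>i\<in>{1..n}. xi n y p i powr (g - 1))) / (\<Prod>i\<in>{1..<n}. x i)
     else 0)"

definition slice_prob :: "nat \<Rightarrow> real \<Rightarrow> (nat \<Rightarrow> real) \<Rightarrow> real \<Rightarrow> (nat \<Rightarrow> real) measure" where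
  "slice_prob n g y z = density (\<Pi>\<^sub>M i\<in>{1..<n}. lborel) (\<lambda>x. ennreal (weight n g y z x))"

definition eta :: "nat \<Rightarrow> (nat \<Rightarrow> real) \<Rightarrow> real \<Rightarrow> (nat \<Rightarrow> real) \<Rightarrow> nat \<Rightarrow> real" where
  "eta n y z x i = xi n y (slice_point 1 n y z x) i / (y i * (z - 1))"

lemma slice_point_measurable:
  assumes "n \<ge> 1" "i \<in> {1..n}"
  shows "(\<lambda>x. slice_point 1 n y z x i) \<in> borel_measurable (\<Pi>\<^sub>M i\<in>{1..<n}. lborel)"
proof (cases "i = n")
  case False
  then have "i \<in> {1..<n}" using assms by auto
  then show ?thesis using False by (simp add: slice_point_def)
qed (simp add: slice_point_def)

lemma xi_measurable:
  assumes "n \<ge> 1"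
  shows "(\<lambda>x. xi n y (slice_point 1 n y z x) i) \<in> borel_measurable (\<Pi>\<^sub>M i\<in>{1..<n}. lborel)"
  unfolding xi_def
  by (intro borel_measurable_divide borel_measurable_prod borel_measurable_diff borel_measurable_const
      slice_point_measurable assms)

lemma eta_measurable:
  assumes "n \<ge> 1"
  shows "(\<lambda>x. eta n y z x i) \<in> borel_measurable (\<Pi>\<^sub>M i\<in>{1..<n}. lborel)"
  unfolding eta_def by (intro borel_measurable_divide borel_measurable_const xi_measurable assms)

lemma slice_point_Omega_measurable:
  assumes "n \<ge> 1"
  shows "Measurable.pred (\<Pi>\<^sub>M i\<in>{1..<n}. lborel) (\<lambda>x. slice_point 1 n y z x \<in> Omega n y)"
proof -
  note [measurable] = slice_point_measurable[OF assms]
  show ?thesis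
    unfolding Omega_def mem_Collect_eq
    by (intro pred_intros_logic pred_intros_finite finite_atLeastAtMost finite_atLeastLessThan
        borel_measurable_pred_less borel_measurable_const slice_point_measurable assms) auto
qed

lemma weight_measurable:
  assumes "n \<ge> 1"
  shows "weight n g y z \<in> borel_measurable (\<Pi>\<^sub>M i\<in>{1..<n}. lborel)"
proof -
  note [measurable] = slice_point_Omega_measurable[OF assms] xi_measurable[OF assms]
  have [measurable]: "(\<lambda>x. Vandermonde n (slice_point 1 n y z x)) \<in> borel_measurable (\<Pi>\<^sub>M i\<in>{1..<n}. lborel)"
    unfolding Vandermonde_def
    by (intro borel_measurable_prod borel_measurable_diff slice_point_measurable assms) auto
  show ?thesis unfolding weight_def Let_def by measurable
qed

lemma chain_pos: "chain n y \<Longrightarrow> i \<in> {1..n} \<Longrightarrow> 0 < y i"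
  using chain_on_pos[of 1 n y i] by auto

lemma Omega_pos: "chain n y \<Longrightarrow> x \<in> Omega n y \<Longrightarrow> i \<in> {1..n} \<Longrightarrow> 0 < x i"
  using chain_pos[of n y i] by (force simp: Omega_def)

lemma Omega_less:
  assumes "chain n y" "x \<in> Omega n y" "1 \<le> i" "i < j" "j \<le> n" shows "x i < x j"
proof -
  have "x i < y (i + 1)" using assms by (auto simp: Omega_def)
  also have "y (i + 1) \<le> y j"
    using chain_on_less[of 1 n y "i + 1" j] assms by (cases "i + 1 = j") auto
  also have "y j < x j" using assms by (auto simp: Omega_def)
  finally show ?thesis .
qed

lemma Vandermonde_pos: "chain n y \<Longrightarrow> x \<in> Omega n y \<Longrightarrow> 0 < Vandermonde n x"
  unfolding vandermonde_on_eq[symmetric] using Omega_less by (intro vandermonde_on_pos) auto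

lemma Vandermonde_chain_pos: "chain n y \<Longrightarrow> 0 < Vandermonde n y"
  unfolding vandermonde_on_eq[symmetric]
  using chain_on_less[of 1 n y] by (intro vandermonde_on_pos) auto

lemma weight_nonneg:
  assumes "chain n y" "0 < g" "n \<ge> 1"
  shows "0 \<le> weight n g y z x"
proof (cases "slice_point 1 n y z x \<in> Omega n y")
  case True
  have "0 < x i" if "i \<in> {1..<n}" for i
    using Omega_pos[OF assms(1) True, of i] that by (auto simp: slice_point_def)
  moreover have "0 < Gamma (real n * g)" "0 < Gamma g" using assms by (auto intro!: Gamma_real_pos)
  ultimately show ?thesis
    using Vandermonde_pos[OF assms(1) True] Vandermonde_chain_pos[OF assms(1)] True
    by (auto simp: weight_def Let_def less_imp_le intro!: mult_nonneg_nonneg divide_nonneg_nonneg prod_nonneg)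
qed (simp add: weight_def)

lemma delta_integral_slice:
  assumes y: "chain n y" and "n \<ge> 1"
  shows "delta_integral n (\<lambda>x. (\<Prod>i\<in>{1..n}. x i) - z * (\<Prod>i\<in>{1..n}. y i))
      (\<lambda>x. if x \<in> Omega n y then F x else 0) =
    (\<integral>x. (if slice_point 1 n y z x \<in> Omega n y
           then F (slice_point 1 n y z x) / of_real (\<Prod>i\<in>{1..<n}. x i) else 0) \<partial>(\<Pi>\<^sub>M i\<in>{1..<n}. lborel))"
  unfolding delta_integral_def
proof (rule Bochner_Integration.integral_cong[OF refl])
  fix x :: "nat \<Rightarrow> real"
  define X where "X = (\<Prod>i\<in>{1..<n}. x i)"
  define Y where "Y = (\<Prod>i\<in>{1..n}. y i)"
  have Y: "0 < Y" unfolding Y_def using chain_pos[OF y] by (auto intro: prod_pos)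
  have prod: "(\<Prod>i\<in>{1..n}. (x(n := t)) i) = X * t" for t
  proof -
    have "{1..n} = insert n {1..<n}" using \<open>n \<ge> 1\<close> by auto
    moreover have "(\<Prod>i\<in>{1..<n}. (x(n := t)) i) = X" unfolding X_def by (intro prod.cong refl) auto
    ultimately show ?thesis by simp
  qed
  have deriv: "deriv (\<lambda>s. X * s - z * Y) t = X" for t
    by (rule DERIV_imp_deriv) (auto intro!: derivative_eq_intros)
  show "(\<Sum>t | (\<Prod>i\<in>{1..n}. (x(n := t)) i) - z * (\<Prod>i\<in>{1..n}. y i) = 0.
      (if x(n := t) \<in> Omega n y then F (x(n := t)) else 0) /
      of_real \<bar>deriv (\<lambda>s. (\<Prod>i\<in>{1..n}. (x(n := s)) i) - z * (\<Prod>i\<in>{1..n}. y i)) t\<bar>) =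
    (if slice_point 1 n y z x \<in> Omega n y
           then F (slice_point 1 n y z x) / of_real (\<Prod>i\<in>{1..<n}. x i) else 0)"
  proof (cases "X = 0")
    \<comment> \<open>If the product of the free coordinates is 0, every summand on the left is a
      quotient by a zero derivative and therefore 0, whatever the set of zeros \<open>t\<close> is;
      on the right, membership in \<open>Omega\<close> would make that product positive.\<close>
    case True
    have "slice_point 1 n y z x \<notin> Omega n y"
    proof
      assume *: "slice_point 1 n y z x \<in> Omega n y"
      have "0 < x i" if "i \<in> {1..<n}" for i
        using Omega_pos[OF y *, of i] that by (auto simp: slice_point_def)
      then have "0 < X" unfolding X_def by (auto intro: prod_pos)
      with True show False by simp
    qed
    moreover have "(if x(n := t) \<in> Omega n y then F (x(n := t)) else 0) /
      of_real \<bar>deriv (\<lambda>s. (\<Prod>i\<in>{1..n}. (x(n := s)) i) - z * (\<Prod>i\<in>{1..n}. y i)) t\<bar> = 0" for t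
      unfolding prod Y_def[symmetric] deriv using True by simp
    ultimately show ?thesis by (simp only: sum.neutral_const if_False)
  next
    case False
    have "{t. X * t - z * Y = 0} = {z * Y / X}" using False by (auto simp: field_simps)
    moreover have "x(n := z * Y / X) = slice_point 1 n y z x"
      by (simp add: slice_point_def X_def Y_def)
    moreover have "\<bar>X\<bar> = X" if "slice_point 1 n y z x \<in> Omega n y"
    proof -
      have "0 < x i" if "i \<in> {1..<n}" for i
        using Omega_pos[OF y \<open>slice_point 1 n y z x \<in> Omega n y\<close>, of i] that by (auto simp: slice_point_def)
      then have "0 < X" unfolding X_def by (auto intro: prod_pos)
      then show ?thesis by simp
    qed
    ultimately show ?thesis
      unfolding prod Y_def[symmetric] deriv X_def[symmetric] by simp
  qed
qed

lemma eval_mpoly_slice_measurable: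
  assumes "n \<ge> 1" "p \<in> sym_polys n"
  shows "(\<lambda>x. eval_mpoly (\<lambda>i. of_real (slice_point 1 n y z x i)) p)
    \<in> borel_measurable (\<Pi>\<^sub>M i\<in>{1..<n}. lborel)"
proof -
  have "(\<lambda>x. complex_of_real (slice_point 1 n y z x i)) \<in> borel_measurable (\<Pi>\<^sub>M i\<in>{1..<n}. lborel)"
    if "e \<in> Poly_Mapping.keys p" "i \<in> Poly_Mapping.keys e" for e i
  proof -
    have "i \<in> {1..n}" using that assms(2) unfolding sym_polys_def by blast
    note [measurable] = slice_point_measurable[OF assms(1) this]
    show ?thesis by measurable
  qed
  then show ?thesis
    unfolding eval_mpoly_def
    by (intro borel_measurable_sum borel_measurable_times borel_measurable_prod borel_measurable_power
        borel_measurable_const)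
qed

lemma Q_integral_eq:
  assumes y: "chain n y" and "n \<ge> 1" "0 < g" "p \<in> sym_polys n"
  shows "Q_integral n g z p y = (\<integral>x. eval_mpoly (\<lambda>i. of_real (slice_point 1 n y z x i)) p \<partial>slice_prob n g y z)"
proof -
  let ?c = "Gamma (real n * g) / Gamma g ^ n * ((z - 1) powr (1 - real n * g) /
         (Vandermonde n y * (\<Prod>i\<in>{1..n}. y i powr (g - 1))))"
  let ?p = "slice_point 1 n y z"
  let ?e = "\<lambda>x. eval_mpoly (\<lambda>i. of_real (?p x i)) p"
  have "(\<integral>x. ?e x \<partial>slice_prob n g y z) = (\<integral>x. weight n g y z x *\<^sub>R ?e x \<partial>(\<Pi>\<^sub>M i\<in>{1..<n}. lborel))"
    unfolding slice_prob_def
    by (rule integral_density)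
      (use eval_mpoly_slice_measurable[OF assms(2,4)] weight_measurable[OF assms(2)] weight_nonneg[OF y assms(3,2)] in auto)
  also have "\<dots> = (\<integral>x. of_real ?c * (if ?p x \<in> Omega n y
        then of_real (Vandermonde n (?p x) * (\<Prod>i\<in>{1..n}. xi n y (?p x) i powr (g - 1))) * ?e x /
          of_real (\<Prod>i\<in>{1..<n}. x i) else 0) \<partial>(\<Pi>\<^sub>M i\<in>{1..<n}. lborel))"
    by (intro Bochner_Integration.integral_cong refl) (simp add: weight_def Let_def scaleR_conv_of_real ac_simps)
  also have "\<dots> = of_real ?c * (\<integral>x. (if ?p x \<in> Omega n y
        then of_real (Vandermonde n (?p x) * (\<Prod>i\<in>{1..n}. xi n y (?p x) i powr (g - 1))) * ?e x /
          of_real (\<Prod>i\<in>{1..<n}. x i) else 0) \<partial>(\<Pi>\<^sub>M i\<in>{1..<n}. lborel))"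
    by (rule integral_mult_right_zero)
  also have "\<dots> = Q_integral n g z p y"
    unfolding Q_integral_def delta_integral_slice[OF y assms(2)] ..
  finally show ?thesis ..
qed

section \<open>Moments of the simplex coordinates\<close>

definition dirichlet_moment :: "nat \<Rightarrow> real \<Rightarrow> (nat \<Rightarrow> nat) \<Rightarrow> real" where
  "dirichlet_moment n g m = (\<Prod>i\<in>{1..n}. pochhammer g (m i)) / pochhammer (real n * g) (\<Sum>i\<in>{1..n}. m i)"

lemma eta_pos:
  assumes "chain n y" "1 < z" "slice_point 1 n y z x \<in> Omega n y" "i \<in> {1..n}"
  shows "0 < eta n y z x i"
  using xi_pos[OF assms(1,3,4)] chain_pos[OF assms(1,4)] assms(2) by (simp add: eta_def)

lemma slice_point_prod:
  assumes "chain n y" "n \<ge> 1" "slice_point 1 n y z x \<in> Omega n y"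
  shows "(\<Prod>i\<in>{1..n}. slice_point 1 n y z x i) = z * (\<Prod>i\<in>{1..n}. y i)"
proof -
  have "0 < x i" if "i \<in> {1..<n}" for i
    using Omega_pos[OF assms(1,3), of i] that by (auto simp: slice_point_def)
  define X where "X = (\<Prod>i\<in>{1..<n}. x i)"
  have X: "0 < X" unfolding X_def using \<open>\<And>i. i \<in> {1..<n} \<Longrightarrow> 0 < x i\<close> by (auto intro: prod_pos)
  have "{1..n} = insert n {1..<n}" using assms(2) by auto
  moreover have "(\<Prod>i\<in>{1..<n}. slice_point 1 n y z x i) = X"
    unfolding X_def by (intro prod.cong refl) (auto simp: slice_point_def)
  ultimately have "(\<Prod>i\<in>{1..n}. slice_point 1 n y z x i) = slice_point 1 n y z x n * X" by simp
  also have "slice_point 1 n y z x n = z * (\<Prod>i\<in>{1..n}. y i) / X" by (simp add: slice_point_def X_def)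
  finally show ?thesis using X by simp
qed

lemma xi_partial_fractions:
  assumes y: "chain n y" and "u \<notin> y ` {1..n}"
  shows "(\<Prod>k\<in>{1..n}. (x k - u) / (y k - u)) = 1 + (\<Sum>i\<in>{1..n}. xi n y x i / (y i - u))"
proof -
  have "chain_on 1 n y" using y by simp
  then have "inj_on y {1..n}" by (rule chain_on_inj)
  then show ?thesis using partial_fractions[of "{1..n}" y u x] assms(2)
    unfolding residue_coord_eq_xi by simp
qed

lemma sum_eta:
  assumes y: "chain n y" and "n \<ge> 1" "1 < z" and x: "slice_point 1 n y z x \<in> Omega n y"
  shows "(\<Sum>i\<in>{1..n}. eta n y z x i) = 1"
proof -
  let ?p = "slice_point 1 n y z x"
  have "0 \<notin> y ` {1..n}" using chain_pos[OF y] by force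
  note pf = xi_partial_fractions[OF y this, of ?p]
  define Y where "Y = (\<Prod>k\<in>{1..n}. y k)"
  have "0 < Y" unfolding Y_def using chain_pos[OF y] by (auto intro: prod_pos)
  have "z * Y / Y = 1 + (\<Sum>i\<in>{1..n}. xi n y ?p i / y i)"
    using pf unfolding diff_0_right prod_dividef slice_point_prod[OF y assms(2) x] Y_def .
  with \<open>0 < Y\<close> have "z - 1 = (\<Sum>i\<in>{1..n}. xi n y ?p i / y i)" by simp
  moreover have "(\<Sum>i\<in>{1..n}. eta n y z x i) = (\<Sum>i\<in>{1..n}. xi n y ?p i / y i) / (z - 1)"
    by (simp add: eta_def sum_divide_distrib)
  ultimately show ?thesis using \<open>1 < z\<close> by simp
qed

lemma eta_le_1:
  assumes "chain n y" "n \<ge> 1" "1 < z" "slice_point 1 n y z x \<in> Omega n y" "i \<in> {1..n}"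
  shows "eta n y z x i \<le> 1"
proof -
  have "eta n y z x i \<le> (\<Sum>i\<in>{1..n}. eta n y z x i)"
    by (rule member_le_sum) (use assms eta_pos[of n y z x] in \<open>auto intro: less_imp_le\<close>)
  then show ?thesis using sum_eta[OF assms(1-4)] by simp
qed

lemma powr_mult_power: "0 < v \<Longrightarrow> v powr (g - 1) * v ^ m = v powr (g + real m - 1)"
  by (simp add: powr_realpow[symmetric] powr_add[symmetric] algebra_simps)

text \<open>The change of variables produces a Dirichlet integral with parameters
  \<open>g + m i\<close>. The powers of \<open>y i\<close> and of \<open>z - 1\<close> coming from
  the prefactor, from the normalisation of \<open>eta\<close> and from that integral all cancel,
  which makes the value independent of \<open>y\<close> and \<open>z\<close>. The case
  \<open>m = 0\<close> gives the total mass.\<close>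

lemma nn_integral_eta_moment:
  assumes y: "chain n y" and n: "n \<ge> 1" and g: "0 < g" and z: "1 < z"
  shows "(\<integral>\<^sup>+x. ennreal (\<Prod>i\<in>{1..n}. eta n y z x i ^ m i) \<partial>slice_prob n g y z) =
    ennreal (dirichlet_moment n g m)"
proof -
  define c where "c = z - 1"
  have c: "0 < c" using z by (simp add: c_def)
  define c' where "c' = Gamma (real n * g) / Gamma g ^ n * (c powr (1 - real n * g) / (\<Prod>i\<in>{1..n}. y i powr (g - 1)))"
  have yi: "0 < y i" if "i \<in> {1..n}" for i using chain_pos[OF y that] .
  have G: "0 < Gamma (real n * g)" "0 < Gamma g" using n g by (auto intro!: Gamma_real_pos)
  have c'0: "0 \<le> c'" unfolding c'_def using G c by (intro mult_nonneg_nonneg divide_nonneg_nonneg prod_nonneg) auto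
  \<comment> \<open>The part of the integrand that depends on \<open>x\<close> only through the
    residue coordinates; the Vandermonde quotient and the divisor are supplied by
    \<open>slice_integrand\<close>.\<close>
  define F where "F = (\<lambda>v::nat \<Rightarrow> real. ennreal (c' * (\<Prod>i\<in>{1..n}. v i powr (g - 1) * (v i / (y i * c)) ^ m i)))"
  have F: "F \<in> borel_measurable (Pi\<^sub>M {1..n} (\<lambda>_. borel))" unfolding F_def by measurable
  have y': "chain_on 1 n y" using y by simp
  have "(\<integral>\<^sup>+x. ennreal (\<Prod>i\<in>{1..n}. eta n y z x i ^ m i) \<partial>slice_prob n g y z) =
    (\<integral>\<^sup>+x. ennreal (weight n g y z x) * ennreal (\<Prod>i\<in>{1..n}. eta n y z x i ^ m i) \<partial>(\<Pi>\<^sub>M i\<in>{1..<n}. lborel))"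
    unfolding slice_prob_def
    using weight_measurable[OF n] eta_measurable[OF n]
    by (intro nn_integral_density measurable_compose[OF _ measurable_ennreal] borel_measurable_prod borel_measurable_power) auto
  also have "\<dots> = (\<integral>\<^sup>+x. slice_integrand 1 n y z F x \<partial>(\<Pi>\<^sub>M i\<in>{1..<n}. lborel))"
  proof (rule nn_integral_cong)
    fix x :: "nat \<Rightarrow> real"
    let ?p = "slice_point 1 n y z x"
    show "ennreal (weight n g y z x) * ennreal (\<Prod>i\<in>{1..n}. eta n y z x i ^ m i) = slice_integrand 1 n y z F x"
    proof (cases "?p \<in> Omega n y")
      case False
      then show ?thesis unfolding weight_def slice_integrand_def interlaced_eq_Omega by simp
    next
      case True
      have "0 < x i" if "i \<in> {1..<n}" for i
        using Omega_pos[OF y True, of i] that by (auto simp: slice_point_def)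
      then have X: "0 < (\<Prod>i\<in>{1..<n}. x i)" by (auto intro: prod_pos)
      have V: "0 < Vandermonde n ?p" "0 < Vandermonde n y" using Vandermonde_pos[OF y True] Vandermonde_chain_pos[OF y] by auto
      have xi: "0 < xi n y ?p i" if "i \<in> {1..n}" for i using xi_pos[OF y True that] .
      let ?P = "\<Prod>i\<in>{1..n}. xi n y ?p i powr (g - 1)"
      let ?M = "\<Prod>i\<in>{1..n}. eta n y z x i ^ m i"
      have M: "0 \<le> ?M" using eta_pos[OF y z True] by (intro prod_nonneg) (auto intro: less_imp_le)
      have "F (\<lambda>i\<in>{1..n}. residue_coord {1..n} y ?p i) = ennreal (c' * (?P * ?M))"
        unfolding F_def residue_coord_eq_xi by (simp add: prod.distrib eta_def c_def)
      moreover have "weight n g y z x * ?M = Vandermonde n ?p / Vandermonde n y / (\<Prod>i\<in>{1..<n}. x i) * (c' * (?P * ?M))"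
        using True V X by (simp add: weight_def Let_def c'_def c_def ac_simps)
      moreover have "0 \<le> ?P" by (intro prod_nonneg) auto
      then have "0 \<le> c' * (?P * ?M)" by (intro mult_nonneg_nonneg c'0 M)
      moreover have "0 \<le> weight n g y z x" by (rule weight_nonneg[OF y g n])
      ultimately show ?thesis
        using True M V X unfolding slice_integrand_def interlaced_eq_Omega vandermonde_on_eq
        by (simp add: less_imp_le flip: ennreal_mult)
    qed
  qed
  also have "\<dots> = (\<integral>\<^sup>+u. simplex_integrand 1 n y z F u \<partial>Pi\<^sub>M {Suc 1..n} (\<lambda>_. lborel))"
    by (rule slice_change_of_variables[OF n y' F])
  also have "\<dots> = (\<integral>\<^sup>+u. ennreal (1 / (\<Prod>i\<in>{Suc 1..n}. y i) * (c' * (y 1 powr (g + real (m 1) - 1) * (\<Prod>i\<in>{1..n}. (1 / (y i * c)) ^ m i)))) *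
     (indicator {u. (\<forall>i\<in>{Suc 1..n}. 0 < u i) \<and> (\<Sum>i\<in>{Suc 1..n}. u i / y i) < c} u *
      ennreal ((c - (\<Sum>i\<in>{Suc 1..n}. u i / y i)) powr ((g + real (m 1)) - 1) * (\<Prod>i\<in>{Suc 1..n}. u i powr ((g + real (m i)) - 1)))) \<partial>Pi\<^sub>M {Suc 1..n} (\<lambda>_. lborel))"
  proof (rule nn_integral_cong)
    fix u :: "nat \<Rightarrow> real"
    let ?S = "\<Sum>i\<in>{Suc 1..n}. u i / y i"
    let ?v = "\<lambda>i\<in>{1..n}. if i = 1 then y 1 * (z - 1 - ?S) else u i"
    show "simplex_integrand 1 n y z F u = ennreal (1 / (\<Prod>i\<in>{Suc 1..n}. y i) * (c' * (y 1 powr (g + real (m 1) - 1) * (\<Prod>i\<in>{1..n}. (1 / (y i * c)) ^ m i)))) *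
     (indicator {u. (\<forall>i\<in>{Suc 1..n}. 0 < u i) \<and> (\<Sum>i\<in>{Suc 1..n}. u i / y i) < c} u *
      ennreal ((c - ?S) powr ((g + real (m 1)) - 1) * (\<Prod>i\<in>{Suc 1..n}. u i powr ((g + real (m i)) - 1))))"
    proof (cases "(\<forall>i\<in>{Suc 1..n}. 0 < u i) \<and> ?S < c")
      case False
      then show ?thesis unfolding simplex_integrand_def c_def by simp
    next
      case True
      have v: "0 < ?v i" if "i \<in> {1..n}" for i
        using that True yi[of i] by (cases "i = 1") (auto simp: c_def)
      have ins: "{1..n} = insert 1 {Suc 1..n}" using n by auto
      have "(\<Prod>i\<in>{1..n}. ?v i powr (g - 1) * (?v i / (y i * c)) ^ m i) =
        (\<Prod>i\<in>{1..n}. (1 / (y i * c)) ^ m i * ?v i powr (g + real (m i) - 1))"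
      proof (intro prod.cong refl)
        fix i assume "i \<in> {1..n}"
        then show "?v i powr (g - 1) * (?v i / (y i * c)) ^ m i = (1 / (y i * c)) ^ m i * ?v i powr (g + real (m i) - 1)"
          unfolding powr_mult_power[OF v[OF \<open>i \<in> {1..n}\<close>], symmetric] by (simp add: power_divide)
      qed
      also have "\<dots> = (\<Prod>i\<in>{1..n}. (1 / (y i * c)) ^ m i) * (\<Prod>i\<in>{1..n}. ?v i powr (g + real (m i) - 1))"
        by (rule prod.distrib)
      also have "(\<Prod>i\<in>{1..n}. ?v i powr (g + real (m i) - 1)) =
        y 1 powr (g + real (m 1) - 1) * (c - ?S) powr (g + real (m 1) - 1) * (\<Prod>i\<in>{Suc 1..n}. u i powr (g + real (m i) - 1))"
      proof -
        have "(\<Prod>i\<in>{Suc 1..n}. ?v i powr (g + real (m i) - 1)) = (\<Prod>i\<in>{Suc 1..n}. u i powr (g + real (m i) - 1))"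
          by (intro prod.cong refl) auto
        moreover have "?v 1 powr (g + real (m 1) - 1) = y 1 powr (g + real (m 1) - 1) * (c - ?S) powr (g + real (m 1) - 1)"
          using n yi[of 1] True by (simp add: c_def powr_mult)
        moreover have "(\<Prod>i\<in>{1..n}. ?v i powr (g + real (m i) - 1)) = ?v 1 powr (g + real (m 1) - 1) * (\<Prod>i\<in>{Suc 1..n}. ?v i powr (g + real (m i) - 1))"
          using n by (rule prod.atLeast_Suc_atMost)
        ultimately show ?thesis by simp
      qed
      finally have prod: "(\<Prod>i\<in>{1..n}. ?v i powr (g - 1) * (?v i / (y i * c)) ^ m i) =
        (\<Prod>i\<in>{1..n}. (1 / (y i * c)) ^ m i) *
        (y 1 powr (g + real (m 1) - 1) * (c - ?S) powr (g + real (m 1) - 1) * (\<Prod>i\<in>{Suc 1..n}. u i powr (g + real (m i) - 1)))" .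
      have ind: "indicator {u. (\<forall>i\<in>{Suc 1..n}. 0 < u i) \<and> (\<Sum>i\<in>{Suc 1..n}. u i / y i) < c} u = (1::ennreal)"
        using True by simp
      have "0 < (\<Prod>i\<in>{Suc 1..n}. y i)" using yi by (intro prod_pos) auto
      then have ypos: "0 \<le> 1 / (\<Prod>i\<in>{Suc 1..n}. y i)" by simp
      have 0: "0 \<le> (\<Prod>i\<in>{1..n}. (1 / (y i * c)) ^ m i)" using yi c by (intro prod_nonneg) (auto intro!: zero_le_power simp: less_imp_le)
      have 1: "ennreal a * ennreal (b * (p * (q * r * s))) = ennreal (a * (b * (q * p))) * ennreal (r * s)"
        if "0 \<le> a" "0 \<le> b" "0 \<le> p" "0 \<le> q" "0 \<le> r" "0 \<le> s" for a b p q r s :: real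
        using that by (simp add: ac_simps flip: ennreal_mult)
      show ?thesis
        unfolding simplex_integrand_def F_def c_def[symmetric] prod[folded c_def] ind mult_1
        by (rule 1) (use ypos c'0 0 in \<open>auto intro: prod_nonneg\<close>)
    qed
  qed
  also have "\<dots> = ennreal (1 / (\<Prod>i\<in>{Suc 1..n}. y i) * (c' * (y 1 powr (g + real (m 1) - 1) * (\<Prod>i\<in>{1..n}. (1 / (y i * c)) ^ m i)))) *
    (ennreal (c powr ((g + real (m 1)) + (\<Sum>i\<in>{Suc 1..n}. g + real (m i)) - 1) * (\<Prod>i\<in>{Suc 1..n}. y i powr (g + real (m i))) *
      (Gamma (g + real (m 1)) * (\<Prod>i\<in>{Suc 1..n}. Gamma (g + real (m i))) / Gamma ((g + real (m 1)) + (\<Sum>i\<in>{Suc 1..n}. g + real (m i))))) * indicator {0<..} c)"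
  proof (subst nn_integral_cmult)
    show "(\<lambda>u. indicator {u. (\<forall>i\<in>{Suc 1..n}. 0 < u i) \<and> (\<Sum>i\<in>{Suc 1..n}. u i / y i) < c} u *
      ennreal ((c - (\<Sum>i\<in>{Suc 1..n}. u i / y i)) powr ((g + real (m 1)) - 1) * (\<Prod>i\<in>{Suc 1..n}. u i powr ((g + real (m i)) - 1))))
      \<in> borel_measurable (Pi\<^sub>M {Suc 1..n} (\<lambda>_. lborel))" by measurable
  qed (subst Dirichlet_nn_integral, use yi g in \<open>auto intro!: add_pos_nonneg\<close>)
  also have "\<dots> = ennreal (dirichlet_moment n g m)"
  proof -
    let ?s = "\<lambda>i. g + real (m i)"
    have s: "0 < ?s i" for i using g by (intro add_pos_nonneg) auto
    have S: "?s 1 + (\<Sum>i\<in>{Suc 1..n}. ?s i) = (\<Sum>i\<in>{1..n}. ?s i)"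
      using sum.atLeast_Suc_atMost[OF n, of ?s] by simp
    have S': "(\<Sum>i\<in>{1..n}. ?s i) = real n * g + real (\<Sum>i\<in>{1..n}. m i)" by (simp add: sum.distrib)
    have Gs: "Gamma (?s 1) * (\<Prod>i\<in>{Suc 1..n}. Gamma (?s i)) = (\<Prod>i\<in>{1..n}. Gamma (?s i))"
      using prod.atLeast_Suc_atMost[OF n, of "\<lambda>i. Gamma (?s i)"] by simp
    have Y: "(\<Prod>i\<in>{Suc 1..n}. y i powr ?s i) / (\<Prod>i\<in>{Suc 1..n}. y i) = (\<Prod>i\<in>{Suc 1..n}. y i powr (?s i - 1))"
      unfolding prod_dividef[symmetric]
    proof (intro prod.cong refl)
      fix i assume "i \<in> {Suc 1..n}"
      then have "0 < y i" using yi by auto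
      then show "y i powr ?s i / y i = y i powr (?s i - 1)" by (simp add: powr_diff)
    qed
    have Y1: "y 1 powr (?s 1 - 1) * (\<Prod>i\<in>{Suc 1..n}. y i powr (?s i - 1)) = (\<Prod>i\<in>{1..n}. y i powr (?s i - 1))"
      using prod.atLeast_Suc_atMost[OF n, of "\<lambda>i. y i powr (?s i - 1)"] by simp
    have Y2: "(\<Prod>i\<in>{1..n}. (1 / (y i * c)) ^ m i) * (\<Prod>i\<in>{1..n}. y i powr (?s i - 1)) =
      (\<Prod>i\<in>{1..n}. y i powr (g - 1)) * (1 / c) ^ (\<Sum>i\<in>{1..n}. m i)"
    proof -
      have "(1 / (y i * c)) ^ m i * y i powr (?s i - 1) = y i powr (g - 1) * (1 / c) ^ m i" if "i \<in> {1..n}" for i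
        unfolding powr_mult_power[OF yi[OF that], symmetric] using yi[OF that] c
        by (simp add: power_divide power_mult_distrib)
      then have "(\<Prod>i\<in>{1..n}. (1 / (y i * c)) ^ m i * y i powr (?s i - 1)) = (\<Prod>i\<in>{1..n}. y i powr (g - 1) * (1 / c) ^ m i)"
        by (rule prod.cong[OF refl])
      then show ?thesis by (simp only: prod.distrib power_sum)
    qed
    \<comment> \<open>The exponents \<open>1 - n g\<close>, \<open>- M\<close> and
      \<open>n g + M - 1\<close> of \<open>z - 1\<close> add up to 0.\<close>
    have C: "c powr (1 - real n * g) * (1 / c) ^ M * c powr (real n * g + real M - 1) = 1" for M
    proof -
      have "(1 / c) ^ M = c powr (- real M)" using c by (simp add: powr_minus powr_realpow power_one_over divide_inverse power_inverse)
      then show ?thesis using c by (simp flip: powr_add)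
    qed
    have GG: "Gamma (real n * g) / Gamma g ^ n * ((\<Prod>i\<in>{1..n}. Gamma (?s i)) / Gamma (real n * g + real M)) =
      (\<Prod>i\<in>{1..n}. pochhammer g (m i)) / pochhammer (real n * g) M" for M
    proof -
      have p: "pochhammer a k = Gamma (a + real k) / Gamma a" if "0 < a" for a k
        by (rule pochhammer_Gamma) (use that in \<open>auto elim!: nonpos_Ints_cases\<close>)
      have ng: "0 < real n * g" using n g by auto
      have "(\<Prod>i\<in>{1..n}. pochhammer g (m i)) = (\<Prod>i\<in>{1..n}. Gamma (?s i)) / Gamma g ^ n"
        by (simp add: p[OF g] prod_dividef)
      then show ?thesis using p[OF ng, of M] G by simp
    qed
    define Q where "Q = (\<Prod>i\<in>{1..n}. y i powr (g - 1))"
    have "0 < Q" unfolding Q_def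
    proof (rule prod_pos)
      fix i assume "i \<in> {1..n}"
      from yi[OF this] show "0 < y i powr (g - 1)" by simp
    qed
    then have Q: "Q \<noteq> 0" by simp
    define M where "M = (\<Sum>i\<in>{1..n}. m i)"
    have "1 / (\<Prod>i\<in>{Suc 1..n}. y i) * (c' * (y 1 powr (?s 1 - 1) * (\<Prod>i\<in>{1..n}. (1 / (y i * c)) ^ m i))) *
      (c powr (real n * g + real M - 1) * (\<Prod>i\<in>{Suc 1..n}. y i powr ?s i) * R) =
      c' * ((\<Prod>i\<in>{1..n}. (1 / (y i * c)) ^ m i) * (y 1 powr (?s 1 - 1) *
        ((\<Prod>i\<in>{Suc 1..n}. y i powr ?s i) / (\<Prod>i\<in>{Suc 1..n}. y i)))) * c powr (real n * g + real M - 1) * R" for R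
      by (simp add: ac_simps)
    also have "\<dots> R = Gamma (real n * g) / Gamma g ^ n * R * (c powr (1 - real n * g) * (1 / c) ^ M * c powr (real n * g + real M - 1))" for R
      unfolding Y Y1 Y2 c'_def M_def[symmetric] Q_def[symmetric] using Q by (simp add: ac_simps)
    finally have key: "1 / (\<Prod>i\<in>{Suc 1..n}. y i) * (c' * (y 1 powr (?s 1 - 1) * (\<Prod>i\<in>{1..n}. (1 / (y i * c)) ^ m i))) *
      (c powr (real n * g + real M - 1) * (\<Prod>i\<in>{Suc 1..n}. y i powr ?s i) * R) = Gamma (real n * g) / Gamma g ^ n * R" for R
      unfolding C by simp
    have 0: "0 \<le> 1 / (\<Prod>i\<in>{Suc 1..n}. y i) * (c' * (y 1 powr (?s 1 - 1) * (\<Prod>i\<in>{1..n}. (1 / (y i * c)) ^ m i)))"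
      using yi c c'0 by (intro mult_nonneg_nonneg divide_nonneg_nonneg prod_nonneg zero_le_power) (auto simp: less_imp_le)
    have R0: "0 \<le> (\<Prod>i\<in>{1..n}. Gamma (?s i)) / Gamma (real n * g + real M)"
    proof -
      have "0 < real n * g + real M" using n g by (intro add_pos_nonneg) auto
      then show ?thesis using s by (intro divide_nonneg_nonneg prod_nonneg less_imp_le Gamma_real_pos)
    qed
    have 1: "0 \<le> c powr (real n * g + real M - 1) * (\<Prod>i\<in>{Suc 1..n}. y i powr ?s i) *
        ((\<Prod>i\<in>{1..n}. Gamma (?s i)) / Gamma (real n * g + real M))"
      by (intro mult_nonneg_nonneg R0 prod_nonneg) auto
    show ?thesis
      unfolding S S' Gs M_def[symmetric] dirichlet_moment_def GG[symmetric] key[symmetric]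
      using c by (subst ennreal_mult[OF 0 1]) simp
  qed
  finally show ?thesis .
qed

lemma sets_slice_prob [simp, measurable_cong]: "sets (slice_prob n g y z) = sets (\<Pi>\<^sub>M i\<in>{1..<n}. lborel)"
  by (simp add: slice_prob_def)

lemma emeasure_slice_prob:
  assumes "chain n y" "n \<ge> 1" "0 < g" "1 < z"
  shows "emeasure (slice_prob n g y z) (space (slice_prob n g y z)) = 1"
proof -
  have "emeasure (slice_prob n g y z) (space (slice_prob n g y z)) = (\<integral>\<^sup>+x. 1 \<partial>slice_prob n g y z)"
    by simp
  also have "\<dots> = 1"
    using nn_integral_eta_moment[OF assms, of "\<lambda>_. 0"] by (simp add: dirichlet_moment_def)
  finally show ?thesis .
qed

lemma finite_measure_slice_prob:
  assumes "chain n y" "n \<ge> 1" "0 < g" "1 < z"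
  shows "finite_measure (slice_prob n g y z)"
  by (rule finite_measureI) (simp add: emeasure_slice_prob[OF assms])

lemma AE_slice_prob:
  assumes "n \<ge> 1"
  shows "AE x in slice_prob n g y z. slice_point 1 n y z x \<in> Omega n y"
proof -
  have "(\<lambda>x. ennreal (weight n g y z x)) \<in> borel_measurable (\<Pi>\<^sub>M i\<in>{1..<n}. lborel)"
    using weight_measurable[OF assms] by measurable
  from AE_density[OF this]
  show ?thesis unfolding slice_prob_def by (auto simp: weight_def Let_def intro!: AE_I2)
qed

lemma eta_measurable_slice_prob:
  "n \<ge> 1 \<Longrightarrow> (\<lambda>x. eta n y z x i) \<in> borel_measurable (slice_prob n g y z)"
  using eta_measurable[of n y z i] by (simp add: measurable_cong_sets[OF sets_slice_prob refl])

lemma integrable_eta_moment: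
  assumes "chain n y" "n \<ge> 1" "0 < g" "1 < z"
  shows "integrable (slice_prob n g y z) (\<lambda>x. \<Prod>i\<in>{1..n}. eta n y z x i ^ m i)"
proof -
  interpret finite_measure "slice_prob n g y z" by (rule finite_measure_slice_prob[OF assms])
  show ?thesis
  proof (rule integrable_const_bound[where B = 1])
    show "AE x in slice_prob n g y z. norm (\<Prod>i\<in>{1..n}. eta n y z x i ^ m i) \<le> 1"
      using AE_slice_prob[OF assms(2), where g = g and y = y and z = z]
    proof eventually_elim
      case (elim x)
      have "0 \<le> eta n y z x i" "eta n y z x i \<le> 1" if "i \<in> {1..n}" for i
        using eta_pos[OF assms(1,4) elim that] eta_le_1[OF assms(1,2,4) elim that] by auto
      then have "0 \<le> (\<Prod>i\<in>{1..n}. eta n y z x i ^ m i) \<and> (\<Prod>i\<in>{1..n}. eta n y z x i ^ m i) \<le> 1"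
        by (intro conjI prod_nonneg prod_le_1) (auto intro: power_le_one)
      then show ?case by simp
    qed
    show "(\<lambda>x. \<Prod>i\<in>{1..n}. eta n y z x i ^ m i) \<in> borel_measurable (slice_prob n g y z)"
      by (intro borel_measurable_prod borel_measurable_power eta_measurable_slice_prob assms)
  qed
qed

lemma integral_eta_moment:
  assumes "chain n y" "n \<ge> 1" "0 < g" "1 < z"
  shows "(\<integral>x. (\<Prod>i\<in>{1..n}. eta n y z x i ^ m i) \<partial>slice_prob n g y z) = dirichlet_moment n g m"
proof (subst integral_eq_nn_integral)
  show "AE x in slice_prob n g y z. 0 \<le> (\<Prod>i\<in>{1..n}. eta n y z x i ^ m i)"
    using AE_slice_prob[OF assms(2), where g = g and y = y and z = z]
    by eventually_elim (intro prod_nonneg zero_le_power less_imp_le eta_pos[OF assms(1,4)]; simp)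
  show "(\<lambda>x. \<Prod>i\<in>{1..n}. eta n y z x i ^ m i) \<in> borel_measurable (slice_prob n g y z)"
    by (intro borel_measurable_prod borel_measurable_power eta_measurable_slice_prob assms)
  have "0 \<le> dirichlet_moment n g m"
    unfolding dirichlet_moment_def using assms(2,3)
    by (intro divide_nonneg_nonneg prod_nonneg) (auto intro!: less_imp_le pochhammer_pos)
  then show "enn2real (\<integral>\<^sup>+x. ennreal (\<Prod>i\<in>{1..n}. eta n y z x i ^ m i) \<partial>slice_prob n g y z) = dirichlet_moment n g m"
    unfolding nn_integral_eta_moment[OF assms] by simp
qed

section \<open>Symmetric functions\<close>

text \<open>Polynomials are represented by the functions they induce. Substitution is then plain
  composition, and every closure property is one induction over the way a function was
  built.\<close>

inductive_set generated_ring :: "('s \<Rightarrow> complex) set \<Rightarrow> ('s \<Rightarrow> complex) set" for B where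
  base: "b \<in> B \<Longrightarrow> b \<in> generated_ring B"
| const: "(\<lambda>_. c) \<in> generated_ring B"
| add: "f \<in> generated_ring B \<Longrightarrow> h \<in> generated_ring B \<Longrightarrow> (\<lambda>s. f s + h s) \<in> generated_ring B"
| mult: "f \<in> generated_ring B \<Longrightarrow> h \<in> generated_ring B \<Longrightarrow> (\<lambda>s. f s * h s) \<in> generated_ring B"

lemma generated_ring_subst:
  assumes "f \<in> generated_ring B" "\<And>b. b \<in> B \<Longrightarrow> (\<lambda>s. b (\<phi> s)) \<in> generated_ring C"
  shows "(\<lambda>s. f (\<phi> s)) \<in> generated_ring C"
  using assms(1) by induction (auto intro: generated_ring.intros assms(2))

lemma generated_ring_sum:
  assumes "\<And>i. i \<in> I \<Longrightarrow> f i \<in> generated_ring B"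
  shows "(\<lambda>s. \<Sum>i\<in>I. f i s) \<in> generated_ring B"
  using assms by (induction I rule: infinite_finite_induct) (auto intro: generated_ring.intros)

lemma generated_ring_sum_list:
  assumes "\<And>c. c \<in> set l \<Longrightarrow> f c \<in> generated_ring B"
  shows "(\<lambda>s. \<Sum>c\<leftarrow>l. f c s) \<in> generated_ring B"
  using assms by (induction l) (auto intro: generated_ring.intros)

lemma generated_ring_cmult: "f \<in> generated_ring B \<Longrightarrow> (\<lambda>s. c * f s) \<in> generated_ring B"
  by (rule generated_ring.mult[OF generated_ring.const])

lemma generated_ring_diff:
  assumes "f \<in> generated_ring B" "h \<in> generated_ring B"
  shows "(\<lambda>s. f s - h s) \<in> generated_ring B"
  using generated_ring.add[OF assms(1) generated_ring_cmult[OF assms(2), of "- 1"]] by simp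

lemma sum_list_mult_sum_list:
  fixes f :: "'a \<Rightarrow> 'c::comm_semiring_0"
  shows "(\<Sum>x\<leftarrow>xs. f x) * (\<Sum>y\<leftarrow>ys. h y) = (\<Sum>(x, y)\<leftarrow>List.product xs ys. f x * h y)"
  by (induction xs) (simp_all add: distrib_right comp_def sum_list_const_mult)

text \<open>Multiplying out: each generator is either a coefficient or lies in the multiplicatively
  closed set \<open>M\<close>, so sums of products of a coefficient with an element of
  \<open>M\<close> are stable under sums and products. This separates the variables that are summed
  or integrated from those that are kept fixed.\<close>

lemma generated_ring_normal_form:
  assumes "f \<in> generated_ring C"
    and C: "\<And>b. b \<in> C \<Longrightarrow> b \<in> generated_ring B \<or> b \<in> M"
    and one: "(\<lambda>_. 1) \<in> M" and mult: "\<And>a b. a \<in> M \<Longrightarrow> b \<in> M \<Longrightarrow> (\<lambda>s. a s * b s) \<in> M"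
  shows "\<exists>l. set l \<subseteq> generated_ring B \<times> M \<and> (\<forall>s. f s = (\<Sum>(c, m)\<leftarrow>l. c s * m s))"
  using assms(1)
proof induction
  case (base b)
  from C[OF base] show ?case
  proof
    assume "b \<in> generated_ring B"
    then show ?thesis using one by (intro exI[of _ "[(b, \<lambda>_. 1)]"]) auto
  next
    assume "b \<in> M"
    then show ?thesis by (intro exI[of _ "[(\<lambda>_. 1, b)]"]) (auto intro: generated_ring.const)
  qed
next
  case (const c)
  show ?case using one by (intro exI[of _ "[(\<lambda>_. c, \<lambda>_. 1)]"]) (auto intro: generated_ring.const)
next
  case (add f h)
  then obtain l l' where "set l \<subseteq> generated_ring B \<times> M" "\<forall>s. f s = (\<Sum>(c, m)\<leftarrow>l. c s * m s)"
    "set l' \<subseteq> generated_ring B \<times> M" "\<forall>s. h s = (\<Sum>(c, m)\<leftarrow>l'. c s * m s)" by blast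
  then show ?case by (intro exI[of _ "l @ l'"]) auto
next
  case (mult f h)
  then obtain l l' where l: "set l \<subseteq> generated_ring B \<times> M" "\<forall>s. f s = (\<Sum>(c, m)\<leftarrow>l. c s * m s)"
    "set l' \<subseteq> generated_ring B \<times> M" "\<forall>s. h s = (\<Sum>(c, m)\<leftarrow>l'. c s * m s)" by blast
  let ?p = "\<lambda>((c, m), (c', m')). ((\<lambda>s. c s * c' s), (\<lambda>s. m s * m' s))"
  have "set (map ?p (List.product l l')) \<subseteq> generated_ring B \<times> M"
    using l(1,3) assms(4) by (fastforce intro: generated_ring.mult)
  moreover have "f s * h s = (\<Sum>(c, m)\<leftarrow>map ?p (List.product l l'). c s * m s)" for s
  proof -
    have "f s * h s = (\<Sum>(p, q)\<leftarrow>List.product l l'. (case p of (c, m) \<Rightarrow> c s * m s) * (case q of (c, m) \<Rightarrow> c s * m s))"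
      using l(2,4) by (simp only: sum_list_mult_sum_list)
    then show ?thesis by (simp add: case_prod_unfold comp_def ac_simps)
  qed
  ultimately show ?case by blast
qed

text \<open>Polynomials in countably many indeterminates \<open>w 0\<close>, \<open>w 1\<close>,
  ...; the sequences of power sums and of elementary symmetric functions are substituted for
  \<open>w\<close>.\<close>

definition poly_funs :: "((nat \<Rightarrow> complex) \<Rightarrow> complex) set" where
  "poly_funs = generated_ring (range (\<lambda>i w. w i))"

lemma poly_funs_coord: "(\<lambda>w. w i) \<in> poly_funs"
  unfolding poly_funs_def by (rule generated_ring.base) auto

text \<open>Dropping one variable with value \<open>u\<close> changes the power sum of order
  \<open>k\<close> by \<open>- u ^ k\<close>. The expansion in powers of \<open>u\<close>, with
  coefficients in the full power sums, is what permits a later summation over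
  \<open>u\<close>.\<close>

lemma poly_funs_shift_powers:
  assumes "s \<in> poly_funs"
  shows "\<exists>l. (\<forall>(c, k)\<in>set l. c \<in> poly_funs) \<and>
    (\<forall>p u. s (\<lambda>k. p k - u ^ k) = (\<Sum>(c, k::nat)\<leftarrow>l. c p * u ^ k))"
proof -
  let ?B = "range (\<lambda>i (t :: (nat \<Rightarrow> complex) \<times> complex). fst t i)"
  let ?M = "range (\<lambda>k (t :: (nat \<Rightarrow> complex) \<times> complex). snd t ^ k)"
  have "(\<lambda>t. s (\<lambda>k. fst t k - snd t ^ k)) \<in> generated_ring (?B \<union> ?M)"
  proof (rule generated_ring_subst[OF assms[unfolded poly_funs_def]])
    fix b assume "b \<in> range (\<lambda>i (w :: nat \<Rightarrow> complex). w i)"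
    then obtain i where "b = (\<lambda>w. w i)" by auto
    moreover have "(\<lambda>t. fst t i) \<in> generated_ring (?B \<union> ?M)" "(\<lambda>t. snd t ^ i) \<in> generated_ring (?B \<union> ?M)"
      by (auto intro: generated_ring.base)
    from generated_ring_diff[OF this] have "(\<lambda>t. fst t i - snd t ^ i) \<in> generated_ring (?B \<union> ?M)"
      .
    ultimately show "(\<lambda>t. b (\<lambda>k. fst t k - snd t ^ k)) \<in> generated_ring (?B \<union> ?M)" by simp
  qed
  then have "\<exists>l. set l \<subseteq> generated_ring ?B \<times> ?M \<and>
      (\<forall>t. s (\<lambda>k. fst t k - snd t ^ k) = (\<Sum>(c, m)\<leftarrow>l. c t * m t))"
  proof (rule generated_ring_normal_form)
    show "(\<lambda>_. 1) \<in> ?M" by (rule image_eqI[of _ _ 0]) auto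
    show "(\<lambda>t. a t * b t) \<in> ?M" if "a \<in> ?M" "b \<in> ?M" for a b
    proof -
      obtain j k where "a = (\<lambda>t. snd t ^ j)" "b = (\<lambda>t. snd t ^ k)" using \<open>a \<in> ?M\<close> \<open>b \<in> ?M\<close> by auto
      then show ?thesis by (intro image_eqI[of _ _ "j + k"]) (auto simp: power_add)
    qed
  qed (auto intro: generated_ring.base)
  then obtain l where l: "set l \<subseteq> generated_ring ?B \<times> ?M"
    "\<And>t. s (\<lambda>k. fst t k - snd t ^ k) = (\<Sum>(c, m)\<leftarrow>l. c t * m t)" by blast
  have indep: "c (p, u) = c (p, 0)" if "c \<in> generated_ring ?B" for c p u
    using that by induction auto
  have "\<exists>k. \<forall>p u. m (p, u) = u ^ k" if "m \<in> ?M" for m using that by auto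
  then obtain d where d: "m (p, u) = u ^ d m" if "m \<in> ?M" for m p u by metis
  define l' where "l' = map (\<lambda>(c, m). ((\<lambda>p. c (p, 0 :: complex)), d m)) l"
  have "c \<in> poly_funs" if ck: "(c, k) \<in> set l'" for c k
  proof -
    obtain t where t: "t \<in> set l" "(c, k) = (\<lambda>(c, m). ((\<lambda>p. c (p, 0 :: complex)), d m)) t"
      using ck unfolding l'_def set_map by blast
    obtain c' m where "t = (c', m)" by (cases t)
    with t have "(c', m) \<in> set l" and c: "c = (\<lambda>p. c' (p, 0))" by auto
    then have c': "c' \<in> generated_ring ?B" using l(1) by auto
    show ?thesis unfolding c poly_funs_def
      by (rule generated_ring_subst[OF c']) (auto intro: generated_ring.base)
  qed
  moreover have "s (\<lambda>k. p k - u ^ k) = (\<Sum>(c, k)\<leftarrow>l'. c p * u ^ k)" for p u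
  proof -
    have "s (\<lambda>k. p k - u ^ k) = (\<Sum>(c, m)\<leftarrow>l. c (p, u) * m (p, u))"
      using l(2)[of "(p, u)"] by simp
    also have "\<dots> = (\<Sum>(c, m)\<leftarrow>l. c (p, 0) * u ^ d m)"
    proof (intro arg_cong[where f = sum_list] map_cong refl)
      fix t assume "t \<in> set l"
      moreover obtain c m where t: "t = (c, m)" by (cases t)
      ultimately have "c \<in> generated_ring ?B" "m \<in> ?M" using l(1) by auto
      then show "(case t of (c, m) \<Rightarrow> c (p, u) * m (p, u)) = (case t of (c, m) \<Rightarrow> c (p, 0) * u ^ d m)"
        unfolding t using indep[of c p u] d[of m p u] by simp
    qed
    finally show ?thesis by (simp add: l'_def comp_def case_prod_unfold)
  qed
  ultimately show ?thesis by (intro exI[of _ l']) blast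
qed

section \<open>Permutation sums, power sums and elementary symmetric functions\<close>

text \<open>A permutation of \<open>insert b S\<close> consists of the image \<open>c\<close> of
  \<open>b\<close> and a permutation of the rest. By induction the inner sum is a polynomial in the
  power sums of the other values, each of which lacks \<open>x c ^ k\<close>; after expansion in
  powers of \<open>x c\<close>, the sum over \<open>c\<close> produces power sums again.\<close>

lemma permutation_sum_in_power_sums:
  fixes a :: "nat \<Rightarrow> nat"
  assumes "finite S"
  shows "\<exists>s\<in>poly_funs. \<forall>x. (\<Sum>q | q permutes S. \<Prod>i\<in>S. x (q i) ^ a i) = s (\<lambda>k. \<Sum>i\<in>S. x i ^ k)"
  using assms
proof (induction S)
  case empty
  show ?case by (rule bexI[of _ "\<lambda>_. 1"]) (auto simp: poly_funs_def intro: generated_ring.const)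
next
  case (insert b S)
  then obtain s where s: "s \<in> poly_funs"
    "\<And>x. (\<Sum>q | q permutes S. \<Prod>i\<in>S. x (q i) ^ a i) = s (\<lambda>k. \<Sum>i\<in>S. x i ^ k)" by blast
  obtain l where l: "\<And>c k. (c, k) \<in> set l \<Longrightarrow> c \<in> poly_funs"
    "\<And>p u. s (\<lambda>k. p k - u ^ k) = (\<Sum>(c, k)\<leftarrow>l. c p * u ^ k)"
    using poly_funs_shift_powers[OF s(1)] by blast
  define s' where "s' = (\<lambda>p. \<Sum>(c, k)\<leftarrow>l. c p * p (a b + k))"
  have "s' \<in> poly_funs"
    unfolding s'_def poly_funs_def split_beta
    by (intro generated_ring_sum_list generated_ring.mult)
      (use l(1) poly_funs_coord in \<open>auto simp: poly_funs_def\<close>)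
  moreover have "(\<Sum>q | q permutes insert b S. \<Prod>i\<in>insert b S. x (q i) ^ a i) = s' (\<lambda>k. \<Sum>i\<in>insert b S. x i ^ k)" for x
  proof -
    let ?P = "\<lambda>k. \<Sum>i\<in>insert b S. x i ^ k"
    have "(\<Sum>q | q permutes insert b S. \<Prod>i\<in>insert b S. x (q i) ^ a i) =
      (\<Sum>c\<in>insert b S. \<Sum>q | q permutes S. \<Prod>i\<in>insert b S. x ((Transposition.transpose b c \<circ> q) i) ^ a i)"
      by (rule sum_over_permutations_insert) (use insert in auto)
    also have "\<dots> = (\<Sum>c\<in>insert b S. x c ^ a b * s (\<lambda>k. ?P k - x c ^ k))"
    proof (intro sum.cong refl)
      fix c assume c: "c \<in> insert b S"
      have "(\<Sum>q | q permutes S. \<Prod>i\<in>insert b S. x ((Transposition.transpose b c \<circ> q) i) ^ a i) =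
        (\<Sum>q | q permutes S. x c ^ a b * (\<Prod>i\<in>S. x (Transposition.transpose b c (q i)) ^ a i))"
      proof (intro sum.cong refl)
        fix q assume "q \<in> {q. q permutes S}"
        then have "q b = b" using insert by (auto simp: permutes_def)
        then show "(\<Prod>i\<in>insert b S. x ((Transposition.transpose b c \<circ> q) i) ^ a i) = x c ^ a b * (\<Prod>i\<in>S. x (Transposition.transpose b c (q i)) ^ a i)"
          using insert by simp
      qed
      also have "\<dots> = x c ^ a b * s (\<lambda>k. \<Sum>i\<in>S. x (Transposition.transpose b c i) ^ k)"
        unfolding sum_distrib_left[symmetric] s(2)[of "\<lambda>i. x (Transposition.transpose b c i)"] ..
      also have "(\<lambda>k. \<Sum>i\<in>S. x (Transposition.transpose b c i) ^ k) = (\<lambda>k. ?P k - x c ^ k)"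
      proof
        fix k
        have "(\<Sum>i\<in>insert b S. x (Transposition.transpose b c i) ^ k) = ?P k"
          using sum.permute[of "Transposition.transpose b c" "insert b S" "\<lambda>i. x i ^ k"] c
          by (simp add: comp_def permutes_swap_id)
        then show "(\<Sum>i\<in>S. x (Transposition.transpose b c i) ^ k) = ?P k - x c ^ k"
          using insert by (simp add: algebra_simps)
      qed
      finally show "(\<Sum>q | q permutes S. \<Prod>i\<in>insert b S. x ((Transposition.transpose b c \<circ> q) i) ^ a i) =
        x c ^ a b * s (\<lambda>k. ?P k - x c ^ k)" .
    qed
    also have "\<dots> = (\<Sum>c\<in>insert b S. \<Sum>(cf, k)\<leftarrow>l. cf ?P * x c ^ (a b + k))"
      unfolding l(2) by (intro sum.cong refl) (simp add: sum_list_const_mult[symmetric] power_add case_prod_unfold ac_simps)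
    also have "\<dots> = (\<Sum>(cf, k)\<leftarrow>l. \<Sum>c\<in>insert b S. cf ?P * x c ^ (a b + k))"
      by (induction l) (auto simp: sum.distrib split_beta)
    also have "\<dots> = s' ?P"
      unfolding s'_def sum_distrib_left ..
    finally show ?thesis .
  qed
  ultimately show ?case by blast
qed

definition esym :: "nat set \<Rightarrow> (nat \<Rightarrow> complex) \<Rightarrow> nat \<Rightarrow> complex" where
  "esym S x r = coeff (\<Prod>i\<in>S. [:1, x i:]) r"

text \<open>The generating polynomial of \<open>S - {j}\<close> is that of \<open>S\<close> divided
  by \<open>1 + x j T\<close>, expanded as a geometric series.\<close>

lemma esym_remove:
  assumes "finite S" "j \<in> S"
  shows "esym (S - {j}) x r = (\<Sum>i\<le>r. (- x j) ^ i * esym S x (r - i))"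
proof (induction r)
  case 0
  show ?case by (simp add: esym_def poly_0_coeff_0[symmetric] poly_prod)
next
  case (Suc r)
  have "(\<Prod>i\<in>S. [:1, x i:]) = [:1, x j:] * (\<Prod>i\<in>S - {j}. [:1, x i:])"
    by (rule prod.remove[OF assms])
  then have "esym S x (Suc r) = esym (S - {j}) x (Suc r) + x j * esym (S - {j}) x r"
    by (simp add: esym_def mult_pCons_left)
  then have "esym (S - {j}) x (Suc r) = esym S x (Suc r) + (\<Sum>i\<le>r. (- x j) ^ Suc i * esym S x (r - i))"
    by (simp add: Suc sum_distrib_left sum_negf mult.assoc algebra_simps)
  also have "\<dots> = (\<Sum>i\<le>Suc r. (- x j) ^ i * esym S x (Suc r - i))"
    by (subst sum.atMost_Suc_shift) simp
  finally show ?case .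
qed

text \<open>Coefficients of order \<open>r\<close> in the derivative of the product of all
  \<open>1 + x i T\<close> are compared; the product rule leaves products over
  \<open>S - {j}\<close>, which \<open>esym_remove\<close> rewrites.\<close>

lemma newton_identity:
  assumes "finite S"
  shows "of_nat (Suc r) * esym S x (Suc r) = (\<Sum>i\<le>r. (- 1) ^ i * (\<Sum>j\<in>S. x j ^ Suc i) * esym S x (r - i))"
proof -
  have "of_nat (Suc r) * esym S x (Suc r) = coeff (pderiv (\<Prod>i\<in>S. [:1, x i:])) r"
    by (simp add: esym_def coeff_pderiv)
  also have "\<dots> = (\<Sum>j\<in>S. x j * esym (S - {j}) x r)"
    by (simp add: pderiv_prod coeff_sum esym_def pderiv_pCons mult.commute)
  also have "\<dots> = (\<Sum>j\<in>S. \<Sum>i\<le>r. (- 1) ^ i * x j ^ Suc i * esym S x (r - i))"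
    by (intro sum.cong refl)
      (simp add: esym_remove[OF assms] sum_distrib_left power_minus[of "x _"] ac_simps)
  also have "\<dots> = (\<Sum>i\<le>r. (- 1) ^ i * (\<Sum>j\<in>S. x j ^ Suc i) * esym S x (r - i))"
    by (subst sum.swap) (simp add: sum_distrib_left sum_distrib_right mult.assoc)
  finally show ?thesis .
qed

text \<open>In Newton's identity of order \<open>k\<close> the power sum of that order has
  coefficient 1 or -1, because \<open>esym S x 0 = 1\<close>; solving for it gives a
  recursion.\<close>

lemma power_sum_in_esym:
  assumes "finite S"
  shows "\<exists>s\<in>poly_funs. \<forall>x. (\<Sum>i\<in>S. x i ^ k) = s (esym S x)"
proof (induction k rule: less_induct)
  case (less k)
  show ?case
  proof (cases k)
    case 0
    then show ?thesis
      by (intro bexI[of _ "\<lambda>_. of_nat (card S)"]) (auto simp: poly_funs_def intro: generated_ring.const)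
  next
    case (Suc r)
    have "\<forall>i\<in>{..<k}. \<exists>s. s \<in> poly_funs \<and> (\<forall>x. (\<Sum>j\<in>S. x j ^ i) = s (esym S x))"
      using less by blast
    then obtain s where s: "\<And>i. i < k \<Longrightarrow> s i \<in> poly_funs"
      "\<And>i x. i < k \<Longrightarrow> (\<Sum>j\<in>S. x j ^ i) = s i (esym S x)" by (metis lessThan_iff)
    define t where "t = (\<lambda>e. (- 1) ^ r * (of_nat (Suc r) * e (Suc r) - (\<Sum>i<r. (- 1) ^ i * s (Suc i) e * e (r - i))))"
    have "t \<in> poly_funs"
      unfolding t_def poly_funs_def
      by (intro generated_ring_cmult generated_ring_diff generated_ring_sum generated_ring.mult)
        (use s(1) poly_funs_coord Suc in \<open>auto simp: poly_funs_def intro: generated_ring.const\<close>)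
    moreover have "(\<Sum>j\<in>S. x j ^ k) = t (esym S x)" for x
    proof -
      have "esym S x 0 = 1" by (simp add: esym_def poly_0_coeff_0[symmetric] poly_prod)
      then have "of_nat (Suc r) * esym S x (Suc r) =
        (\<Sum>i<r. (- 1) ^ i * s (Suc i) (esym S x) * esym S x (r - i)) + (- 1) ^ r * (\<Sum>j\<in>S. x j ^ Suc r)"
        unfolding newton_identity[OF assms] lessThan_Suc_atMost[symmetric] using s(2) Suc by (simp del: power_Suc)
      moreover have "(- 1) ^ r * ((- 1) ^ r * c) = c" for c :: complex
        by (simp add: mult.assoc[symmetric] flip: power_mult_distrib)
      ultimately show ?thesis unfolding t_def Suc by simp
    qed
    ultimately show ?thesis by blast
  qed
qed

lemma permutation_sum_in_esym:
  fixes a :: "nat \<Rightarrow> nat"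
  assumes "finite S"
  shows "\<exists>s\<in>poly_funs. \<forall>x. (\<Sum>q | q permutes S. \<Prod>i\<in>S. x (q i) ^ a i) = s (esym S x)"
proof -
  obtain s where s: "s \<in> poly_funs"
    "\<And>x. (\<Sum>q | q permutes S. \<Prod>i\<in>S. x (q i) ^ a i) = s (\<lambda>k. \<Sum>i\<in>S. x i ^ k)"
    using permutation_sum_in_power_sums[OF assms] by blast
  obtain t where t: "\<And>k. t k \<in> poly_funs" "\<And>k x. (\<Sum>i\<in>S. x i ^ k) = t k (esym S x)"
    using power_sum_in_esym[OF assms] by metis
  have "(\<lambda>e. s (\<lambda>k. t k e)) \<in> poly_funs"
    unfolding poly_funs_def
    by (rule generated_ring_subst[OF s(1)[unfolded poly_funs_def]]) (use t(1) in \<open>auto simp: poly_funs_def\<close>)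
  then show ?thesis using s(2) t(2) by auto
qed

section \<open>Evaluation of polynomials\<close>

abbreviation monom_eval :: "(nat \<Rightarrow> complex) \<Rightarrow> (nat \<Rightarrow>\<^sub>0 nat) \<Rightarrow> complex" where
  "monom_eval x e \<equiv> (\<Prod>i\<in>Poly_Mapping.keys e. x i ^ Poly_Mapping.lookup e i)"

lemma monom_eval_superset:
  assumes "finite I" "Poly_Mapping.keys e \<subseteq> I"
  shows "monom_eval x e = (\<Prod>i\<in>I. x i ^ Poly_Mapping.lookup e i)"
  using assms by (intro prod.mono_neutral_left) (auto simp: in_keys_iff)

lemma monom_eval_add: "monom_eval x (e + f) = monom_eval x e * monom_eval x f"
proof -
  let ?I = "Poly_Mapping.keys e \<union> Poly_Mapping.keys f"
  have "monom_eval x (e + f) = (\<Prod>i\<in>?I. x i ^ Poly_Mapping.lookup (e + f) i)"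
    by (rule monom_eval_superset) (use keys_add[of e f] in auto)
  also have "\<dots> = (\<Prod>i\<in>?I. x i ^ Poly_Mapping.lookup e i) * (\<Prod>i\<in>?I. x i ^ Poly_Mapping.lookup f i)"
    by (simp add: lookup_add power_add prod.distrib)
  also have "(\<Prod>i\<in>?I. x i ^ Poly_Mapping.lookup e i) = monom_eval x e"
    by (rule monom_eval_superset[symmetric]) auto
  also have "(\<Prod>i\<in>?I. x i ^ Poly_Mapping.lookup f i) = monom_eval x f"
    by (rule monom_eval_superset[symmetric]) auto
  finally show ?thesis .
qed

lemma eval_mpoly_superset:
  assumes "finite A" "Poly_Mapping.keys p \<subseteq> A"
  shows "eval_mpoly x p = (\<Sum>e\<in>A. Poly_Mapping.lookup p e * monom_eval x e)"
  unfolding eval_mpoly_def using assms by (intro sum.mono_neutral_left) (auto simp: in_keys_iff)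

lemma eval_mpoly_0 [simp]: "eval_mpoly x 0 = 0"
  by (simp add: eval_mpoly_def)

lemma eval_mpoly_add [simp]: "eval_mpoly x (p + q) = eval_mpoly x p + eval_mpoly x q"
proof -
  let ?A = "Poly_Mapping.keys p \<union> Poly_Mapping.keys q"
  have "eval_mpoly x (p + q) = (\<Sum>e\<in>?A. Poly_Mapping.lookup (p + q) e * monom_eval x e)"
    by (rule eval_mpoly_superset) (use keys_add[of p q] in auto)
  also have "\<dots> = (\<Sum>e\<in>?A. Poly_Mapping.lookup p e * monom_eval x e) + (\<Sum>e\<in>?A. Poly_Mapping.lookup q e * monom_eval x e)"
    by (simp add: lookup_add distrib_right sum.distrib)
  also have "(\<Sum>e\<in>?A. Poly_Mapping.lookup p e * monom_eval x e) = eval_mpoly x p"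
    by (rule eval_mpoly_superset[symmetric]) auto
  also have "(\<Sum>e\<in>?A. Poly_Mapping.lookup q e * monom_eval x e) = eval_mpoly x q"
    by (rule eval_mpoly_superset[symmetric]) auto
  finally show ?thesis .
qed

lemma eval_mpoly_sum [simp]: "eval_mpoly x (\<Sum>i\<in>I. p i) = (\<Sum>i\<in>I. eval_mpoly x (p i))"
  by (induction I rule: infinite_finite_induct) auto

lemma eval_mpoly_single [simp]: "eval_mpoly x (Poly_Mapping.single e c) = c * monom_eval x e"
  by (simp add: eval_mpoly_superset[of "{e}"])

lemma poly_mapping_eq_sum_single:
  "p = (\<Sum>e\<in>Poly_Mapping.keys p. Poly_Mapping.single e (Poly_Mapping.lookup p e))"
proof (rule poly_mapping_eqI)
  fix e
  show "Poly_Mapping.lookup p e = Poly_Mapping.lookup (\<Sum>e\<in>Poly_Mapping.keys p. Poly_Mapping.single e (Poly_Mapping.lookup p e)) e"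
    by (simp add: lookup_sum lookup_single when_def in_keys_iff)
qed

lemma eval_mpoly_mult [simp]: "eval_mpoly x (p * q) = eval_mpoly x p * eval_mpoly x q"
proof -
  have "p * q = (\<Sum>e\<in>Poly_Mapping.keys p. \<Sum>f\<in>Poly_Mapping.keys q.
    Poly_Mapping.single (e + f) (Poly_Mapping.lookup p e * Poly_Mapping.lookup q f))"
    by (subst (1) poly_mapping_eq_sum_single[of p], subst (1) poly_mapping_eq_sum_single[of q])
      (simp add: sum_product mult_single)
  then have "eval_mpoly x (p * q) = (\<Sum>e\<in>Poly_Mapping.keys p. \<Sum>f\<in>Poly_Mapping.keys q.
    Poly_Mapping.lookup p e * Poly_Mapping.lookup q f * (monom_eval x e * monom_eval x f))"
    by (simp add: monom_eval_add)
  also have "\<dots> = eval_mpoly x p * eval_mpoly x q"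
    by (simp add: eval_mpoly_def sum_product ac_simps)
  finally show ?thesis .
qed

lemma eval_mpoly_const [simp]: "eval_mpoly x (const c) = c"
  by (simp add: const_def)

lemma eval_mpoly_var [simp]: "eval_mpoly x (var i) = x i"
  by (simp add: var_def)

lemma eval_mpoly_poly_const:
  "eval_mpoly x (poly R (const z)) = poly (map_poly (eval_mpoly x) R) z"
  by (induction R) (auto simp: map_poly_pCons)

lemma Poly_zero_of_infinite_roots:
  fixes p :: "complex poly"
  assumes "\<And>t::real. T < t \<Longrightarrow> poly p (of_real t) = 0"
  shows "p = 0"
proof (rule ccontr)
  assume "p \<noteq> 0"
  then have "finite {x. poly p x = 0}" by (rule poly_roots_finite)
  moreover have "complex_of_real ` {T<..} \<subseteq> {x. poly p x = 0}" using assms by auto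
  ultimately have "finite (complex_of_real ` {T<..})" by (rule rev_finite_subset)
  then have "finite {T<..}" by (rule finite_imageD) (auto intro: inj_onI)
  then show False using infinite_Ioi by blast
qed

section \<open>Polynomials are determined by their values on chains\<close>

text \<open>Chains do not form a product set, but with \<open>y 1\<close>, ..., \<open>y n\<close>
  fixed the next coordinate still ranges over a half-line. The sum is therefore the zero polynomial
  in that coordinate, and each of its coefficients is a sum of the same kind in fewer
  variables.\<close>

lemma monomials_independent_on_chains:
  fixes c :: "(nat \<Rightarrow> nat) \<Rightarrow> complex"
  assumes "finite K" "inj_on (\<lambda>e. restrict e {1..n}) K"
    and "\<And>y. chain n y \<Longrightarrow> (\<Sum>e\<in>K. c e * (\<Prod>i\<in>{1..n}. of_real (y i) ^ e i)) = 0"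
  shows "\<forall>e\<in>K. c e = 0"
  using assms
proof (induction n arbitrary: K)
  case 0
  show ?case
  proof
    fix e assume "e \<in> K"
    then have "K = {e}" using 0(2) by (auto simp: inj_on_def restrict_def)
    then show "c e = 0" using 0(3)[of "\<lambda>_. 1"] by (simp add: chain_def)
  qed
next
  case (Suc n)
  show ?case
  proof
    fix e0 assume e0: "e0 \<in> K"
    define K' where "K' = {e\<in>K. e (Suc n) = e0 (Suc n)}"
    have "\<forall>e\<in>K'. c e = 0"
    proof (rule Suc.IH)
      show "finite K'" using Suc.prems(1) by (simp add: K'_def)
      show "inj_on (\<lambda>e. restrict e {1..n}) K'"
      proof (rule inj_onI)
        fix e e' assume *: "e \<in> K'" "e' \<in> K'" "restrict e {1..n} = restrict e' {1..n}"
        have "e i = e' i" if "i \<in> {1..Suc n}" for i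
        proof (cases "i = Suc n")
          case False
          then have "i \<in> {1..n}" using that by auto
          then show ?thesis using fun_cong[OF *(3), of i] by simp
        qed (use * in \<open>auto simp: K'_def\<close>)
        then have "restrict e {1..Suc n} = restrict e' {1..Suc n}" by (auto simp: fun_eq_iff)
        then show "e = e'" using Suc.prems(2) * unfolding inj_on_def K'_def by blast
      qed
      fix y assume y: "chain n y"
      let ?m = "\<lambda>e. \<Prod>i\<in>{1..n}. complex_of_real (y i) ^ e i"
      define p where "p = (\<Sum>e\<in>K. monom (c e * ?m e) (e (Suc n)))"
      have "p = 0"
      proof (rule Poly_zero_of_infinite_roots[where T = "max 0 (y n)"])
        fix t :: real assume t: "max 0 (y n) < t"
        have "chain (Suc n) (y(Suc n := t))" using y t by (cases n) (auto simp: chain_def)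
        from Suc.prems(3)[OF this]
        show "poly p (of_real t) = 0" by (simp add: p_def poly_sum poly_monom mult.assoc)
      qed
      then have "coeff p (e0 (Suc n)) = 0" by simp
      moreover have "coeff p (e0 (Suc n)) = (\<Sum>e\<in>K'. c e * ?m e)"
        using Suc.prems(1) unfolding p_def K'_def coeff_sum coeff_monom
        by (subst sum.inter_filter) auto
      ultimately show "(\<Sum>e\<in>K'. c e * (\<Prod>i\<in>{1..n}. of_real (y i) ^ e i)) = 0" by simp
    qed
    then show "c e0 = 0" using e0 by (auto simp: K'_def)
  qed
qed

definition vars_in :: "nat \<Rightarrow> mpoly \<Rightarrow> bool" where
  "vars_in n p \<longleftrightarrow> (\<forall>e\<in>Poly_Mapping.keys p. Poly_Mapping.keys e \<subseteq> {1..n})"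

lemma eval_mpoly_vars_in:
  assumes "vars_in n p"
  shows "eval_mpoly x p = (\<Sum>e\<in>Poly_Mapping.keys p. Poly_Mapping.lookup p e * (\<Prod>i\<in>{1..n}. x i ^ Poly_Mapping.lookup e i))"
  unfolding eval_mpoly_def
  by (intro sum.cong refl arg_cong2[where f = "(*)"] monom_eval_superset) (use assms in \<open>auto simp: vars_in_def\<close>)

lemma mpoly_zero_on_chains:
  assumes "vars_in n p" "\<And>y. chain n y \<Longrightarrow> eval_mpoly (\<lambda>i. of_real (y i)) p = 0"
  shows "p = 0"
proof -
  let ?K = "Poly_Mapping.lookup ` Poly_Mapping.keys p"
  have inj: "inj_on Poly_Mapping.lookup (Poly_Mapping.keys p)" by (auto intro: inj_onI poly_mapping_eqI)
  have "\<forall>e\<in>?K. Poly_Mapping.lookup p (Poly_Mapping.Abs_poly_mapping e) = 0"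
  proof (rule monomials_independent_on_chains[where n = n])
    show "inj_on (\<lambda>e. restrict e {1..n}) ?K"
    proof (rule inj_onI)
      fix a b assume "a \<in> ?K" "b \<in> ?K" and ab: "restrict a {1..n} = restrict b {1..n}"
      then obtain e f where ef: "a = Poly_Mapping.lookup e" "b = Poly_Mapping.lookup f"
        "e \<in> Poly_Mapping.keys p" "f \<in> Poly_Mapping.keys p" by auto
      have "a i = b i" for i
      proof (cases "i \<in> {1..n}")
        case True
        then show ?thesis using fun_cong[OF ab, of i] by simp
      next
        case False
        then have "i \<notin> Poly_Mapping.keys e" "i \<notin> Poly_Mapping.keys f"
          using ef assms(1) unfolding vars_in_def by blast+
        then show ?thesis by (simp add: ef in_keys_iff)
      qed
      then show "a = b" by auto
    qed
    fix y assume "chain n y"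
    show "(\<Sum>e\<in>?K. Poly_Mapping.lookup p (Poly_Mapping.Abs_poly_mapping e) * (\<Prod>i\<in>{1..n}. of_real (y i) ^ e i)) = 0"
      using assms(2)[OF \<open>chain n y\<close>] unfolding eval_mpoly_vars_in[OF assms(1)]
      by (subst sum.reindex[OF inj]) (simp add: comp_def Poly_Mapping.lookup_inverse)
  qed simp
  then have "Poly_Mapping.lookup p e = 0" if "e \<in> Poly_Mapping.keys p" for e
    using that by (auto simp: Poly_Mapping.lookup_inverse)
  then have "Poly_Mapping.lookup p e = 0" for e by (cases "e \<in> Poly_Mapping.keys p") (auto simp: in_keys_iff)
  then show ?thesis by (intro poly_mapping_eqI) simp
qed

lemma mpoly_eq_on_chains:
  assumes "vars_in n p" "vars_in n q"
    and "\<And>y. chain n y \<Longrightarrow> eval_mpoly (\<lambda>i. of_real (y i)) p = eval_mpoly (\<lambda>i. of_real (y i)) q"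
  shows "p = q"
proof -
  have "eval_mpoly x (- q) = - eval_mpoly x q" for x
    using eval_mpoly_add[of x q "- q"] by (simp add: add_eq_0_iff2)
  then have minus: "eval_mpoly x (p - q) = eval_mpoly x p - eval_mpoly x q" for x
    using eval_mpoly_add[of x p "- q"] by simp
  have "p - q = 0"
  proof (rule mpoly_zero_on_chains[where n = n])
    have "Poly_Mapping.keys (p - q) \<subseteq> Poly_Mapping.keys p \<union> Poly_Mapping.keys q" by (rule keys_diff)
    then show "vars_in n (p - q)" using assms unfolding vars_in_def by blast
  qed (simp add: minus assms(3))
  then show ?thesis by simp
qed

lemma vars_in_add: "vars_in n p \<Longrightarrow> vars_in n q \<Longrightarrow> vars_in n (p + q)"
  using keys_add[of p q] unfolding vars_in_def by blast

lemma vars_in_mult: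
  assumes "vars_in n p" "vars_in n q" shows "vars_in n (p * q)"
  unfolding vars_in_def
proof
  fix e assume "e \<in> Poly_Mapping.keys (p * q)"
  then obtain a b where "e = a + b" "a \<in> Poly_Mapping.keys p" "b \<in> Poly_Mapping.keys q"
    using keys_mult[of p q] by blast
  then show "Poly_Mapping.keys e \<subseteq> {1..n}"
    using keys_add[of a b] assms unfolding vars_in_def by blast
qed

lemma vars_in_sum: "(\<And>i. i \<in> I \<Longrightarrow> vars_in n (p i)) \<Longrightarrow> vars_in n (\<Sum>i\<in>I. p i)"
  by (induction I rule: infinite_finite_induct) (auto intro: vars_in_add simp: vars_in_def[of _ 0])

lemma vars_in_const: "vars_in n (const c)"
  by (auto simp: vars_in_def const_def)

lemma vars_in_var: "i \<in> {1..n} \<Longrightarrow> vars_in n (var i)"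
  by (auto simp: vars_in_def var_def)

section \<open>Permutation of the variables\<close>

lemma lookup_map_key_permutes:
  "\<sigma> permutes S \<Longrightarrow> Poly_Mapping.lookup (Poly_Mapping.map_key \<sigma> e) i = Poly_Mapping.lookup e (\<sigma> i)"
  by (subst Poly_Mapping.map_key.rep_eq) (auto simp: permutes_inj)

lemma map_key_inv:
  assumes "\<sigma> permutes S"
  shows "Poly_Mapping.map_key \<sigma> (Poly_Mapping.map_key (inv \<sigma>) e) = e"
    and "Poly_Mapping.map_key (inv \<sigma>) (Poly_Mapping.map_key \<sigma> e) = e"
  by (rule poly_mapping_eqI,
      simp add: lookup_map_key_permutes[OF assms] lookup_map_key_permutes[OF permutes_inv[OF assms]] permutes_inverses[OF assms])+

lemma keys_map_key_permutes:
  assumes "\<sigma> permutes {1..n}" "Poly_Mapping.keys e \<subseteq> {1..n}"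
  shows "Poly_Mapping.keys (Poly_Mapping.map_key \<sigma> e) \<subseteq> {1..n}"
proof
  fix i assume "i \<in> Poly_Mapping.keys (Poly_Mapping.map_key \<sigma> e)"
  then have "\<sigma> i \<in> {1..n}" using assms by (auto simp: in_keys_iff lookup_map_key_permutes[OF assms(1)])
  then show "i \<in> {1..n}" using permutes_in_image[OF assms(1)] by blast
qed

lemma monom_eval_permute:
  assumes "\<sigma> permutes {1..n}" "Poly_Mapping.keys e \<subseteq> {1..n}"
  shows "monom_eval (\<lambda>i. x (\<sigma> i)) (Poly_Mapping.map_key \<sigma> e) = monom_eval x e"
proof -
  have "monom_eval (\<lambda>i. x (\<sigma> i)) (Poly_Mapping.map_key \<sigma> e) = (\<Prod>i\<in>{1..n}. x (\<sigma> i) ^ Poly_Mapping.lookup e (\<sigma> i))"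
    by (subst monom_eval_superset[OF _ keys_map_key_permutes[OF assms]]) (simp_all add: lookup_map_key_permutes[OF assms(1)])
  also have "\<dots> = (\<Prod>i\<in>{1..n}. x i ^ Poly_Mapping.lookup e i)"
    using prod.permute[OF assms(1), of "\<lambda>i. x i ^ Poly_Mapping.lookup e i"] by (simp add: comp_def)
  also have "\<dots> = monom_eval x e" by (rule monom_eval_superset[symmetric]) (use assms in auto)
  finally show ?thesis .
qed

lemma eval_mpoly_permute:
  assumes p: "p \<in> sym_polys n" and \<sigma>: "\<sigma> permutes {1..n}"
  shows "eval_mpoly (\<lambda>i. x (\<sigma> i)) p = eval_mpoly x p"
proof -
  have keys: "Poly_Mapping.keys e \<subseteq> {1..n}" if "e \<in> Poly_Mapping.keys p" for e
    using p that unfolding sym_polys_def by blast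
  have lookup: "Poly_Mapping.lookup p (Poly_Mapping.map_key \<tau> e) = Poly_Mapping.lookup p e" if "\<tau> permutes {1..n}" for \<tau> e
    using p that unfolding sym_polys_def by blast
  have "eval_mpoly x p = (\<Sum>e\<in>Poly_Mapping.keys p. Poly_Mapping.lookup p (Poly_Mapping.map_key \<sigma> e) *
      monom_eval (\<lambda>i. x (\<sigma> i)) (Poly_Mapping.map_key \<sigma> e))"
    unfolding eval_mpoly_def
    by (intro sum.cong refl) (simp add: monom_eval_permute[OF \<sigma> keys] lookup[OF \<sigma>])
  also have "\<dots> = eval_mpoly (\<lambda>i. x (\<sigma> i)) p"
    unfolding eval_mpoly_def
    by (rule sum.reindex_bij_witness[where i = "Poly_Mapping.map_key (inv \<sigma>)" and j = "Poly_Mapping.map_key \<sigma>"])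
      (auto simp: map_key_inv[OF \<sigma>] in_keys_iff lookup[OF \<sigma>] lookup[OF permutes_inv[OF \<sigma>]])
  finally show ?thesis ..
qed

text \<open>Transfers symmetry from values to coefficients: permuting the exponents of
  \<open>p\<close> yields a polynomial with the same values on chains, which is therefore
  \<open>p\<close> itself. Exponents that do not occur in \<open>p\<close> are covered by the
  inverse permutation.\<close>

lemma sym_polysI:
  assumes "vars_in n p" and inv: "\<And>\<sigma> x. \<sigma> permutes {1..n} \<Longrightarrow> eval_mpoly (\<lambda>i. x (\<sigma> i)) p = eval_mpoly x p"
  shows "p \<in> sym_polys n"
proof -
  have keys: "Poly_Mapping.keys e \<subseteq> {1..n}" if "e \<in> Poly_Mapping.keys p" for e
    using assms(1) that unfolding vars_in_def by blast
  have on_keys: "Poly_Mapping.lookup p (Poly_Mapping.map_key \<sigma> e) = Poly_Mapping.lookup p e"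
    if \<sigma>: "\<sigma> permutes {1..n}" and e: "e \<in> Poly_Mapping.keys p" for \<sigma> e
  proof -
    define p' where "p' = (\<Sum>e\<in>Poly_Mapping.keys p. Poly_Mapping.single (Poly_Mapping.map_key \<sigma> e) (Poly_Mapping.lookup p e))"
    have "p' = p"
    proof (rule mpoly_eq_on_chains[where n = n])
      show "vars_in n p'" unfolding p'_def
        by (rule vars_in_sum) (use keys_map_key_permutes[OF \<sigma> keys] in \<open>auto simp: vars_in_def\<close>)
      fix y :: "nat \<Rightarrow> real"
      let ?y = "\<lambda>i. complex_of_real (y i)"
      have *: "eval_mpoly (\<lambda>i. x (\<sigma> i)) p' = eval_mpoly x p" for x
        unfolding p'_def eval_mpoly_sum eval_mpoly_single unfolding eval_mpoly_def
        by (intro sum.cong refl) (simp only: monom_eval_permute[OF \<sigma> keys, of _ x])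
      have "eval_mpoly ?y p' = eval_mpoly (\<lambda>i. ?y (inv \<sigma> (\<sigma> i))) p'"
        by (simp add: permutes_inverses[OF \<sigma>])
      also have "\<dots> = eval_mpoly (\<lambda>i. ?y (inv \<sigma> i)) p" by (rule *)
      also have "\<dots> = eval_mpoly ?y p" by (rule inv[OF permutes_inv[OF \<sigma>]])
      finally show "eval_mpoly ?y p' = eval_mpoly ?y p" .
    qed (rule assms(1))
    moreover have "Poly_Mapping.lookup p' (Poly_Mapping.map_key \<sigma> e) = Poly_Mapping.lookup p e"
    proof -
      have "Poly_Mapping.map_key \<sigma> f = Poly_Mapping.map_key \<sigma> e \<longleftrightarrow> f = e" for f
        by (metis map_key_inv(2)[OF \<sigma>])
      then show ?thesis using e by (simp add: p'_def lookup_sum lookup_single when_def)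
    qed
    ultimately show ?thesis by simp
  qed
  have "Poly_Mapping.lookup p (Poly_Mapping.map_key \<sigma> e) = Poly_Mapping.lookup p e"
    if \<sigma>: "\<sigma> permutes {1..n}" for \<sigma> e
  proof (cases "e \<in> Poly_Mapping.keys p")
    case False
    have "Poly_Mapping.map_key \<sigma> e \<notin> Poly_Mapping.keys p"
      using on_keys[OF permutes_inv[OF \<sigma>], of "Poly_Mapping.map_key \<sigma> e"] False
      by (auto simp: map_key_inv[OF \<sigma>] in_keys_iff)
    then show ?thesis using False by (simp add: in_keys_iff)
  qed (rule on_keys[OF \<sigma>])
  then show ?thesis unfolding sym_polys_def using keys by blast
qed

section \<open>Polynomiality of the integral operator\<close>

lemma residue_coord_of_real:
  "residue_coord I (\<lambda>i. of_real (y i)) (\<lambda>i. of_real (x i)) i = (of_real (residue_coord I y x i) :: complex)"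
  by (simp add: residue_coord_def)

text \<open>The substitution \<open>u = - 1 / v\<close> turns \<open>(x k - u) / (y k - u)\<close>
  into \<open>(1 + v * x k) / (1 + v * y k)\<close>. Clearing denominators in the partial fraction
  identity gives equal values for all but finitely many \<open>v\<close>.\<close>

lemma generating_polynomial_residues:
  fixes x y :: "nat \<Rightarrow> complex"
  assumes "finite I" "inj_on y I"
  shows "(\<Prod>k\<in>I. [:1, x k:]) = (\<Prod>k\<in>I. [:1, y k:]) +
    (\<Sum>i\<in>I. [:0, residue_coord I y x i:] * (\<Prod>k\<in>I - {i}. [:1, y k:]))" (is "?L = ?R")
proof -
  have eval: "poly ?L v = poly ?R v" if v: "v \<noteq> 0" "- 1 / v \<notin> y ` I" for v
  proof -
    have vx: "1 + v * a = v * (a - (- 1 / v))" for a using v(1) by (simp add: field_simps)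
    have nz: "y k - (- 1 / v) \<noteq> 0" if "k \<in> I" for k
      using v(2) imageI[OF that, of y] by (metis eq_iff_diff_eq_0)
    have "poly ?L v = (\<Prod>k\<in>I. (1 + v * y k) * ((x k - (- 1 / v)) / (y k - (- 1 / v))))"
      unfolding poly_prod using nz v(1) by (intro prod.cong refl) (simp add: vx del: minus_divide_left)
    also have "\<dots> = (\<Prod>k\<in>I. 1 + v * y k) * (1 + (\<Sum>i\<in>I. residue_coord I y x i / (y i - (- 1 / v))))"
      unfolding prod.distrib partial_fractions[OF assms v(2)] ..
    also have "\<dots> = (\<Prod>k\<in>I. 1 + v * y k) + (\<Sum>i\<in>I. v * residue_coord I y x i * (\<Prod>k\<in>I - {i}. 1 + v * y k))"
      unfolding distrib_left mult_1_right sum_distrib_left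
    proof (intro arg_cong2[where f = "(+)"] sum.cong refl)
      fix i assume i: "i \<in> I"
      have "(\<Prod>k\<in>I. 1 + v * y k) = v * (y i - (- 1 / v)) * (\<Prod>k\<in>I - {i}. 1 + v * y k)"
        unfolding vx[symmetric] using assms(1) i by (rule prod.remove)
      then show "(\<Prod>k\<in>I. 1 + v * y k) * (residue_coord I y x i / (y i - (- 1 / v))) =
        v * residue_coord I y x i * (\<Prod>k\<in>I - {i}. 1 + v * y k)"
        using nz[OF i] by simp
    qed
    also have "\<dots> = poly ?R v" by (simp add: poly_prod poly_sum mult.assoc)
    finally show ?thesis .
  qed
  \<comment> \<open>For \<open>t\<close> above every \<open>norm (inverse (y k))\<close> the point
    \<open>- 1 / t\<close> is not a pole.\<close>
  have "poly (?L - ?R) (of_real t) = 0" if t: "Max (insert 0 ((\<lambda>k. norm (inverse (y k))) ` I)) < t" for t :: real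
  proof -
    have pos: "0 < t" and big: "norm (inverse (y k)) < t" if "k \<in> I" for k
      using t assms(1) that by (auto simp: Max_less_iff)
    have t0: "0 < t" using t assms(1) by (auto simp: Max_less_iff)
    have "- 1 / complex_of_real t \<notin> y ` I"
    proof
      assume "- 1 / complex_of_real t \<in> y ` I"
      then obtain k where k: "k \<in> I" "y k = - 1 / complex_of_real t" by auto
      then have "norm (inverse (y k)) = t" using t0 by (simp add: norm_inverse norm_divide)
      with big[OF k(1)] show False by simp
    qed
    then have "poly ?L (of_real t) = poly ?R (of_real t)" using t0 by (intro eval) auto
    then show ?thesis by simp
  qed
  then have "?L - ?R = 0" by (rule Poly_zero_of_infinite_roots)
  then show ?thesis by simp
qed

text \<open>The elementary symmetric functions of \<open>x\<close> in terms of \<open>y\<close>, \<open>z\<close> and the simplex coordinates \<open>h\<close>.\<close>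

definition esym_gen :: "nat \<Rightarrow> (nat \<Rightarrow> complex) \<Rightarrow> complex \<Rightarrow> (nat \<Rightarrow> complex) \<Rightarrow> complex poly" where
  "esym_gen n y z h = (\<Prod>k\<in>{1..n}. [:1, y k:]) +
    (\<Sum>i\<in>{1..n}. [:0, y i * (z - 1) * h i:] * (\<Prod>k\<in>{1..n} - {i}. [:1, y k:]))"

lemma esym_slice:
  assumes y: "chain n y" and z: "1 < z"
  shows "esym {1..n} (\<lambda>i. of_real (slice_point 1 n y z x i)) r =
    coeff (esym_gen n (\<lambda>i. of_real (y i)) (of_real z) (\<lambda>i. of_real (eta n y z x i))) r"
proof -
  let ?p = "slice_point 1 n y z x"
  have "chain_on 1 n y" using y by simp
  then have "inj_on y {1..n}" by (rule chain_on_inj)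
  then have inj: "inj_on (\<lambda>i. complex_of_real (y i)) {1..n}"
    unfolding inj_on_def of_real_eq_iff .
  have "residue_coord {1..n} (\<lambda>i. complex_of_real (y i)) (\<lambda>i. of_real (?p i)) i =
     of_real (y i) * (of_real z - 1) * of_real (eta n y z x i)" if "i \<in> {1..n}" for i
    unfolding residue_coord_of_real residue_coord_eq_xi
    using chain_pos[OF y that] z by (simp add: eta_def)
  then show ?thesis
    unfolding esym_def esym_gen_def
    by (subst generating_polynomial_residues[OF _ inj]) (auto intro!: arg_cong2[where f = coeff] sum.cong)
qed

text \<open>A permutation of \<open>y\<close> alone can thus be shifted to \<open>h\<close>, whose
  moments are symmetric; this is the source of the symmetry of the integral in
  \<open>y\<close>.\<close>

lemma esym_gen_permute:
  assumes \<sigma>: "\<sigma> permutes {1..n}"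
  shows "esym_gen n (\<lambda>i. y (\<sigma> i)) z (\<lambda>i. h (\<sigma> i)) = esym_gen n y z h"
proof -
  have bij: "bij_betw \<sigma> ({1..n} - {i}) ({1..n} - {\<sigma> i})" for i
    by (rule bij_betw_imageI)
      (simp_all only: permutes_inj_on[OF \<sigma>] image_set_diff[OF permutes_inj[OF \<sigma>]] permutes_image[OF \<sigma>]
        image_insert image_empty)
  have inner: "(\<Prod>k\<in>{1..n} - {i}. [:1, y (\<sigma> k):]) = (\<Prod>k\<in>{1..n} - {\<sigma> i}. [:1, y k:])" for i
    by (rule prod.reindex_bij_betw[OF bij])
  have "(\<Prod>k\<in>{1..n}. [:1, y (\<sigma> k):]) = (\<Prod>k\<in>{1..n}. [:1, y k:])"
    by (rule prod.reindex_bij_betw[OF permutes_imp_bij[OF \<sigma>]])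
  moreover have "(\<Sum>i\<in>{1..n}. [:0, y (\<sigma> i) * (z - 1) * h (\<sigma> i):] * (\<Prod>k\<in>{1..n} - {\<sigma> i}. [:1, y k:])) =
     (\<Sum>i\<in>{1..n}. [:0, y i * (z - 1) * h i:] * (\<Prod>k\<in>{1..n} - {i}. [:1, y k:]))"
    by (rule sum.reindex_bij_betw[OF permutes_imp_bij[OF \<sigma>]])
  ultimately show ?thesis
    unfolding esym_gen_def using inner by simp
qed

text \<open>A state consists of \<open>y\<close>, \<open>z\<close> and the simplex coordinates
  \<open>h\<close>. Functions of \<open>y\<close> and \<open>z\<close> are the coefficients that
  survive integration; monomials in \<open>h\<close> get replaced by their moments.\<close>

type_synonym state = "(nat \<Rightarrow> complex) \<times> complex \<times> (nat \<Rightarrow> complex)"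

definition base_funs :: "nat \<Rightarrow> (state \<Rightarrow> complex) set" where
  "base_funs n = insert (\<lambda>t. fst (snd t)) ((\<lambda>i t. fst t i) ` {1..n})"

definition simplex_monomials :: "nat \<Rightarrow> (state \<Rightarrow> complex) set" where
  "simplex_monomials n = range (\<lambda>a t. \<Prod>i\<in>{1..n}. snd (snd t) i ^ a i)"

lemma coeff_prod_generated:
  assumes "\<And>i r. i \<in> I \<Longrightarrow> (\<lambda>s. coeff (f i s) r) \<in> generated_ring B"
  shows "(\<lambda>s. coeff (\<Prod>i\<in>I. f i s) r) \<in> generated_ring B"
  using assms
proof (induction I arbitrary: r rule: infinite_finite_induct)
  case (insert i I)
  then show ?case
    by (simp add: coeff_mult) (intro generated_ring_sum generated_ring.mult, auto)
qed (auto intro: generated_ring.const)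

lemma coeff_linear_generated:
  assumes "f \<in> generated_ring B" "h \<in> generated_ring B"
  shows "(\<lambda>s. coeff [:f s, h s:] r) \<in> generated_ring B"
  using assms by (cases r; cases "r - 1") (auto simp: coeff_pCons split: nat.splits intro: generated_ring.const)

lemma coeff_esym_gen_generated:
  "(\<lambda>(y, z, h). coeff (esym_gen n y z h) r) \<in> generated_ring (base_funs n \<union> simplex_monomials n)"
proof -
  let ?G = "generated_ring (base_funs n \<union> simplex_monomials n)"
  have y: "(\<lambda>s. fst s i) \<in> ?G" if "i \<in> {1..n}" for i
    by (rule generated_ring.base) (use that in \<open>auto simp: base_funs_def\<close>)
  have z: "(\<lambda>s. fst (snd s)) \<in> ?G"
    by (rule generated_ring.base) (auto simp: base_funs_def)
  have h: "(\<lambda>s. snd (snd s) i) \<in> ?G" if "i \<in> {1..n}" for i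
  proof (rule generated_ring.base)
    have "(\<Prod>j\<in>{1..n}. h j ^ (if j = i then 1 else 0)) = h i" for h :: "nat \<Rightarrow> complex"
      using that by (simp add: if_distrib prod.delta cong: if_cong)
    then show "(\<lambda>s. snd (snd s) i) \<in> base_funs n \<union> simplex_monomials n"
      unfolding simplex_monomials_def by (intro UnI2 image_eqI[of _ _ "\<lambda>j. if j = i then 1 else 0"]) (simp_all only: UNIV_I)
  qed
  have lin: "(\<lambda>s. coeff [:1, fst s k:] r) \<in> ?G" if "k \<in> {1..n}" for k r
    by (intro coeff_linear_generated generated_ring.const y that)
  have "(\<lambda>s. coeff (\<Prod>k\<in>{1..n}. [:1, fst s k:]) r +
    (\<Sum>i\<in>{1..n}. \<Sum>j\<le>r. coeff [:0, fst s i * (fst (snd s) - 1) * snd (snd s) i:] j *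
       coeff (\<Prod>k\<in>{1..n} - {i}. [:1, fst s k:]) (r - j))) \<in> ?G"
    by (intro generated_ring.add generated_ring_sum generated_ring.mult coeff_prod_generated lin
        coeff_linear_generated generated_ring.const generated_ring_diff y z h) auto
  then show ?thesis unfolding esym_gen_def case_prod_unfold coeff_add coeff_sum coeff_mult .
qed

lemma base_funs_as_mpoly:
  assumes "c \<in> generated_ring (base_funs n)"
  shows "\<exists>R. (\<forall>i. vars_in n (coeff R i)) \<and> (\<forall>y z h. c (y, z, h) = eval_mpoly y (poly R (const z)))"
  using assms
proof induction
  case (base b)
  then consider "b = (\<lambda>t. fst (snd t))" | i where "i \<in> {1..n}" "b = (\<lambda>t. fst t i)"
    by (auto simp: base_funs_def)
  then show ?case
  proof cases
    case 1
    have "vars_in n (coeff [:0, 1:] i)" for i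
      using vars_in_const[of n 0] vars_in_const[of n 1]
      by (auto simp: coeff_pCons const_def split: nat.splits)
    then show ?thesis unfolding 1 by (intro exI[of _ "[:0, 1:]"]) auto
  next
    case (2 i)
    have "vars_in n (coeff [:var i:] j)" for j
      using vars_in_const[of n 0] vars_in_var[OF 2(1)] by (auto simp: coeff_pCons const_def split: nat.splits)
    then show ?thesis unfolding 2 by (intro exI[of _ "[:var i:]"]) auto
  qed
next
  case (const c)
  have "vars_in n (coeff [:Defs.const c:] j)" for j
    using vars_in_const[of n 0] vars_in_const[of n c] by (auto simp: coeff_pCons const_def split: nat.splits)
  then show ?case by (intro exI[of _ "[:Defs.const c:]"]) auto
next
  case (add f h)
  then obtain R R' where "\<forall>i. vars_in n (coeff R i)" "\<forall>y z h. f (y, z, h) = eval_mpoly y (poly R (Defs.const z))"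
    "\<forall>i. vars_in n (coeff R' i)" "\<forall>y z h'. h (y, z, h') = eval_mpoly y (poly R' (Defs.const z))" by blast
  then show ?case by (intro exI[of _ "R + R'"]) (auto intro: vars_in_add)
next
  case (mult f h)
  then obtain R R' where "\<forall>i. vars_in n (coeff R i)" "\<forall>y z h. f (y, z, h) = eval_mpoly y (poly R (Defs.const z))"
    "\<forall>i. vars_in n (coeff R' i)" "\<forall>y z h'. h (y, z, h') = eval_mpoly y (poly R' (Defs.const z))" by blast
  then show ?case by (intro exI[of _ "R * R'"] conjI allI) (unfold coeff_mult, intro vars_in_sum vars_in_mult, auto)
qed

lemma integral_simplex_polynomial:
  fixes l :: "(complex \<times> (nat \<Rightarrow> nat)) list"
  assumes "chain n y" "n \<ge> 1" "0 < g" "1 < z"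
  shows "integrable (slice_prob n g y z) (\<lambda>x. \<Sum>(c, a)\<leftarrow>l. c * (\<Prod>i\<in>{1..n}. of_real (eta n y z x i) ^ a i))"
    and "(\<integral>x. (\<Sum>(c, a)\<leftarrow>l. c * (\<Prod>i\<in>{1..n}. of_real (eta n y z x i) ^ a i)) \<partial>slice_prob n g y z) =
      (\<Sum>(c, a)\<leftarrow>l. c * of_real (dirichlet_moment n g a))"
proof -
  have eq: "(\<Prod>i\<in>{1..n}. of_real (eta n y z x i) ^ a i) = complex_of_real (\<Prod>i\<in>{1..n}. eta n y z x i ^ a i)" for x a
    by simp
  have single: "integrable (slice_prob n g y z) (\<lambda>x. c * (\<Prod>i\<in>{1..n}. of_real (eta n y z x i) ^ a i))"
    "(\<integral>x. c * (\<Prod>i\<in>{1..n}. of_real (eta n y z x i) ^ a i) \<partial>slice_prob n g y z) = c * of_real (dirichlet_moment n g a)"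
    for c :: complex and a
    unfolding eq using integrable_eta_moment[OF assms, of a] integral_eta_moment[OF assms, of a]
    by (auto simp del: of_real_prod)
  show 1: "integrable (slice_prob n g y z) (\<lambda>x. \<Sum>(c, a)\<leftarrow>l. c * (\<Prod>i\<in>{1..n}. of_real (eta n y z x i) ^ a i))" for l :: "(complex \<times> (nat \<Rightarrow> nat)) list"
  proof (induction l)
    case (Cons t l)
    obtain c a where t: "t = (c, a)" by (cases t)
    show ?case using Bochner_Integration.integrable_add[OF single(1)[of c a] Cons] by (simp add: t)
  qed simp
  show "(\<integral>x. (\<Sum>(c, a)\<leftarrow>l. c * (\<Prod>i\<in>{1..n}. of_real (eta n y z x i) ^ a i)) \<partial>slice_prob n g y z) =
      (\<Sum>(c, a)\<leftarrow>l. c * of_real (dirichlet_moment n g a))"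
  proof (induction l)
    case (Cons t l)
    obtain c a where t: "t = (c, a)" by (cases t)
    show ?case
      by (simp only: t list.map sum_list.Cons case_prod_conv Cons
          Bochner_Integration.integral_add[OF single(1)[of c a] 1[of l]] single(2))
  qed simp
qed

lemma dirichlet_moment_permute:
  assumes "\<sigma> permutes {1..n}"
  shows "dirichlet_moment n g (\<lambda>i. a (\<sigma> i)) = dirichlet_moment n g a"
  unfolding dirichlet_moment_def
  using prod.reindex_bij_betw[OF permutes_imp_bij[OF assms], of "\<lambda>i. pochhammer g (a i)"]
    sum.reindex_bij_betw[OF permutes_imp_bij[OF assms], of a] by simp

lemma sym_polys_vars_in: "p \<in> sym_polys n \<Longrightarrow> vars_in n p"
  unfolding sym_polys_def vars_in_def by blast

text \<open>Averaging over all permutations expresses \<open>fact n\<close> times a symmetric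
  polynomial through the permutation sums of its monomials.\<close>

lemma sym_poly_in_esym:
  assumes p: "p \<in> sym_polys n"
  shows "\<exists>s\<in>poly_funs. \<forall>x. eval_mpoly x p = s (esym {1..n} x)"
proof -
  have v: "vars_in n p" using p by (rule sym_polys_vars_in)
  have "\<forall>a. \<exists>s. s \<in> poly_funs \<and> (\<forall>x. (\<Sum>q | q permutes {1..n}. \<Prod>i\<in>{1..n}. x (q i) ^ a i) = s (esym {1..n} x))"
    using permutation_sum_in_esym[OF finite_atLeastAtMost] by blast
  from choice[OF this] obtain t where t: "\<And>a. t a \<in> poly_funs"
    "\<And>a x. (\<Sum>q | q permutes {1..n}. \<Prod>i\<in>{1..n}. x (q i) ^ a i) = t a (esym {1..n} x)"
    by blast
  define s where "s = (\<lambda>e. inverse (fact n) * (\<Sum>k\<in>Poly_Mapping.keys p. Poly_Mapping.lookup p k * t (Poly_Mapping.lookup k) e))"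
  have "s \<in> poly_funs"
    unfolding s_def poly_funs_def
    by (intro generated_ring_cmult generated_ring_sum) (use t(1) in \<open>simp add: poly_funs_def\<close>)
  moreover have "eval_mpoly x p = s (esym {1..n} x)" for x
  proof -
    have "fact n * eval_mpoly x p = (\<Sum>q | q permutes {1..n}. eval_mpoly (\<lambda>i. x (q i)) p)"
      using eval_mpoly_permute[OF p, of _ x] by (simp add: card_permutations)
    also have "\<dots> = (\<Sum>k\<in>Poly_Mapping.keys p. Poly_Mapping.lookup p k * t (Poly_Mapping.lookup k) (esym {1..n} x))"
      unfolding eval_mpoly_vars_in[OF v] t(2)[symmetric] by (subst sum.swap) (simp add: sum_distrib_left)
    finally show ?thesis by (simp add: s_def field_simps)
  qed
  ultimately show ?thesis by blast
qed

section \<open>Existence and uniqueness of the interpolating polynomial\<close>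

text \<open>The integrand is a polynomial in the elementary symmetric functions of \<open>x\<close>,
  hence in \<open>y\<close>, \<open>z\<close> and the simplex coordinates. In normal form only the
  monomials in the latter are integrated, and their moments involve neither \<open>y\<close> nor
  \<open>z\<close>; so \<open>R\<close> arises by putting moments in place of monomials.\<close>

theorem Q_poly_exists:
  assumes n: "n \<ge> 1" and g: "0 < g" and p: "p \<in> sym_polys n"
  shows "\<exists>R. (\<forall>i. coeff R i \<in> sym_polys n) \<and>
    (\<forall>z>1. \<forall>y. chain n y \<longrightarrow> eval_mpoly (\<lambda>i. of_real (y i)) (poly R (const (of_real z))) = Q_integral n g z p y)"
proof -
  obtain s where s: "s \<in> poly_funs" "\<And>x. eval_mpoly x p = s (esym {1..n} x)"
    using sym_poly_in_esym[OF p] by blast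
  define G where "G = (\<lambda>(y, z, h). s (coeff (esym_gen n y z h)))"
  have "(\<lambda>t. s (\<lambda>r. (\<lambda>(y, z, h). coeff (esym_gen n y z h) r) t)) \<in> generated_ring (base_funs n \<union> simplex_monomials n)"
    by (rule generated_ring_subst[OF s(1)[unfolded poly_funs_def]]) (use coeff_esym_gen_generated in auto)
  then have "G \<in> generated_ring (base_funs n \<union> simplex_monomials n)"
    by (simp add: G_def case_prod_unfold)
  then have "\<exists>l. set l \<subseteq> generated_ring (base_funs n) \<times> simplex_monomials n \<and>
      (\<forall>t. G t = (\<Sum>(c, m)\<leftarrow>l. c t * m t))"
  proof (rule generated_ring_normal_form)
    show "(\<lambda>_. 1) \<in> simplex_monomials n"
      unfolding simplex_monomials_def by (rule range_eqI[of _ _ "\<lambda>_. 0"]) simp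
    show "(\<lambda>t. a t * b t) \<in> simplex_monomials n" if ab: "a \<in> simplex_monomials n" "b \<in> simplex_monomials n" for a b
    proof -
      obtain j where j: "a = (\<lambda>t. \<Prod>i\<in>{1..n}. snd (snd t) i ^ j i)"
        using ab(1) unfolding simplex_monomials_def by (rule rangeE)
      obtain k where k: "b = (\<lambda>t. \<Prod>i\<in>{1..n}. snd (snd t) i ^ k i)"
        using ab(2) unfolding simplex_monomials_def by (rule rangeE)
      show ?thesis unfolding simplex_monomials_def j k
        by (rule range_eqI[of _ _ "\<lambda>i. j i + k i"]) (simp add: power_add prod.distrib)
    qed
  qed (auto intro: generated_ring.base)
  then obtain l where l: "set l \<subseteq> generated_ring (base_funs n) \<times> simplex_monomials n"
    "\<And>t. G t = (\<Sum>(c, m)\<leftarrow>l. c t * m t)" by blast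
  have "\<forall>c. \<exists>R. c \<in> generated_ring (base_funs n) \<longrightarrow>
      (\<forall>i. vars_in n (coeff R i)) \<and> (\<forall>y z h. c (y, z, h) = eval_mpoly y (poly R (const z)))"
    using base_funs_as_mpoly by blast
  from choice[OF this] obtain rep where rep: "\<And>c. c \<in> generated_ring (base_funs n) \<Longrightarrow>
      (\<forall>i. vars_in n (coeff (rep c) i)) \<and> (\<forall>y z h. c (y, z, h) = eval_mpoly y (poly (rep c) (const z)))"
    by blast
  have "\<forall>m. \<exists>a. m \<in> simplex_monomials n \<longrightarrow> m = (\<lambda>t. \<Prod>i\<in>{1..n}. snd (snd t) i ^ a i)"
    by (auto simp: simplex_monomials_def)
  from choice[OF this] obtain ex where ex: "\<And>m. m \<in> simplex_monomials n \<Longrightarrow> m = (\<lambda>t. \<Prod>i\<in>{1..n}. snd (snd t) i ^ ex m i)"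
    by blast
  define l' where "l' = map (\<lambda>(c, m). (rep c, ex m)) l"
  have l'_vars: "vars_in n (coeff R i)" if "(R, a) \<in> set l'" for R a i
    using that l(1) rep by (auto simp: l'_def)
  have G: "G (y, z, h) = (\<Sum>(R, a)\<leftarrow>l'. eval_mpoly y (poly R (const z)) * (\<Prod>i\<in>{1..n}. h i ^ a i))" for y z h
  proof -
    have "G (y, z, h) = (\<Sum>(c, m)\<leftarrow>l. eval_mpoly y (poly (rep c) (const z)) * (\<Prod>i\<in>{1..n}. h i ^ ex m i))"
      unfolding l(2)
    proof (intro arg_cong[where f = sum_list] map_cong refl)
      fix t assume "t \<in> set l"
      moreover obtain c m where t: "t = (c, m)" by (cases t)
      ultimately have cm: "c \<in> generated_ring (base_funs n)" "m \<in> simplex_monomials n" using l(1) by auto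
      have "c (y, z, h) = eval_mpoly y (poly (rep c) (const z))" using rep[OF cm(1)] by blast
      moreover have "m (y, z, h) = (\<Prod>i\<in>{1..n}. h i ^ ex m i)" by (subst ex[OF cm(2)]) simp
      ultimately show "(case t of (c, m) \<Rightarrow> c (y, z, h) * m (y, z, h)) =
        (case t of (c, m) \<Rightarrow> eval_mpoly y (poly (rep c) (const z)) * (\<Prod>i\<in>{1..n}. h i ^ ex m i))"
        unfolding t by simp
    qed
    then show ?thesis by (simp add: l'_def comp_def case_prod_unfold)
  qed
  define R where "R = (\<Sum>(R, a)\<leftarrow>l'. smult (const (of_real (dirichlet_moment n g a))) R)"
  have evalR: "eval_mpoly y (poly R (const z)) =
      (\<Sum>(R, a)\<leftarrow>l'. eval_mpoly y (poly R (const z)) * of_real (dirichlet_moment n g a))" for y z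
    unfolding R_def by (induction l') (auto simp: mult.commute)
  \<comment> \<open>The measure is taken at parameters \<open>y0\<close>, \<open>z0\<close>
    unrelated to the arguments \<open>y\<close>, \<open>z\<close>, which is possible because it
    enters only through the moments.\<close>
  have expect: "(\<integral>x. G (y, z, \<lambda>i. of_real (eta n y0 z0 x i)) \<partial>slice_prob n g y0 z0) = eval_mpoly y (poly R (const z))"
    if "chain n y0" "1 < z0" for y z y0 z0
  proof -
    have "(\<integral>x. (\<Sum>(c, a)\<leftarrow>map (\<lambda>(R, a). (eval_mpoly y (poly R (const z)), a)) l'. c * (\<Prod>i\<in>{1..n}. of_real (eta n y0 z0 x i) ^ a i)) \<partial>slice_prob n g y0 z0) =
      (\<Sum>(c, a)\<leftarrow>map (\<lambda>(R, a). (eval_mpoly y (poly R (const z)), a)) l'. c * of_real (dirichlet_moment n g a))"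
      by (rule integral_simplex_polynomial(2)[OF that(1) n g that(2)])
    then show ?thesis unfolding G evalR by (simp add: comp_def case_prod_unfold)
  qed
  have vars: "vars_in n (coeff R i)" for i
  proof -
    have "vars_in n (coeff (\<Sum>(R, a)\<leftarrow>l''. smult (const (of_real (dirichlet_moment n g a))) R) i)" if "set l'' \<subseteq> set l'" for l''
      using that
    proof (induction l'')
      case Nil
      show ?case using vars_in_const[of n 0] by (simp add: const_def)
    next
      case (Cons t l'')
      then show ?case using l'_vars by (cases t) (auto intro!: vars_in_add vars_in_mult vars_in_const)
    qed
    then show ?thesis unfolding R_def by blast
  qed
  have perm: "eval_mpoly (\<lambda>i. y (\<sigma> i)) (poly R (const z)) = eval_mpoly y (poly R (const z))"
    if \<sigma>: "\<sigma> permutes {1..n}" for \<sigma> y z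
  proof -
    \<comment> \<open>Any chain will do: it only realises the moments as integrals, while the
      complex arguments \<open>y\<close> need not form a chain.\<close>
    define y0 :: "nat \<Rightarrow> real" where "y0 = real"
    have y0: "chain n y0" by (simp add: chain_def y0_def)
    let ?h = "\<lambda>x i. complex_of_real (eta n y0 2 x i)"
    let ?i = "inv \<sigma>"
    have i: "?i permutes {1..n}" by (rule permutes_inv[OF \<sigma>])
    have G_perm: "G (\<lambda>i. y (\<sigma> i), z, h) = G (y, z, \<lambda>i. h (?i i))" for h
      using esym_gen_permute[OF \<sigma>, of y z "\<lambda>i. h (?i i)"] by (simp add: G_def permutes_inverses[OF \<sigma>])
    have "eval_mpoly (\<lambda>i. y (\<sigma> i)) (poly R (const z)) = (\<integral>x. G (y, z, \<lambda>i. ?h x (?i i)) \<partial>slice_prob n g y0 2)"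
    proof -
      have "(\<lambda>x. G (y, z, \<lambda>i. ?h x (?i i))) = (\<lambda>x. G (\<lambda>i. y (\<sigma> i), z, ?h x))"
        by (rule ext) (rule G_perm[symmetric])
      then show ?thesis using expect[OF y0, of 2 "\<lambda>i. y (\<sigma> i)" z] by (simp only: one_less_numeral_iff semiring_norm)
    qed
    also have "\<dots> = (\<integral>x. (\<Sum>(c, a)\<leftarrow>map (\<lambda>(R, a). (eval_mpoly y (poly R (const z)), \<lambda>i. a (\<sigma> i))) l'.
        c * (\<Prod>i\<in>{1..n}. of_real (eta n y0 2 x i) ^ a i)) \<partial>slice_prob n g y0 2)"
    proof (rule Bochner_Integration.integral_cong[OF refl])
      fix x
      have "(\<Prod>j\<in>{1..n}. ?h x (?i j) ^ a j) = (\<Prod>j\<in>{1..n}. ?h x j ^ a (\<sigma> j))" for a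
        using prod.reindex_bij_betw[OF permutes_imp_bij[OF \<sigma>], of "\<lambda>j. ?h x (?i j) ^ a j"]
        by (simp add: permutes_inverses[OF \<sigma>])
      then show "G (y, z, \<lambda>i. ?h x (?i i)) = (\<Sum>(c, a)\<leftarrow>map (\<lambda>(R, a). (eval_mpoly y (poly R (const z)), \<lambda>i. a (\<sigma> i))) l'.
        c * (\<Prod>i\<in>{1..n}. of_real (eta n y0 2 x i) ^ a i))"
        unfolding G by (simp add: comp_def case_prod_unfold)
    qed
    also have "\<dots> = (\<Sum>(c, a)\<leftarrow>map (\<lambda>(R, a). (eval_mpoly y (poly R (const z)), \<lambda>i. a (\<sigma> i))) l'. c * of_real (dirichlet_moment n g a))"
      by (rule integral_simplex_polynomial(2)[OF y0 n g]) simp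
    also have "\<dots> = eval_mpoly y (poly R (const z))"
      unfolding evalR by (simp add: comp_def case_prod_unfold dirichlet_moment_permute[OF \<sigma>])
    finally show ?thesis .
  qed
  have "coeff R i \<in> sym_polys n" for i
  proof (rule sym_polysI[OF vars])
    fix \<sigma> and x :: "nat \<Rightarrow> complex" assume "\<sigma> permutes {1..n}"
    from perm[OF this, of x]
    have "poly (map_poly (eval_mpoly (\<lambda>i. x (\<sigma> i))) R) z = poly (map_poly (eval_mpoly x) R) z" for z
      by (simp add: eval_mpoly_poly_const)
    then have "map_poly (eval_mpoly (\<lambda>i. x (\<sigma> i))) R = map_poly (eval_mpoly x) R"
      by (intro poly_ext)
    from arg_cong[OF this, of "\<lambda>q. coeff q i"]
    show "eval_mpoly (\<lambda>i. x (\<sigma> i)) (coeff R i) = eval_mpoly x (coeff R i)"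
      by (simp add: coeff_map_poly)
  qed
  moreover have "eval_mpoly (\<lambda>i. of_real (y i)) (poly R (const (of_real z))) = Q_integral n g z p y"
    if z: "1 < z" and y: "chain n y" for z y
  proof -
    have "Q_integral n g z p y = (\<integral>x. eval_mpoly (\<lambda>i. of_real (slice_point 1 n y z x i)) p \<partial>slice_prob n g y z)"
      by (rule Q_integral_eq[OF y n g p])
    also have "\<dots> = (\<integral>x. G (\<lambda>i. of_real (y i), of_real z, \<lambda>i. of_real (eta n y z x i)) \<partial>slice_prob n g y z)"
    proof -
      have "esym {1..n} (\<lambda>i. of_real (slice_point 1 n y z x i)) =
        coeff (esym_gen n (\<lambda>i. of_real (y i)) (of_real z) (\<lambda>i. of_real (eta n y z x i)))" for x
        by (rule ext) (rule esym_slice[OF y z])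
      then show ?thesis by (simp add: s(2) G_def)
    qed
    also have "\<dots> = eval_mpoly (\<lambda>i. of_real (y i)) (poly R (const (of_real z)))"
      by (rule expect[OF y z])
    finally show ?thesis ..
  qed
  ultimately show ?thesis by (intro exI[of _ R] conjI allI impI)
qed

theorem Q_poly_unique:
  assumes "\<forall>i. coeff R i \<in> sym_polys n" "\<forall>i. coeff R' i \<in> sym_polys n"
    and eq: "\<And>z y. 1 < z \<Longrightarrow> chain n y \<Longrightarrow>
      eval_mpoly (\<lambda>i. of_real (y i)) (poly R (const (of_real z))) = eval_mpoly (\<lambda>i. of_real (y i)) (poly R' (const (of_real z)))"
  shows "R = R'"
proof (rule poly_eqI)
  fix i
  show "coeff R i = coeff R' i"
  proof (rule mpoly_eq_on_chains[where n = n])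
    show "vars_in n (coeff R i)" "vars_in n (coeff R' i)"
      using assms(1,2) by (auto intro: sym_polys_vars_in)
    fix y assume y: "chain n y"
    let ?y = "\<lambda>i. complex_of_real (y i)"
    have "map_poly (eval_mpoly ?y) R - map_poly (eval_mpoly ?y) R' = 0"
      by (rule Poly_zero_of_infinite_roots[where T = 1]) (use eq[OF _ y] in \<open>simp add: eval_mpoly_poly_const\<close>)
    then have "coeff (map_poly (eval_mpoly ?y) R) i = coeff (map_poly (eval_mpoly ?y) R') i" by simp
    then show "eval_mpoly ?y (coeff R i) = eval_mpoly ?y (coeff R' i)" by (simp add: coeff_map_poly)
  qed
qed

text \<open>Makes the definite description in \<open>Q_poly\<close> usable: an interpolating
  polynomial exists, and two of them agree because chains and real \<open>z > 1\<close> determine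
  all coefficients.\<close>

theorem eval_Q_op:
  assumes "n \<ge> 1" "0 < g" "p \<in> sym_polys n" "1 < z" "chain n y"
  shows "eval_mpoly (\<lambda>i. of_real (y i)) (Q_op n g (of_real z) p) =
    (\<integral>x. eval_mpoly (\<lambda>i. of_real (slice_point 1 n y z x i)) p \<partial>slice_prob n g y z)"
proof -
  let ?P = "\<lambda>R. (\<forall>i. coeff R i \<in> sym_polys n) \<and>
    (\<forall>z>1. \<forall>y. chain n y \<longrightarrow> eval_mpoly (\<lambda>i. of_real (y i)) (poly R (const (of_real z))) = Q_integral n g z p y)"
  obtain R where R: "?P R" using Q_poly_exists[OF assms(1-3)] ..
  have "?P (Q_poly n g p)"
    unfolding Q_poly_def
  proof (rule theI[of ?P, OF R])
    fix R' assume R': "?P R'"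
    show "R' = R"
    proof (rule Q_poly_unique[OF conjunct1[OF R'] conjunct1[OF R]])
      fix z :: real and y :: "nat \<Rightarrow> real" assume "1 < z" "chain n y"
      then show "eval_mpoly (\<lambda>i. of_real (y i)) (poly R' (const (of_real z))) = eval_mpoly (\<lambda>i. of_real (y i)) (poly R (const (of_real z)))"
        using conjunct2[OF R', rule_format, of z y] conjunct2[OF R, rule_format, of z y] by (simp only: simp_thms)
    qed
  qed
  from conjunct2[OF this, rule_format, of z y]
  have "eval_mpoly (\<lambda>i. of_real (y i)) (poly (Q_poly n g p) (const (of_real z))) = Q_integral n g z p y"
    using assms(4,5) by (simp only: simp_thms)
  then show ?thesis
    unfolding Q_op_def Q_integral_eq[OF assms(5,1-3)] .
qed

section \<open>The hypergeometric form\<close>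

lemma sum_PiE_insert:
  assumes "i \<notin> I" "finite I" "\<And>j. j \<in> insert i I \<Longrightarrow> finite (B j)"
  shows "(\<Sum>k\<in>Pi\<^sub>E (insert i I) B. F k) = (\<Sum>k\<in>Pi\<^sub>E I B. \<Sum>c\<in>B i. F (k(i := c)))"
proof -
  have "(\<Sum>k\<in>Pi\<^sub>E (insert i I) B. F k) = (\<Sum>(c, k)\<in>B i \<times> Pi\<^sub>E I B. F (k(i := c)))"
    unfolding PiE_insert_eq
    by (subst sum.reindex[OF inj_combinator[OF assms(1)]]) (simp add: split_beta comp_def)
  also have "\<dots> = (\<Sum>c\<in>B i. \<Sum>k\<in>Pi\<^sub>E I B. F (k(i := c)))"
    by (rule sum.cartesian_product[symmetric])
  also have "\<dots> = (\<Sum>k\<in>Pi\<^sub>E I B. \<Sum>c\<in>B i. F (k(i := c)))"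
    by (rule sum.swap)
  finally show ?thesis .
qed

section \<open>Power series of powers of 1 - X\<close>

text \<open>Binomial series of \<open>1 - X\<close> to the power \<open>- a\<close>; the exponent is
  negated so that Pochhammer symbols appear without signs.\<close>

definition fps_pow1m :: "'a::field_char_0 \<Rightarrow> 'a fps" where
  "fps_pow1m a = Abs_fps (\<lambda>j. pochhammer a j / fact j)"

lemma fps_pow1m_minus_one: "fps_pow1m (a - 1) = (1 - fps_X) * fps_pow1m a"
proof (rule fps_ext)
  fix j
  show "fps_nth (fps_pow1m (a - 1)) j = fps_nth ((1 - fps_X) * fps_pow1m a) j"
  proof (cases j)
    case (Suc i)
    have "pochhammer (a - 1) (Suc i) = (a - 1) * pochhammer a i"
      by (simp add: pochhammer_rec)
    moreover have "(a - 1) * p / (s * f) = p * (a + (s - 1)) / (s * f) - p / f" if "s \<noteq> 0" "f \<noteq> 0" for p s f :: 'a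
      using that by (simp add: field_simps)
    from this[of "of_nat (Suc i)" "fact i" "pochhammer a i"]
    have "(a - 1) * pochhammer a i / fact (Suc i) = pochhammer a (Suc i) / fact (Suc i) - pochhammer a i / fact i"
      by (simp add: pochhammer_Suc of_nat_neq_0 del: of_nat_Suc) (simp add: of_nat_Suc)
    ultimately show ?thesis by (simp add: Suc fps_pow1m_def left_diff_distrib del: fact_Suc)
  qed (simp add: fps_pow1m_def)
qed

lemma fps_pow1m_minus_of_nat: "fps_pow1m (a - of_nat d) = (1 - fps_X) ^ d * fps_pow1m a"
proof (induction d)
  case (Suc d)
  have "fps_pow1m (a - of_nat (Suc d)) = fps_pow1m ((a - of_nat d) - 1)" by (simp add: algebra_simps)
  then show ?case unfolding fps_pow1m_minus_one Suc by (simp add: mult.assoc)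
qed simp

text \<open>Multiplication by \<open>1 = (X + (1 - X)) ^ d\<close>, expanded. At the price of a sum
  it lowers the parameter from \<open>a\<close> to \<open>a - d\<close>, which adapts it to the next
  denominator parameter.\<close>

lemma fps_pow1m_raise:
  "fps_X ^ K * fps_pow1m a =
   (\<Sum>k\<le>d. of_nat (d choose k) * (fps_X ^ (K + k) * fps_pow1m (a - of_nat d + of_nat k)))"
proof -
  have "(\<Sum>k\<le>d. of_nat (d choose k) * (fps_X ^ (K + k) * fps_pow1m (a - of_nat d + of_nat k))) =
    (\<Sum>k\<le>d. of_nat (d choose k) * fps_X ^ k * (1 - fps_X) ^ (d - k)) * (fps_X ^ K * fps_pow1m a)"
  proof -
    have "fps_pow1m (a - of_nat d + of_nat k) = (1 - fps_X) ^ (d - k) * fps_pow1m a" if "k \<le> d" for k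
      using fps_pow1m_minus_of_nat[of a "d - k"] that by (simp add: of_nat_diff algebra_simps)
    then show ?thesis
      unfolding sum_distrib_right by (intro sum.cong refl) (simp add: power_add ac_simps)
  qed
  also have "(\<Sum>k\<le>d. of_nat (d choose k) * fps_X ^ k * (1 - fps_X) ^ (d - k)) = (1 :: 'a fps)"
    using binomial_ring[of fps_X "1 - fps_X :: 'a fps" d] by simp
  finally show ?thesis by simp
qed

text \<open>Since \<open>(b)_j = (b)_K (b + K)_(j - K)\<close>, the denominator \<open>(b)_j\<close>
  cancels the Pochhammer symbol in the coefficient up to \<open>(b)_K\<close>, and the same
  splitting of \<open>(a)_j\<close> puts \<open>a\<close> in its place.\<close>

lemma fps_pow1m_multiplier:
  fixes a b :: "'a::field_char_0"
  assumes "\<And>m. pochhammer b m \<noteq> 0"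
  shows "pochhammer a j / pochhammer b j * fps_nth (fps_X ^ K * fps_pow1m (b + of_nat K)) j =
    pochhammer a K / pochhammer b K * fps_nth (fps_X ^ K * fps_pow1m (a + of_nat K)) j"
proof (cases "K \<le> j")
  case True
  have "pochhammer a j = pochhammer a K * pochhammer (a + of_nat K) (j - K)"
    "pochhammer b j = pochhammer b K * pochhammer (b + of_nat K) (j - K)"
    using True by (simp_all add: pochhammer_product)
  moreover have "pochhammer b j \<noteq> 0" by fact
  ultimately show ?thesis using True by (simp add: fps_pow1m_def fps_X_power_mult_nth)
qed (simp add: fps_X_power_mult_nth)

lemma fps_pow1m_complex:
  fixes a z :: complex
  assumes "norm z < 1"
  shows "(\<lambda>j. fps_nth (fps_X ^ K * fps_pow1m a) j * z ^ j) sums (z ^ K * (1 - z) powr (- a))"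
proof -
  have "(\<lambda>j. ((- a) gchoose j) * (- z) ^ j) sums ((1 + (- z)) powr (- a))"
    by (rule gen_binomial_complex) (use assms in simp)
  moreover have "((- a) gchoose j) * (- z) ^ j = fps_nth (fps_pow1m a) j * z ^ j" for j
  proof -
    have "((- a) gchoose j) * (- z) ^ j = ((- 1) ^ j * (- 1) ^ j) * (pochhammer a j / fact j * z ^ j)"
      by (simp add: gbinomial_pochhammer power_minus[of z])
    then show ?thesis by (simp add: fps_pow1m_def flip: power_mult_distrib)
  qed
  ultimately have "(\<lambda>j. fps_nth (fps_pow1m a) j * z ^ j) sums ((1 - z) powr (- a))" by simp
  note shifted = sums_mult[OF this, of "z ^ K"]
  have "(\<lambda>j. fps_nth (fps_X ^ K * fps_pow1m a) (j + K) * z ^ (j + K)) sums (z ^ K * (1 - z) powr (- a))"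
  proof -
    have "fps_nth (fps_X ^ K * fps_pow1m a) (j + K) * z ^ (j + K) = z ^ K * (fps_nth (fps_pow1m a) j * z ^ j)" for j
      by (simp add: fps_X_power_mult_nth power_add)
    with shifted show ?thesis by simp
  qed
  then have "(\<lambda>j. fps_nth (fps_X ^ K * fps_pow1m a) j * z ^ j) sums
     (z ^ K * (1 - z) powr (- a) + (\<Sum>j<K. fps_nth (fps_X ^ K * fps_pow1m a) j * z ^ j))"
    by (subst (asm) sums_iff_shift) 
  then show ?thesis by (simp add: fps_X_power_mult_nth)
qed

lemma pochhammer_minus_of_nat_over_fact:
  "pochhammer (- real d) k / fact k = (- 1) ^ k * real (d choose k)"
  using gbinomial_pochhammer[of "real d" k] by (simp add: binomial_gbinomial mult.assoc[symmetric] flip: power_mult_distrib)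

lemma f_coeff_hyp:
  assumes "lam \<in> partitions n" "i \<in> {1..<n}"
  shows "f_coeff n g lam k i = (- 1) ^ k i * real ((lam i - lam (i + 1)) choose k i) *
    (pochhammer (hyp_a n g lam i) (\<Sum>j\<in>{i..<n}. k j) / pochhammer (hyp_b n g lam i) (\<Sum>j\<in>{i..<n}. k j))"
proof -
  have le: "lam n \<le> lam i"
  proof -
    have "lam j \<le> lam i" if "i \<le> j" "j \<le> n" for j
      using that
    proof (induction j rule: dec_induct)
      case (step j)
      then have "lam (j + 1) \<le> lam j" using assms by (auto simp: partitions_def)
      with step show ?case by simp
    qed simp
    then show ?thesis using assms by auto
  qed
  have "1 - real (n - i + 1) * g - real (lam i - lam n) = hyp_a n g lam i"
    using le by (simp add: hyp_a_def of_nat_diff)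
  moreover have "1 - real (n - i) * g - real (lam i - lam n) = hyp_b n g lam i"
    using le by (simp add: hyp_b_def hyp_a_def of_nat_diff algebra_simps)
  ultimately show ?thesis
    by (simp add: f_coeff_def pochhammer_minus_of_nat_over_fact)
qed

text \<open>The signs of \<open>(- z) ^ k\<close> and of the binomial form of
  \<open>(- d)_k / k!\<close> cancel. The powers of \<open>z\<close> and \<open>1 - z\<close> are
  collected into one factor for each \<open>k\<close>, the shape in which the hypergeometric
  expansion arrives.\<close>

lemma poly_f_poly_hyp:
  fixes z :: complex
  assumes "lam \<in> partitions n"
  defines "K \<equiv> \<lambda>i k. \<Sum>j\<in>{i..<n}. k j"
  shows "poly (f_poly n g lam) z = z ^ lam n *
    (\<Sum>k\<in>(\<Pi>\<^sub>E i\<in>{1..<n}. {0..lam i - lam (i + 1)}).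
       (\<Prod>i\<in>{1..<n}. of_nat ((lam i - lam (i + 1)) choose k i) *
          of_real (pochhammer (hyp_a n g lam i) (K i k) / pochhammer (hyp_b n g lam i) (K i k))) *
       (z ^ K 1 k * (1 - z) ^ (\<Sum>i\<in>{1..<n}. lam i - lam (i + 1) - k i)))"
proof -
  have "poly (f_poly n g lam) z = z ^ lam n *
    (\<Sum>k\<in>(\<Pi>\<^sub>E i\<in>{1..<n}. {0..lam i - lam (i + 1)}).
       \<Prod>i\<in>{1..<n}. of_real (f_coeff n g lam k i) * ((1 - z) ^ (lam i - lam (i + 1) - k i) * (- z) ^ k i))"
    by (simp add: f_poly_def poly_sum poly_prod)
  also have "(\<Sum>k\<in>(\<Pi>\<^sub>E i\<in>{1..<n}. {0..lam i - lam (i + 1)}).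
       \<Prod>i\<in>{1..<n}. of_real (f_coeff n g lam k i) * ((1 - z) ^ (lam i - lam (i + 1) - k i) * (- z) ^ k i)) =
    (\<Sum>k\<in>(\<Pi>\<^sub>E i\<in>{1..<n}. {0..lam i - lam (i + 1)}).
       (\<Prod>i\<in>{1..<n}. (of_nat ((lam i - lam (i + 1)) choose k i) *
          of_real (pochhammer (hyp_a n g lam i) (K i k) / pochhammer (hyp_b n g lam i) (K i k))) *
       (z ^ k i * (1 - z) ^ (lam i - lam (i + 1) - k i))))"
  proof (intro sum.cong prod.cong refl)
    fix k i assume "i \<in> {1..<n}"
    have "(- 1) ^ k i * (- z) ^ k i = z ^ k i" by (simp flip: power_mult_distrib)
    then have *: "((- 1) ^ k i * c * p) * (q * (- z) ^ k i) = (c * p) * (z ^ k i * q)" for c p q :: complex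
    proof -
      have "(s * c * p) * (q * t) = (s * t) * (c * p * q)" for s t :: complex by (simp only: ac_simps)
      then show ?thesis by (simp only: \<open>(- 1) ^ k i * (- z) ^ k i = z ^ k i\<close> ac_simps)
    qed
    show "of_real (f_coeff n g lam k i) * ((1 - z) ^ (lam i - lam (i + 1) - k i) * (- z) ^ k i) =
      (of_nat ((lam i - lam (i + 1)) choose k i) *
          of_real (pochhammer (hyp_a n g lam i) (K i k) / pochhammer (hyp_b n g lam i) (K i k))) *
       (z ^ k i * (1 - z) ^ (lam i - lam (i + 1) - k i))"
      unfolding f_coeff_hyp[OF assms(1) \<open>i \<in> {1..<n}\<close>] *[symmetric]
      by (simp only: of_real_mult of_real_power of_real_minus of_real_1 of_real_of_nat_eq K_def)
  qed
  finally show ?thesis by (simp only: prod.distrib K_def power_sum)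
qed

text \<open>Downward recursion from the binomial series with parameter \<open>a n\<close>. Because
  \<open>b i = a (Suc i) - d i\<close>, \<open>fps_pow1m_raise\<close> brings the parameter
  \<open>a (Suc i)\<close> plus its shift into the form \<open>b i\<close> plus a larger shift, the
  increment being the new summation index \<open>k i\<close>; \<open>fps_pow1m_multiplier\<close>
  then replaces \<open>b i\<close> by \<open>a i\<close>.\<close>

lemma hypergeo_coefficients:
  fixes a b :: "nat \<Rightarrow> 'a::field_char_0" and d :: "nat \<Rightarrow> nat"
  assumes "i \<le> n"
    and shift: "\<And>i. i < n \<Longrightarrow> b i = a (Suc i) - of_nat (d i)"
    and nz: "\<And>i m. lo \<le> i \<Longrightarrow> i < n \<Longrightarrow> pochhammer (b i) m \<noteq> 0" and "lo \<le> i"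
  defines "K \<equiv> \<lambda>i k. \<Sum>j\<in>{i..<n}. k j"
  shows "(\<Prod>l\<in>{i..n}. pochhammer (a l) j) / ((\<Prod>l\<in>{i..<n}. pochhammer (b l) j) * fact j) =
    (\<Sum>k\<in>(\<Pi>\<^sub>E l\<in>{i..<n}. {0..d l}).
      (\<Prod>l\<in>{i..<n}. of_nat (d l choose k l) * (pochhammer (a l) (K l k) / pochhammer (b l) (K l k))) *
      fps_nth (fps_X ^ K i k * fps_pow1m (a i + of_nat (K i k))) j)"
  using assms(1,4)
proof (induction rule: inc_induct)
  case base
  then show ?case by (simp add: K_def fps_pow1m_def)
next
  case (step i)
  have ins: "{i..<n} = insert i {Suc i..<n}" "{i..n} = insert i {Suc i..n}" using \<open>i < n\<close> by auto
  let ?D = "\<lambda>l. {0..d l}"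
  let ?w = "\<lambda>l k. of_nat (d l choose k l) * (pochhammer (a l) (K l k) / pochhammer (b l) (K l k))"
  let ?mult = "pochhammer (a i) j / pochhammer (b i) j"
  have bi: "\<And>m. pochhammer (b i) m \<noteq> 0" using nz step by auto
  have "(\<Prod>l\<in>{i..n}. pochhammer (a l) j) / ((\<Prod>l\<in>{i..<n}. pochhammer (b l) j) * fact j) =
    ?mult * ((\<Prod>l\<in>{Suc i..n}. pochhammer (a l) j) / ((\<Prod>l\<in>{Suc i..<n}. pochhammer (b l) j) * fact j))"
    unfolding ins by simp
  also have "\<dots> = ?mult * (\<Sum>k\<in>Pi\<^sub>E {Suc i..<n} ?D. (\<Prod>l\<in>{Suc i..<n}. ?w l k) *
      fps_nth (fps_X ^ K (Suc i) k * fps_pow1m (a (Suc i) + of_nat (K (Suc i) k))) j)"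
    using step by simp
  also have "\<dots> = (\<Sum>k\<in>Pi\<^sub>E {Suc i..<n} ?D. \<Sum>c\<in>{0..d i}. (\<Prod>l\<in>{Suc i..<n}. ?w l k) *
      (of_nat (d i choose c) * (pochhammer (a i) (K (Suc i) k + c) / pochhammer (b i) (K (Suc i) k + c)) *
       fps_nth (fps_X ^ (K (Suc i) k + c) * fps_pow1m (a i + of_nat (K (Suc i) k + c))) j))"
    unfolding sum_distrib_left
  proof (intro sum.cong refl)
    fix k
    let ?K = "K (Suc i) k"
    have shift': "a (Suc i) + of_nat ?K - of_nat (d i) + of_nat c = b i + of_nat (?K + c)" for c
      using shift[OF \<open>i < n\<close>] by (simp add: algebra_simps)
    have "fps_X ^ ?K * fps_pow1m (a (Suc i) + of_nat ?K) =
      (\<Sum>c\<le>d i. of_nat (d i choose c) * (fps_X ^ (?K + c) * fps_pow1m (b i + of_nat (?K + c))))"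
      unfolding fps_pow1m_raise[where d = "d i" and K = ?K] shift' ..
    then have "?mult * fps_nth (fps_X ^ ?K * fps_pow1m (a (Suc i) + of_nat ?K)) j =
      ?mult * (\<Sum>c\<le>d i. of_nat (d i choose c) * fps_nth (fps_X ^ (?K + c) * fps_pow1m (b i + of_nat (?K + c))) j)"
      by (simp add: fps_sum_nth fps_of_nat[symmetric] del: fps_of_nat)
    also have "\<dots> = (\<Sum>c\<le>d i. of_nat (d i choose c) * (?mult * fps_nth (fps_X ^ (?K + c) * fps_pow1m (b i + of_nat (?K + c))) j))"
      by (simp only: sum_distrib_left mult.left_commute)
    also have "\<dots> = (\<Sum>c\<in>{0..d i}. of_nat (d i choose c) * (pochhammer (a i) (?K + c) / pochhammer (b i) (?K + c)) *
       fps_nth (fps_X ^ (?K + c) * fps_pow1m (a i + of_nat (?K + c))) j)"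
      by (simp only: fps_pow1m_multiplier[OF bi] mult.assoc atMost_atLeast0)
    finally have eq: "?mult * fps_nth (fps_X ^ ?K * fps_pow1m (a (Suc i) + of_nat ?K)) j = \<dots>" .
    have "?mult * (p * e) = p * (?mult * e)" for p e by (simp only: mult.left_commute)
    then show "?mult * ((\<Prod>l\<in>{Suc i..<n}. ?w l k) * fps_nth (fps_X ^ ?K * fps_pow1m (a (Suc i) + of_nat ?K)) j) =
      (\<Sum>c\<in>{0..d i}. (\<Prod>l\<in>{Suc i..<n}. ?w l k) * (of_nat (d i choose c) * (pochhammer (a i) (?K + c) / pochhammer (b i) (?K + c)) *
       fps_nth (fps_X ^ (?K + c) * fps_pow1m (a i + of_nat (?K + c))) j))"
      unfolding sum_distrib_left[symmetric] by (simp only: eq)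
  qed
  also have "\<dots> = (\<Sum>k\<in>Pi\<^sub>E {i..<n} ?D. (\<Prod>l\<in>{i..<n}. ?w l k) * fps_nth (fps_X ^ K i k * fps_pow1m (a i + of_nat (K i k))) j)"
  proof -
    have "(\<Prod>l\<in>{i..<n}. ?w l (k(i := c))) * fps_nth (fps_X ^ K i (k(i := c)) * fps_pow1m (a i + of_nat (K i (k(i := c))))) j =
      (\<Prod>l\<in>{Suc i..<n}. ?w l k) *
      (of_nat (d i choose c) * (pochhammer (a i) (K (Suc i) k + c) / pochhammer (b i) (K (Suc i) k + c)) *
       fps_nth (fps_X ^ (K (Suc i) k + c) * fps_pow1m (a i + of_nat (K (Suc i) k + c))) j)" for k c
    proof -
      have 1: "K l (k(i := c)) = K l k" if "Suc i \<le> l" for l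
        unfolding K_def by (intro sum.cong refl) (use that in auto)
      have 2: "K i (k(i := c)) = K (Suc i) k + c"
        using 1[of "Suc i"] unfolding K_def ins(1) by simp
      have 3: "(\<Prod>l\<in>{Suc i..<n}. ?w l (k(i := c))) = (\<Prod>l\<in>{Suc i..<n}. ?w l k)"
        by (intro prod.cong refl) (auto simp: 1)
      have "(\<Prod>l\<in>{i..<n}. ?w l (k(i := c))) = ?w i (k(i := c)) * (\<Prod>l\<in>{Suc i..<n}. ?w l k)"
        unfolding 3[symmetric] unfolding ins(1) by (subst prod.insert) auto
      then show ?thesis unfolding 2 by (simp only: fun_upd_same mult.assoc mult.left_commute)
    qed
    then show ?thesis unfolding ins(1) by (subst sum_PiE_insert) auto
  qed
  finally show ?case .
qed

lemma foldl_mult_prod_list: "foldl (\<lambda>r a. r * h a) c xs = c * prod_list (map h xs)"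
  for c :: "'a::comm_monoid_mult"
  by (induction xs arbitrary: c) (simp_all add: mult.assoc)

text \<open>The exponent \<open>1 - n g\<close> of the prefactor and the exponent
  \<open>- a 1 - K\<close> of a term of the series add up to \<open>lam 1 - lam n - K\<close>, a
  natural number; so each term of the expansion is a polynomial, namely the corresponding term of
  \<open>f_poly\<close>.\<close>

theorem f_hyp_eq_f_poly:
  assumes "n \<ge> 1" "lam \<in> partitions n" "norm z < 1"
    and nonpos: "\<forall>i\<in>{1..<n}. hyp_b n g lam i \<notin> \<int>\<^sub>\<le>\<^sub>0"
  shows "f_hyp n g lam z = poly (f_poly n g lam) z"
proof -
  define a b :: "nat \<Rightarrow> complex" where "a = (\<lambda>i. of_real (hyp_a n g lam i))"
    and "b = (\<lambda>i. of_real (hyp_b n g lam i))"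
  \<comment> \<open>The shift hypothesis of \<open>hypergeo_coefficients\<close> includes index 0,
    where the dummy values \<open>d 0 = 0\<close> and \<open>b' 0 = a 1\<close> satisfy it.\<close>
  define d where "d = (\<lambda>i. if i = 0 then 0 else lam i - lam (Suc i))"
  define b' where "b' = (\<lambda>i. if i = 0 then a 1 else b i)"
  define K where "K = (\<lambda>i k. \<Sum>j\<in>{i..<n}. k j :: nat)"
  define I where "I = (\<Pi>\<^sub>E l\<in>{1..<n}. {0..d l})"
  define W where "W = (\<lambda>k. \<Prod>l\<in>{1..<n}. of_nat (d l choose k l) * (pochhammer (a l) (K l k) / pochhammer (b' l) (K l k)))"
  have lam: "lam (Suc i) \<le> lam i" if "1 \<le> i" "i < n" for i
    using that assms by (auto simp: partitions_def)
  have coeff: "fps_nth (fps_hypergeo (map a [1..<Suc n]) (map b [1..<n]) 1) j =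
     (\<Sum>k\<in>I. W k * fps_nth (fps_X ^ K 1 k * fps_pow1m (a 1 + of_nat (K 1 k))) j)" for j
  proof -
    have "fps_nth (fps_hypergeo (map a [1..<Suc n]) (map b [1..<n]) 1) j =
      (\<Prod>l\<in>{1..n}. pochhammer (a l) j) / ((\<Prod>l\<in>{1..<n}. pochhammer (b' l) j) * fact j)"
    proof -
      have "prod_list (map (\<lambda>l. pochhammer (a l) j) [1..<Suc n]) = (\<Prod>l\<in>{1..n}. pochhammer (a l) j)"
        by (subst prod.distinct_set_conv_list[symmetric])
          (simp_all only: set_upt atLeastLessThanSuc_atLeastAtMost distinct_upt)
      moreover have "prod_list (map (\<lambda>l. pochhammer (b l) j) [1..<n]) = (\<Prod>l\<in>{1..<n}. pochhammer (b' l) j)"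
        by (subst prod.distinct_set_conv_list[symmetric]) (auto simp: b'_def)
      ultimately show ?thesis
        unfolding fps_hypergeo_nth foldl_mult_prod_list map_map comp_def by simp
    qed
    also have "\<dots> = (\<Sum>k\<in>I. W k * fps_nth (fps_X ^ K 1 k * fps_pow1m (a 1 + of_nat (K 1 k))) j)"
      unfolding I_def W_def K_def
    proof (rule hypergeo_coefficients[where lo = 1])
      show "b' i = a (Suc i) - of_nat (d i)" if "i < n" for i
        using that lam[of i] by (auto simp: b'_def d_def b_def a_def hyp_b_def hyp_a_def of_nat_diff algebra_simps)
      show "pochhammer (b' i) m \<noteq> 0" if "1 \<le> i" "i < n" for i m
      proof -
        have "hyp_b n g lam i \<notin> \<int>\<^sub>\<le>\<^sub>0" using nonpos that by auto
        then have "pochhammer (hyp_b n g lam i) m \<noteq> 0"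
          by (auto simp: pochhammer_eq_0_iff)
        then show ?thesis using that by (simp add: b'_def b_def pochhammer_of_real)
      qed
    qed (use assms in auto)
    finally show ?thesis .
  qed
  have "(\<lambda>j. \<Sum>k\<in>I. W k * (fps_nth (fps_X ^ K 1 k * fps_pow1m (a 1 + of_nat (K 1 k))) j * z ^ j)) sums
    (\<Sum>k\<in>I. W k * (z ^ K 1 k * (1 - z) powr (- (a 1 + of_nat (K 1 k)))))"
    by (intro sums_sum sums_mult fps_pow1m_complex assms)
  then have "eval_fps (fps_hypergeo (map a [1..<Suc n]) (map b [1..<n]) 1) z =
    (\<Sum>k\<in>I. W k * (z ^ K 1 k * (1 - z) powr (- (a 1 + of_nat (K 1 k)))))"
    unfolding eval_fps_def coeff sum_distrib_right mult.assoc by (simp add: sums_iff)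
  then have "f_hyp n g lam z = z ^ lam n * (\<Sum>k\<in>I. W k *
      (z ^ K 1 k * ((1 - z) powr of_real (1 - real n * g) * (1 - z) powr (- (a 1 + of_nat (K 1 k))))))"
    unfolding f_hyp_def a_def[symmetric] b_def[symmetric] by (simp add: sum_distrib_left ac_simps)
  also have "(\<Sum>k\<in>I. W k * (z ^ K 1 k * ((1 - z) powr of_real (1 - real n * g) * (1 - z) powr (- (a 1 + of_nat (K 1 k)))))) =
     (\<Sum>k\<in>I. W k * (z ^ K 1 k * (1 - z) ^ (\<Sum>i\<in>{1..<n}. lam i - lam (i + 1) - k i)))"
  proof (intro sum.cong refl arg_cong2[where f = "(*)"])
    fix k assume "k \<in> I"
    then have k: "k i \<le> lam i - lam (i + 1)" if "i \<in> {1..<n}" for i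
      using that by (auto simp: I_def d_def PiE_iff)
    have z1: "1 - z \<noteq> 0" using assms by auto
    have "real (\<Sum>i\<in>{1..<n}. lam i - lam (i + 1) - k i) = (\<Sum>i\<in>{1..<n}. real (lam i) - real (lam (Suc i))) - real (K 1 k)"
    proof -
      have "real (lam i - lam (i + 1) - k i) = real (lam i) - real (lam (Suc i)) - real (k i)" if "i \<in> {1..<n}" for i
        using k[OF that] lam[of i] that by (simp add: of_nat_diff)
      then show ?thesis by (simp add: K_def sum_subtractf)
    qed
    also have "(\<Sum>i\<in>{1..<n}. real (lam i) - real (lam (Suc i))) = real (lam 1) - real (lam n)"
      using sum_Suc_diff'[OF \<open>n \<ge> 1\<close>, of "\<lambda>i. - real (lam i)"] by simp
    finally have "real (\<Sum>i\<in>{1..<n}. lam i - lam (i + 1) - k i) = 1 - real n * g - (hyp_a n g lam 1 + real (K 1 k))"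
      using \<open>n \<ge> 1\<close> by (simp add: hyp_a_def)
    from arg_cong[OF this, of complex_of_real]
    have "of_real (1 - real n * g) + (- (a 1 + of_nat (K 1 k))) = of_nat (\<Sum>i\<in>{1..<n}. lam i - lam (i + 1) - k i)"
      by (simp only: a_def of_real_add of_real_minus of_real_of_nat_eq diff_conv_add_uminus)
    then show "(1 - z) powr of_real (1 - real n * g) * (1 - z) powr (- (a 1 + of_nat (K 1 k))) =
       (1 - z) ^ (\<Sum>i\<in>{1..<n}. lam i - lam (i + 1) - k i)"
      using z1 unfolding powr_add[symmetric] by (simp only: powr_nat if_False)
  qed
  also have "z ^ lam n * \<dots> = poly (f_poly n g lam) z"
  proof -
    have "I = (\<Pi>\<^sub>E i\<in>{1..<n}. {0..lam i - lam (i + 1)})"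
      unfolding I_def by (intro PiE_cong) (auto simp: d_def)
    moreover have "W k = (\<Prod>i\<in>{1..<n}. of_nat ((lam i - lam (i + 1)) choose k i) *
          of_real (pochhammer (hyp_a n g lam i) (K i k) / pochhammer (hyp_b n g lam i) (K i k)))" for k
      unfolding W_def
      by (intro prod.cong refl) (auto simp: d_def a_def b'_def b_def pochhammer_of_real)
    ultimately show ?thesis unfolding poly_f_poly_hyp[OF assms(2)] K_def by simp
  qed
  finally show ?thesis .
qed

section \<open>Moments of partial sums\<close>

definition eta_sum :: "nat \<Rightarrow> (nat \<Rightarrow> real) \<Rightarrow> real \<Rightarrow> (nat \<Rightarrow> real) \<Rightarrow> nat \<Rightarrow> real" where
  "eta_sum n y z x j = (\<Sum>i\<in>{1..j}. eta n y z x i)"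

lemma eta_sum_bounds:
  assumes "chain n y" "n \<ge> 1" "1 < z" "slice_point 1 n y z x \<in> Omega n y" "j \<le> n"
  shows "0 \<le> eta_sum n y z x j" "eta_sum n y z x j \<le> 1"
proof -
  have pos: "0 \<le> eta n y z x i" if "i \<in> {1..n}" for i
    using eta_pos[OF assms(1,3,4) that] by simp
  show "0 \<le> eta_sum n y z x j" unfolding eta_sum_def using pos assms(5) by (intro sum_nonneg) auto
  have "eta_sum n y z x j \<le> (\<Sum>i\<in>{1..n}. eta n y z x i)"
    unfolding eta_sum_def using pos assms(5) by (intro sum_mono2) auto
  then show "eta_sum n y z x j \<le> 1" using sum_eta[OF assms(1-4)] by simp
qed

lemma eta_sum_measurable:
  "n \<ge> 1 \<Longrightarrow> (\<lambda>x. eta_sum n y z x j) \<in> borel_measurable (slice_prob n g y z)"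
  unfolding eta_sum_def by (intro borel_measurable_sum eta_measurable_slice_prob)

lemma integrable_eta_sums:
  assumes "chain n y" "n \<ge> 1" "0 < g" "1 < z" "k \<le> n"
  shows "integrable (slice_prob n g y z) (\<lambda>x. (\<Prod>j\<in>{1..<k}. eta_sum n y z x j ^ c j) *
    eta_sum n y z x k ^ C * (\<Prod>i\<in>{Suc k..n}. eta n y z x i ^ m i))"
proof -
  interpret finite_measure "slice_prob n g y z" by (rule finite_measure_slice_prob[OF assms(1-4)])
  show ?thesis
  proof (rule integrable_const_bound[where B = 1])
    show "AE x in slice_prob n g y z. norm ((\<Prod>j\<in>{1..<k}. eta_sum n y z x j ^ c j) *
      eta_sum n y z x k ^ C * (\<Prod>i\<in>{Suc k..n}. eta n y z x i ^ m i)) \<le> 1"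
      using AE_slice_prob[OF assms(2), where g = g and y = y and z = z]
    proof eventually_elim
      case (elim x)
      note s = eta_sum_bounds[OF assms(1,2,4) elim]
      have e: "0 \<le> eta n y z x i" "eta n y z x i \<le> 1" if "i \<in> {Suc k..n}" for i
        using eta_pos[OF assms(1,4) elim, of i] eta_le_1[OF assms(1,2,4) elim, of i] that by auto
      have 1: "0 \<le> (\<Prod>j\<in>{1..<k}. eta_sum n y z x j ^ c j)" "(\<Prod>j\<in>{1..<k}. eta_sum n y z x j ^ c j) \<le> 1"
        using s assms(5) by (intro prod_nonneg prod_le_1; auto intro!: power_le_one zero_le_power)+
      have 2: "0 \<le> eta_sum n y z x k ^ C" "eta_sum n y z x k ^ C \<le> 1"
        using s[OF assms(5)] by (auto intro: power_le_one)
      have 3: "0 \<le> (\<Prod>i\<in>{Suc k..n}. eta n y z x i ^ m i)" "(\<Prod>i\<in>{Suc k..n}. eta n y z x i ^ m i) \<le> 1"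
        using e by (intro prod_nonneg prod_le_1; auto intro!: power_le_one zero_le_power)+
      have "(\<Prod>j\<in>{1..<k}. eta_sum n y z x j ^ c j) * eta_sum n y z x k ^ C * (\<Prod>i\<in>{Suc k..n}. eta n y z x i ^ m i) \<le> 1"
        using 1 2 3 by (intro mult_le_one mult_nonneg_nonneg)
      then show ?case using 1 2 3 by simp
    qed
    show "(\<lambda>x. (\<Prod>j\<in>{1..<k}. eta_sum n y z x j ^ c j) *
      eta_sum n y z x k ^ C * (\<Prod>i\<in>{Suc k..n}. eta n y z x i ^ m i)) \<in> borel_measurable (slice_prob n g y z)"
      by (intro borel_measurable_times borel_measurable_prod borel_measurable_power eta_measurable_slice_prob
          eta_sum_measurable assms)
  qed
qed

text \<open>In each step \<open>\<sigma>\<^sub>k\<^sub>+\<^sub>1 = \<sigma>\<^sub>k + \<eta>\<^sub>k\<^sub>+\<^sub>1\<close> is expanded, and the moments recombine by Vandermonde convolution.\<close>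

lemma integral_eta_sums_aux:
  assumes "chain n y" "n \<ge> 1" "0 < g" "1 < z" "1 \<le> k" "k \<le> n"
  shows "(\<integral>x. (\<Prod>j\<in>{1..<k}. eta_sum n y z x j ^ c j) *
      eta_sum n y z x k ^ C * (\<Prod>i\<in>{Suc k..n}. eta n y z x i ^ m i) \<partial>slice_prob n g y z) =
    (\<Prod>j\<in>{1..<k}. pochhammer (real j * g) (\<Sum>i\<in>{1..j}. c i) / pochhammer (real (Suc j) * g) (\<Sum>i\<in>{1..j}. c i)) *
    pochhammer (real k * g) ((\<Sum>i\<in>{1..<k}. c i) + C) * (\<Prod>i\<in>{Suc k..n}. pochhammer g (m i)) /
    pochhammer (real n * g) ((\<Sum>i\<in>{1..<k}. c i) + C + (\<Sum>i\<in>{Suc k..n}. m i))"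
  using assms(5,6)
proof (induction k arbitrary: C m rule: nat_induct_at_least)
  case base
  \<comment> \<open>For \<open>k = 1\<close> the partial sum is a single simplex coordinate, so its
    exponent \<open>C\<close> becomes an ordinary one.\<close>
  define m' where "m' = m(1 := C)"
  have m': "(\<Prod>i\<in>{Suc 1..n}. f i (m' i)) = (\<Prod>i\<in>{Suc 1..n}. f i (m i))" for f :: "nat \<Rightarrow> nat \<Rightarrow> real"
    by (intro prod.cong refl) (auto simp: m'_def)
  have ms: "(\<Sum>i\<in>{Suc 1..n}. m' i) = (\<Sum>i\<in>{Suc 1..n}. m i)"
    by (intro sum.cong refl) (auto simp: m'_def)
  have m1: "m' 1 = C" by (simp add: m'_def)
  have "(\<Prod>i\<in>{1..n}. eta n y z x i ^ m' i) = (\<Prod>j\<in>{1..<1}. eta_sum n y z x j ^ c j) *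
      eta_sum n y z x 1 ^ C * (\<Prod>i\<in>{Suc 1..n}. eta n y z x i ^ m i)" for x
    unfolding prod.atLeast_Suc_atMost[OF assms(2)] m'[of "\<lambda>i. power (eta n y z x i)"] m1 by (simp add: eta_sum_def)
  moreover have "dirichlet_moment n g m' = pochhammer g C * (\<Prod>i\<in>{Suc 1..n}. pochhammer g (m i)) /
      pochhammer (real n * g) (C + (\<Sum>i\<in>{Suc 1..n}. m i))"
    unfolding dirichlet_moment_def prod.atLeast_Suc_atMost[OF assms(2)] sum.atLeast_Suc_atMost[OF assms(2)]
      m'[of "\<lambda>i. pochhammer g"] ms m1 ..
  ultimately show ?case
    using integral_eta_moment[OF assms(1-4), of m'] by simp
next
  case (Suc k)
  let ?s = "eta_sum n y z" and ?e = "eta n y z"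
  let ?Ck = "\<Sum>i\<in>{1..k}. c i"
  let ?A = "\<Prod>j\<in>{1..<k}. pochhammer (real j * g) (\<Sum>i\<in>{1..j}. c i) / pochhammer (real (Suc j) * g) (\<Sum>i\<in>{1..j}. c i)"
  let ?M = "\<Sum>i\<in>{Suc (Suc k)..n}. m i"
  let ?G = "\<Prod>i\<in>{Suc (Suc k)..n}. pochhammer g (m i)"
  have k: "1 \<le> k" "Suc k \<le> n" using Suc by auto
  have Ck: "?Ck = (\<Sum>i\<in>{1..<k}. c i) + c k" using k by (simp add: sum.last_plus atLeastLessThanSuc_atLeastAtMost[symmetric])
  \<comment> \<open>In the term with index \<open>l\<close> of the binomial expansion, the power
    \<open>l\<close> joins the partial sum up to \<open>k\<close>, and \<open>C - l\<close> goes to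
    the separate factor with index \<open>Suc k\<close>.\<close>
  define m' where "m' = (\<lambda>l. m(Suc k := C - l))"
  have m': "(\<Prod>i\<in>{Suc k..n}. f i (m' l i)) = f (Suc k) (C - l) * (\<Prod>i\<in>{Suc (Suc k)..n}. f i (m i))"
    for f :: "nat \<Rightarrow> nat \<Rightarrow> real" and l
  proof -
    have "(\<Prod>i\<in>{Suc (Suc k)..n}. f i (m' l i)) = (\<Prod>i\<in>{Suc (Suc k)..n}. f i (m i))"
      by (intro prod.cong refl) (auto simp: m'_def)
    then show ?thesis using k by (simp add: prod.atLeast_Suc_atMost m'_def)
  qed
  have ms: "(\<Sum>i\<in>{Suc k..n}. m' l i) = (C - l) + ?M" for l
  proof -
    have "(\<Sum>i\<in>{Suc (Suc k)..n}. m' l i) = ?M" by (intro sum.cong refl) (auto simp: m'_def)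
    then show ?thesis using k by (simp add: sum.atLeast_Suc_atMost m'_def)
  qed
  let ?f = "\<lambda>l x. (\<Prod>j\<in>{1..<k}. ?s x j ^ c j) * ?s x k ^ (c k + l) * (\<Prod>i\<in>{Suc k..n}. ?e x i ^ m' l i)"
  have expand: "(\<Prod>j\<in>{1..<Suc k}. ?s x j ^ c j) * ?s x (Suc k) ^ C * (\<Prod>i\<in>{Suc (Suc k)..n}. ?e x i ^ m i) =
    (\<Sum>l\<le>C. real (C choose l) * ?f l x)" for x
  proof -
    have "?s x (Suc k) = ?s x k + ?e x (Suc k)" by (simp add: eta_sum_def)
    then have "?s x (Suc k) ^ C = (\<Sum>l\<le>C. real (C choose l) * ?s x k ^ l * ?e x (Suc k) ^ (C - l))"
      by (simp add: binomial_ring)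
    moreover have "(\<Prod>j\<in>{1..<Suc k}. ?s x j ^ c j) = (\<Prod>j\<in>{1..<k}. ?s x j ^ c j) * ?s x k ^ c k"
      using k by simp
    ultimately show ?thesis
      unfolding m'[of "\<lambda>i. power (?e x i)"]
      by (simp add: sum_distrib_left sum_distrib_right power_add ac_simps)
  qed
  have int: "integrable (slice_prob n g y z) (?f l)" for l
    by (rule integrable_eta_sums[OF assms(1-4)]) (use k in auto)
  have "(\<integral>x. (\<Prod>j\<in>{1..<Suc k}. ?s x j ^ c j) * ?s x (Suc k) ^ C * (\<Prod>i\<in>{Suc (Suc k)..n}. ?e x i ^ m i) \<partial>slice_prob n g y z) =
    (\<Sum>l\<le>C. real (C choose l) * (\<integral>x. ?f l x \<partial>slice_prob n g y z))"
    unfolding expand using int by (subst Bochner_Integration.integral_sum) auto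
  also have "\<dots> = (\<Sum>l\<le>C. real (C choose l) * (?A * pochhammer (real k * g) (?Ck + l) *
      (pochhammer g (C - l) * ?G) / pochhammer (real n * g) (?Ck + C + ?M)))"
  proof (intro sum.cong refl arg_cong2[where f = "(*)"])
    fix l assume l: "l \<in> {..C}"
    have idx: "(\<Sum>i\<in>{1..<k}. c i) + (c k + l) = ?Ck + l" "?Ck + l + ((C - l) + ?M) = ?Ck + C + ?M"
      using l Ck by auto
    have "(\<integral>x. ?f l x \<partial>slice_prob n g y z) = ?A * pochhammer (real k * g) ((\<Sum>i\<in>{1..<k}. c i) + (c k + l)) *
      (pochhammer g (C - l) * ?G) / pochhammer (real n * g) ((\<Sum>i\<in>{1..<k}. c i) + (c k + l) + ((C - l) + ?M))"
      using Suc.IH[of "c k + l" "m' l"] k(2) unfolding m'[of "\<lambda>i. pochhammer g"] ms by (simp only: Suc_leD)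
    then show "(\<integral>x. ?f l x \<partial>slice_prob n g y z) = ?A * pochhammer (real k * g) (?Ck + l) *
      (pochhammer g (C - l) * ?G) / pochhammer (real n * g) (?Ck + C + ?M)"
      unfolding idx .
  qed
  also have "\<dots> = ?A * ?G / pochhammer (real n * g) (?Ck + C + ?M) * pochhammer (real k * g) ?Ck *
    (\<Sum>l\<le>C. real (C choose l) * pochhammer (real k * g + real ?Ck) l * pochhammer g (C - l))"
    unfolding sum_distrib_left pochhammer_product'[of "real k * g" ?Ck] by (intro sum.cong refl) simp
  also have "(\<Sum>l\<le>C. real (C choose l) * pochhammer (real k * g + real ?Ck) l * pochhammer g (C - l)) =
    pochhammer (real (Suc k) * g + real ?Ck) C"
    by (subst pochhammer_binomial_sum[symmetric]) (simp add: algebra_simps)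
  also have "\<dots> = pochhammer (real (Suc k) * g) (?Ck + C) / pochhammer (real (Suc k) * g) ?Ck"
  proof -
    have "0 < pochhammer (real (Suc k) * g) ?Ck" using assms(3) by (intro pochhammer_pos) auto
    then show ?thesis unfolding pochhammer_product'[of "real (Suc k) * g" ?Ck] by simp
  qed
  also have "?A * ?G / pochhammer (real n * g) (?Ck + C + ?M) * pochhammer (real k * g) ?Ck *
      (pochhammer (real (Suc k) * g) (?Ck + C) / pochhammer (real (Suc k) * g) ?Ck) =
    (?A * (pochhammer (real k * g) ?Ck / pochhammer (real (Suc k) * g) ?Ck)) *
    pochhammer (real (Suc k) * g) (?Ck + C) * ?G / pochhammer (real n * g) (?Ck + C + ?M)"
    by (simp add: ac_simps)
  also have "?A * (pochhammer (real k * g) ?Ck / pochhammer (real (Suc k) * g) ?Ck) =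
    (\<Prod>j\<in>{1..<Suc k}. pochhammer (real j * g) (\<Sum>i\<in>{1..j}. c i) / pochhammer (real (Suc j) * g) (\<Sum>i\<in>{1..j}. c i))"
    using k by simp
  finally show ?case by (simp only: atLeastLessThanSuc_atLeastAtMost)
qed

lemma integral_eta_sums:
  assumes "chain n y" "n \<ge> 1" "0 < g" "1 < z"
  shows "(\<integral>x. (\<Prod>j\<in>{1..<n}. eta_sum n y z x j ^ c j) \<partial>slice_prob n g y z) =
    (\<Prod>j\<in>{1..<n}. pochhammer (real j * g) (\<Sum>i\<in>{1..j}. c i) / pochhammer (real (Suc j) * g) (\<Sum>i\<in>{1..j}. c i))"
proof -
  have "0 < pochhammer (real n * g) (\<Sum>i\<in>{1..<n}. c i)" using assms(2,3) by (intro pochhammer_pos) auto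
  then show ?thesis using integral_eta_sums_aux[OF assms(1-4), of n c 0] assms(2) by simp
qed

lemma integrable_eta_sums':
  assumes "chain n y" "n \<ge> 1" "0 < g" "1 < z"
  shows "integrable (slice_prob n g y z) (\<lambda>x. \<Prod>j\<in>{1..<n}. eta_sum n y z x j ^ c j)"
  using integrable_eta_sums[OF assms(1-4), of n c 0] by simp

text \<open>The factors on the left are, up to sign, the last \<open>K\<close> of the
  \<open>N\<close> factors of \<open>(a)_N\<close>. When this is applied to numerator and
  denominator of \<open>f_coeff\<close>, the symbols \<open>(a)_N\<close>, which do not involve
  \<open>K\<close>, make up \<open>beta\<close>.\<close>

lemma pochhammer_reflect:
  fixes a :: real
  assumes "0 < a" "K \<le> N"
  shows "pochhammer (1 - a - real N) K = (- 1) ^ K * (pochhammer a N / pochhammer a (N - K))"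
proof -
  have "pochhammer (- (a + real N - 1)) K = (- 1) ^ K * pochhammer (a + real N - 1 - real K + 1) K"
    by (rule pochhammer_minus)
  moreover have "pochhammer a N = pochhammer a (N - K) * pochhammer (a + real (N - K)) K"
    using pochhammer_product'[of a "N - K" K] assms(2) by simp
  moreover have "0 < pochhammer a (N - K)" using assms(1) by (rule pochhammer_pos)
  ultimately show ?thesis using assms(2) by (simp add: of_nat_diff algebra_simps)
qed

section \<open>The expectation of the ladder product\<close>

text \<open>The limit of the product of \<open>x i / y i\<close> over the \<open>r\<close> largest
  indices for widely separated \<open>y\<close>: the value of the partial fraction function at a
  point \<open>u\<close> between two blocks of poles, with \<open>y i / (y i - u)\<close> replaced
  by 1 for poles above \<open>u\<close> and by 0 for poles below.\<close>

definition ladder :: "nat \<Rightarrow> (nat \<Rightarrow> real) \<Rightarrow> real \<Rightarrow> (nat \<Rightarrow> real) \<Rightarrow> nat \<Rightarrow> real" where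
  "ladder n y z x r = 1 + (z - 1) * (\<Sum>i\<in>{n - r + 1..n}. eta n y z x i)"

lemma ladder_eta_sum:
  assumes "chain n y" "n \<ge> 1" "1 < z" "slice_point 1 n y z x \<in> Omega n y" "r \<in> {1..<n}"
  shows "ladder n y z x r = z + (1 - z) * eta_sum n y z x (n - r)"
proof -
  have "{1..n} = {1..n - r} \<union> {n - r + 1..n}" "{1..n - r} \<inter> {n - r + 1..n} = {}" using assms(5) by auto
  then have "eta_sum n y z x (n - r) + (\<Sum>i\<in>{n - r + 1..n}. eta n y z x i) = 1"
    unfolding sum_eta[OF assms(1-4), symmetric] eta_sum_def by (simp add: sum.union_disjoint)
  then have "(\<Sum>i\<in>{n - r + 1..n}. eta n y z x i) = 1 - eta_sum n y z x (n - r)" by simp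
  from arg_cong[OF this, of "\<lambda>s. 1 + (z - 1) * s"] show ?thesis unfolding ladder_def by (simp add: algebra_simps)
qed

lemma partition_step_sum:
  assumes lam: "lam \<in> partitions n" and "1 \<le> r" "r \<le> n"
  shows "lam r = lam n + (\<Sum>j\<in>{r..<n}. lam j - lam (j + 1))"
  using assms(3,2)
proof (induction r rule: inc_induct)
  case (step r)
  have "\<forall>i\<in>{1..<n}. lam (i + 1) \<le> lam i" using lam by (simp add: partitions_def)
  then have "lam (Suc r) \<le> lam r" using \<open>r < n\<close> \<open>1 \<le> r\<close> by simp
  moreover have "lam (Suc r) = lam n + (\<Sum>j\<in>{Suc r..<n}. lam j - lam (j + 1))" using step by simp
  moreover have "(\<Sum>j\<in>{r..<n}. lam j - lam (j + 1)) = (lam r - lam (Suc r)) + (\<Sum>j\<in>{Suc r..<n}. lam j - lam (j + 1))"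
    using step by (simp add: sum.atLeast_Suc_lessThan)
  ultimately show ?case by simp
qed simp

text \<open>Each ladder factor is \<open>z + (1 - z)\<close> times a partial sum, and
  \<open>k r\<close> counts how often \<open>z\<close> is chosen among its \<open>d r\<close>
  copies. The moments of the partial sums involve the sums \<open>T k r\<close> of the
  \<open>d j - k j\<close>, whereas \<open>f_coeff\<close> involves sums of the \<open>k j\<close>;
  reflecting the Pochhammer symbols matches the two up to \<open>beta\<close>.\<close>

theorem integral_ladder:
  assumes y: "chain n y" and n: "n \<ge> 1" and g: "0 < g" and z: "1 < z" and lam: "lam \<in> partitions n"
  shows "poly (f_poly n g lam) (of_real z) = of_real (beta n g lam) * of_real (z ^ lam n *
    (\<integral>x. (\<Prod>r\<in>{1..<n}. ladder n y z x r ^ (lam r - lam (r + 1))) \<partial>slice_prob n g y z))"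
    and "integrable (slice_prob n g y z) (\<lambda>x. \<Prod>r\<in>{1..<n}. ladder n y z x r ^ (lam r - lam (r + 1)))"
proof -
  define d where "d = (\<lambda>r. lam r - lam (r + 1))"
  let ?B = "\<lambda>k. \<Prod>r\<in>{1..<n}. real (d r choose k r) * z ^ k r * (1 - z) ^ (d r - k r)"
  let ?S = "\<lambda>k x. \<Prod>r\<in>{1..<n}. eta_sum n y z x (n - r) ^ (d r - k r)"
  let ?I = "\<Pi>\<^sub>E r\<in>{1..<n}. {0..d r}"
  define T where "T = (\<lambda>k r. \<Sum>j\<in>{r..<n}. d j - k j)"
  have d_sum: "lam r - lam n = (\<Sum>j\<in>{r..<n}. d j)" if "1 \<le> r" "r \<le> n" for r
    using partition_step_sum[OF lam that] by (simp add: d_def)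
  \<comment> \<open>\<open>integral_eta_sums\<close> accumulates exponents from index 1 upwards,
    \<open>f_coeff\<close> from \<open>n - 1\<close> downwards; hence the reversal
    \<open>r \<mapsto> n - r\<close>.\<close>
  have S_reindex: "?S k x = (\<Prod>j\<in>{1..<n}. eta_sum n y z x j ^ (d (n - j) - k (n - j)))" for k x
    by (rule prod.reindex_bij_witness[of _ "\<lambda>j. n - j" "\<lambda>r. n - r"]) auto
  have S_int: "integrable (slice_prob n g y z) (?S k)" for k
    unfolding S_reindex by (rule integrable_eta_sums'[OF y n g z])
  have S_val: "(\<integral>x. ?S k x \<partial>slice_prob n g y z) =
    (\<Prod>r\<in>{1..<n}. pochhammer (real (n - r) * g) (T k r) / pochhammer (real (n - r + 1) * g) (T k r))" for k
  proof -
    have "(\<integral>x. ?S k x \<partial>slice_prob n g y z) = (\<Prod>j\<in>{1..<n}.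
      pochhammer (real j * g) (\<Sum>i\<in>{1..j}. d (n - i) - k (n - i)) / pochhammer (real (Suc j) * g) (\<Sum>i\<in>{1..j}. d (n - i) - k (n - i)))"
      unfolding S_reindex by (rule integral_eta_sums[OF y n g z])
    also have "\<dots> = (\<Prod>r\<in>{1..<n}. pochhammer (real (n - r) * g) (T k r) / pochhammer (real (n - r + 1) * g) (T k r))"
    proof (rule prod.reindex_bij_witness[of _ "\<lambda>j. n - j" "\<lambda>r. n - r"])
      fix j assume j: "j \<in> {1..<n}"
      have "(\<Sum>i\<in>{1..j}. d (n - i) - k (n - i)) = T k (n - j)"
        unfolding T_def by (rule sum.reindex_bij_witness[of _ "\<lambda>j. n - j" "\<lambda>r. n - r"]) (use j in auto)
      then show "pochhammer (real (n - (n - j)) * g) (T k (n - j)) / pochhammer (real (n - (n - j) + 1) * g) (T k (n - j)) =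
        pochhammer (real j * g) (\<Sum>i\<in>{1..j}. d (n - i) - k (n - i)) / pochhammer (real (Suc j) * g) (\<Sum>i\<in>{1..j}. d (n - i) - k (n - i))"
        using j by simp
    qed auto
    finally show ?thesis .
  qed
  have AE: "AE x in slice_prob n g y z. (\<Prod>r\<in>{1..<n}. ladder n y z x r ^ d r) = (\<Sum>k\<in>?I. ?B k * ?S k x)"
    using AE_slice_prob[OF n, where g = g and y = y and z = z]
  proof eventually_elim
    case (elim x)
    have "(\<Prod>r\<in>{1..<n}. ladder n y z x r ^ d r) =
      (\<Prod>r\<in>{1..<n}. \<Sum>k\<in>{0..d r}. real (d r choose k) * z ^ k * (1 - z) ^ (d r - k) * eta_sum n y z x (n - r) ^ (d r - k))"
    proof (intro prod.cong refl)
      fix r assume "r \<in> {1..<n}"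
      then show "ladder n y z x r ^ d r = (\<Sum>k\<in>{0..d r}. real (d r choose k) * z ^ k * (1 - z) ^ (d r - k) * eta_sum n y z x (n - r) ^ (d r - k))"
        unfolding ladder_eta_sum[OF y n z elim \<open>r \<in> {1..<n}\<close>] binomial_ring atMost_atLeast0
        by (simp add: power_mult_distrib mult.assoc)
    qed
    also have "\<dots> = (\<Sum>k\<in>?I. \<Prod>r\<in>{1..<n}. real (d r choose k r) * z ^ k r * (1 - z) ^ (d r - k r) * eta_sum n y z x (n - r) ^ (d r - k r))"
      by (rule prod_sum_PiE) auto
    finally show ?case by (simp only: prod.distrib)
  qed
  have sum_int: "integrable (slice_prob n g y z) (\<lambda>x. \<Sum>k\<in>?I. ?B k * ?S k x)"
    using S_int by (intro Bochner_Integration.integrable_sum integrable_mult_right)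
  have meas: "(\<lambda>x. \<Prod>r\<in>{1..<n}. ladder n y z x r ^ d r) \<in> borel_measurable (slice_prob n g y z)"
    unfolding ladder_def
    by (intro borel_measurable_prod borel_measurable_power borel_measurable_add borel_measurable_times
        borel_measurable_const borel_measurable_sum eta_measurable_slice_prob n)
  have "integrable (slice_prob n g y z) (\<lambda>x. \<Prod>r\<in>{1..<n}. ladder n y z x r ^ d r)"
    by (rule integrable_cong_AE_imp[OF sum_int meas]) (use AE in eventually_elim, simp)
  then show "integrable (slice_prob n g y z) (\<lambda>x. \<Prod>r\<in>{1..<n}. ladder n y z x r ^ (lam r - lam (r + 1)))"
    unfolding d_def .
  have val: "(\<integral>x. (\<Prod>r\<in>{1..<n}. ladder n y z x r ^ d r) \<partial>slice_prob n g y z) =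
    (\<Sum>k\<in>?I. ?B k * (\<Prod>r\<in>{1..<n}. pochhammer (real (n - r) * g) (T k r) / pochhammer (real (n - r + 1) * g) (T k r)))"
  proof -
    have "(\<integral>x. (\<Prod>r\<in>{1..<n}. ladder n y z x r ^ d r) \<partial>slice_prob n g y z) =
      (\<integral>x. (\<Sum>k\<in>?I. ?B k * ?S k x) \<partial>slice_prob n g y z)"
      by (rule integral_cong_AE[OF meas _ AE]) (use sum_int in auto)
    also have "\<dots> = (\<Sum>k\<in>?I. ?B k * (\<integral>x. ?S k x \<partial>slice_prob n g y z))"
      using S_int by (subst Bochner_Integration.integral_sum) auto
    finally show ?thesis unfolding S_val .
  qed
  let ?K = "\<lambda>r k. \<Sum>j\<in>{r..<n}. k j"
  have factor: "f_coeff n g lam k r * ((1 - z) ^ (d r - k r) * (- z) ^ k r) =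
    pochhammer (real (n - r + 1) * g) (lam r - lam n) / pochhammer (real (n - r) * g) (lam r - lam n) *
    (real (d r choose k r) * z ^ k r * (1 - z) ^ (d r - k r) *
     (pochhammer (real (n - r) * g) (T k r) / pochhammer (real (n - r + 1) * g) (T k r)))"
    if k: "k \<in> ?I" and r: "r \<in> {1..<n}" for k r
  proof -
    define N where "N = lam r - lam n"
    define K where "K = ?K r k"
    have kd: "k j \<le> d j" if "j \<in> {1..<n}" for j using k that by (auto simp: PiE_iff)
    have N: "N = (\<Sum>j\<in>{r..<n}. d j)" unfolding N_def using r by (intro d_sum) auto
    have "K \<le> N" unfolding N K_def using kd r by (intro sum_mono) auto
    have TNK: "T k r = N - K"
      unfolding T_def N K_def using kd r by (intro sum_subtractf_nat) auto
    have pos: "0 < real (n - r + 1) * g" "0 < real (n - r) * g" using r g by auto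
    have nz: "0 < pochhammer (real (n - r) * g) M" "0 < pochhammer (real (n - r + 1) * g) M" for M
      by (rule pochhammer_pos[OF pos(2)], rule pochhammer_pos[OF pos(1)])
    have "f_coeff n g lam k r = (- 1) ^ k r * real (d r choose k r) *
      (pochhammer (1 - real (n - r + 1) * g - real N) K / pochhammer (1 - real (n - r) * g - real N) K)"
      by (simp add: f_coeff_def pochhammer_minus_of_nat_over_fact d_def N_def K_def)
    also have "pochhammer (1 - real (n - r + 1) * g - real N) K / pochhammer (1 - real (n - r) * g - real N) K =
      pochhammer (real (n - r + 1) * g) N / pochhammer (real (n - r) * g) N *
      (pochhammer (real (n - r) * g) (N - K) / pochhammer (real (n - r + 1) * g) (N - K))"
      unfolding pochhammer_reflect[OF pos(1) \<open>K \<le> N\<close>] pochhammer_reflect[OF pos(2) \<open>K \<le> N\<close>]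
      by (simp add: divide_simps)
    finally have fc: "f_coeff n g lam k r = (- 1) ^ k r * real (d r choose k r) *
      (pochhammer (real (n - r + 1) * g) N / pochhammer (real (n - r) * g) N *
      (pochhammer (real (n - r) * g) (N - K) / pochhammer (real (n - r + 1) * g) (N - K)))" .
    have sgn: "(- 1) ^ k r * (- z) ^ k r = z ^ k r" by (simp flip: power_mult_distrib)
    have "(s * b * (p * q)) * (w * v) = p * (b * (s * v) * w * q)" for s b p q w v :: real by (simp only: ac_simps)
    then show ?thesis unfolding fc TNK N_def[symmetric] by (simp only: sgn)
  qed
  have "poly (f_poly n g lam) (of_real z) = of_real (z ^ lam n *
    (\<Sum>k\<in>?I. \<Prod>r\<in>{1..<n}. f_coeff n g lam k r * ((1 - z) ^ (d r - k r) * (- z) ^ k r)))"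
    by (simp add: f_poly_def poly_sum poly_prod d_def)
  also have "(\<Sum>k\<in>?I. \<Prod>r\<in>{1..<n}. f_coeff n g lam k r * ((1 - z) ^ (d r - k r) * (- z) ^ k r)) =
    (\<Sum>k\<in>?I. beta n g lam * (?B k * (\<Prod>r\<in>{1..<n}. pochhammer (real (n - r) * g) (T k r) / pochhammer (real (n - r + 1) * g) (T k r))))"
  proof (rule sum.cong[OF refl])
    fix k assume "k \<in> ?I"
    then have "(\<Prod>r\<in>{1..<n}. f_coeff n g lam k r * ((1 - z) ^ (d r - k r) * (- z) ^ k r)) =
      (\<Prod>r\<in>{1..<n}. pochhammer (real (n - r + 1) * g) (lam r - lam n) / pochhammer (real (n - r) * g) (lam r - lam n) *
    (real (d r choose k r) * z ^ k r * (1 - z) ^ (d r - k r) *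
     (pochhammer (real (n - r) * g) (T k r) / pochhammer (real (n - r + 1) * g) (T k r))))"
      by (intro prod.cong refl) (rule factor)
    then show "(\<Prod>r\<in>{1..<n}. f_coeff n g lam k r * ((1 - z) ^ (d r - k r) * (- z) ^ k r)) =
      beta n g lam * (?B k * (\<Prod>r\<in>{1..<n}. pochhammer (real (n - r) * g) (T k r) / pochhammer (real (n - r + 1) * g) (T k r)))"
      unfolding beta_def by (simp only: prod.distrib)
  qed
  also have "\<dots> = beta n g lam * (\<integral>x. (\<Prod>r\<in>{1..<n}. ladder n y z x r ^ d r) \<partial>slice_prob n g y z)"
    unfolding val sum_distrib_left ..
  finally show "poly (f_poly n g lam) (of_real z) = of_real (beta n g lam) * of_real (z ^ lam n *
    (\<integral>x. (\<Prod>r\<in>{1..<n}. ladder n y z x r ^ (lam r - lam (r + 1))) \<partial>slice_prob n g y z))"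
    unfolding d_def by (simp only: of_real_mult mult.left_commute)
qed

section \<open>Widely separated points\<close>

lemma chain_powers: "1 < t \<Longrightarrow> chain n (\<lambda>i. t ^ (2 * i))"
  unfolding chain_def by (intro conjI ballI power_strict_increasing) auto

lemma slice_ratio_prod:
  assumes y: "chain n y" and n: "n \<ge> 1" and p: "slice_point 1 n y z x \<in> Omega n y"
  shows "(\<Prod>i\<in>{1..n}. slice_point 1 n y z x i / y i) = z"
proof -
  define Y where "Y = (\<Prod>k\<in>{1..n}. y k)"
  have "0 < Y" unfolding Y_def using chain_pos[OF y] by (intro prod_pos) auto
  then show ?thesis unfolding prod_dividef slice_point_prod[OF y n p] Y_def[symmetric] by simp
qed

text \<open>All ratios \<open>x i / y i\<close> exceed 1 and their product is \<open>z\<close>, so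
  no single one exceeds \<open>z\<close>.\<close>

lemma slice_ratio_bounds:
  assumes y: "chain n y" and n: "n \<ge> 1" and p: "slice_point 1 n y z x \<in> Omega n y" and i: "i \<in> {1..n}"
  shows "y i < slice_point 1 n y z x i" "slice_point 1 n y z x i \<le> z * y i"
proof -
  let ?p = "slice_point 1 n y z x"
  have yp: "0 < y k" "y k < ?p k" if "k \<in> {1..n}" for k
    using chain_pos[OF y that] p that by (auto simp: Omega_def)
  show "y i < ?p i" using yp i by blast
  have "z = (\<Prod>k\<in>{1..n}. ?p k / y k)" by (rule slice_ratio_prod[OF y n p, symmetric])
  also have "(\<Prod>k\<in>{1..n}. ?p k / y k) = ?p i / y i * (\<Prod>k\<in>{1..n} - {i}. ?p k / y k)"
    using i by (intro prod.remove) auto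
  finally have "?p i / y i * (\<Prod>k\<in>{1..n} - {i}. ?p k / y k) = z" ..
  moreover have "1 \<le> (\<Prod>k\<in>{1..n} - {i}. ?p k / y k)"
    by (rule prod_ge_1) (use yp in \<open>auto simp: less_imp_le\<close>)
  moreover have "0 < ?p i / y i" using yp[OF i] by (intro divide_pos_pos) auto
  ultimately have "?p i / y i \<le> z"
    using mult_left_mono[of 1 "\<Prod>k\<in>{1..n} - {i}. ?p k / y k" "?p i / y i"] by simp
  then show "?p i \<le> z * y i" using yp[OF i] by (simp add: pos_divide_le_eq)
qed

definition top_ratio :: "nat \<Rightarrow> (nat \<Rightarrow> real) \<Rightarrow> real \<Rightarrow> (nat \<Rightarrow> real) \<Rightarrow> nat \<Rightarrow> real" where
  "top_ratio n y z x r = (\<Prod>i\<in>{n - r + 1..n}. slice_point 1 n y z x i / y i)"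

text \<open>
  Both bounds come from the value of \<open>\<Prod>k. (x k - u) / (y k - u)\<close> at a point \<open>u\<close> well above
  \<open>y (n - r)\<close> and well below \<open>y (n - r + 1)\<close>: the product form is close to \<open>top_ratio\<close>, the
  partial fraction form is close to \<open>ladder\<close>.
\<close>

lemma top_ratio_ladder:
  assumes n: "n \<ge> 1" and z: "1 < z" and t: "z < t" and r: "r \<in> {1..<n}"
    and y: "y = (\<lambda>i. t ^ (2 * i))" and x: "slice_point 1 n y z x \<in> Omega n y"
  shows "(1 - (z - 1) / (t - 1)) * (1 - 1 / t) ^ n * ladder n y z x r \<le> top_ratio n y z x r"
    and "top_ratio n y z x r \<le> 1 / ((1 - 1 / t) * (1 - z / t) ^ n) * ladder n y z x r"
    and "1 \<le> ladder n y z x r"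
proof -
  let ?p = "slice_point 1 n y z x"
  \<comment> \<open>The odd power lies a factor \<open>t\<close> above \<open>y (n - r)\<close> and
    a factor \<open>t\<close> below \<open>y (n - r + 1)\<close>; this is why the points are even
    powers of \<open>t\<close>.\<close>
  define u where "u = t ^ (2 * (n - r) + 1)"
  define D U where "D = {1..n - r}" and "U = {n - r + 1..n}"
  have t1: "1 < t" "0 < t" using z t by auto
  have ch: "chain n y" unfolding y using t1 by (intro chain_powers)
  have split: "{1..n} = D \<union> U" "D \<inter> U = {}" "finite D" "finite U" using r by (auto simp: D_def U_def)
  have u0: "0 < u" using t1 by (simp add: u_def)
  have yD: "0 < y k" "y k * t \<le> u" "y k < u" "y k < ?p k" "?p k \<le> z * y k" if "k \<in> D" for k
  proof -
    have k: "k \<in> {1..n}" using that split by auto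
    show "0 < y k" "y k < ?p k" "?p k \<le> z * y k" using chain_pos[OF ch k] slice_ratio_bounds[OF ch n x k] by auto
    have "y k * t = t ^ (2 * k + 1)" by (simp add: y)
    also have "\<dots> \<le> u" unfolding u_def using that t1 by (intro power_increasing) (auto simp: D_def)
    finally show "y k * t \<le> u" .
    moreover have "y k < y k * t" using \<open>0 < y k\<close> t1 by simp
    ultimately show "y k < u" by simp
  qed
  have yU: "0 < y k" "u * t \<le> y k" "u < y k" "y k < ?p k" if "k \<in> U" for k
  proof -
    have k: "k \<in> {1..n}" using that split by auto
    show "0 < y k" "y k < ?p k" using chain_pos[OF ch k] slice_ratio_bounds[OF ch n x k] by auto
    have "u * t = t ^ (2 * (n - r) + 2)" by (simp add: u_def)
    also have "\<dots> \<le> y k" unfolding y using that t1 by (intro power_increasing) (auto simp: U_def)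
    finally show "u * t \<le> y k" .
    moreover have "u < u * t" using u0 t1 by simp
    ultimately show "u < y k" by simp
  qed
  define A where "A = top_ratio n y z x r"
  define T where "T = ladder n y z x r"
  define F where "F = (\<Prod>k\<in>{1..n}. (?p k - u) / (y k - u))"
  have A_eq: "A = (\<Prod>k\<in>U. ?p k / y k)" by (simp add: A_def top_ratio_def U_def)
  have A0: "0 < A" unfolding A_eq using yU by (intro prod_pos) (force intro: divide_pos_pos less_trans)
  have zt: "0 < 1 - z / t" "1 - z / t \<le> 1" "0 < 1 - 1 / t" "1 - 1 / t \<le> 1" using t t1 z by auto
  have F_split: "F = (\<Prod>k\<in>D. (?p k - u) / (y k - u)) * (\<Prod>k\<in>U. (?p k - u) / (y k - u))"
    unfolding F_def split(1) using split by (intro prod.union_disjoint)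
  \<comment> \<open>Below \<open>u\<close>, both \<open>x k\<close> and \<open>y k\<close> are small
    compared with \<open>u\<close>, so the factors are close to 1; the bound
    \<open>x k \<le> z * y k\<close> controls them from below.\<close>
  have D1: "(\<Prod>k\<in>D. (?p k - u) / (y k - u)) \<le> 1" and D2: "(1 - z / t) ^ n \<le> (\<Prod>k\<in>D. (?p k - u) / (y k - u))"
  proof -
    have bounds: "1 - z / t \<le> (?p k - u) / (y k - u)" "(?p k - u) / (y k - u) \<le> 1" if "k \<in> D" for k
    proof -
      note b = yD[OF that]
      have eq: "(?p k - u) / (y k - u) = (u - ?p k) / (u - y k)"
        by (metis minus_diff_eq minus_divide_divide)
      show "(?p k - u) / (y k - u) \<le> 1" unfolding eq using b by simp
      have "?p k * t \<le> z * y k * t" using b(5) t1 by (intro mult_right_mono) auto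
      also have "\<dots> = z * (y k * t)" by simp
      also have "\<dots> \<le> z * u" using b(2) z by (intro mult_left_mono) auto
      finally have "?p k * t \<le> z * u" .
      then have "?p k \<le> z / t * u" using t1 by (simp add: field_simps)
      then have "(1 - z / t) * u \<le> u - ?p k" by (simp add: algebra_simps)
      moreover have "(1 - z / t) * (u - y k) \<le> (1 - z / t) * u"
        using zt b by (intro mult_left_mono) auto
      ultimately have "(1 - z / t) * (u - y k) \<le> u - ?p k" by linarith
      then show "1 - z / t \<le> (?p k - u) / (y k - u)" unfolding eq using b by (simp add: pos_le_divide_eq)
    qed
    have nn: "0 \<le> (?p k - u) / (y k - u)" if "k \<in> D" for k using bounds(1)[OF that] zt by linarith
    show "(\<Prod>k\<in>D. (?p k - u) / (y k - u)) \<le> 1" using bounds nn by (intro prod_le_1) auto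
    have "(1 - z / t) ^ n \<le> (1 - z / t) ^ card D"
      using zt by (intro power_decreasing) (auto simp: D_def)
    also have "\<dots> = (\<Prod>k\<in>D. 1 - z / t)" by simp
    also have "\<dots> \<le> (\<Prod>k\<in>D. (?p k - u) / (y k - u))" using bounds zt by (intro prod_mono) auto
    finally show "(1 - z / t) ^ n \<le> (\<Prod>k\<in>D. (?p k - u) / (y k - u))" .
  qed
  \<comment> \<open>Above \<open>u\<close>, subtracting \<open>u\<close> changes numerator and
    denominator by a relative amount of at most \<open>1 / t\<close>.\<close>
  have U1: "A \<le> (\<Prod>k\<in>U. (?p k - u) / (y k - u))" and U2: "(\<Prod>k\<in>U. (?p k - u) / (y k - u)) * (1 - 1 / t) ^ n \<le> A"
  proof -
    have lower: "?p k / y k \<le> (?p k - u) / (y k - u)" if "k \<in> U" for k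
    proof -
      note b = yU[OF that]
      have "?p k * (y k - u) \<le> (?p k - u) * y k"
        using mult_left_mono[of "y k" "?p k" u] b u0 by (simp add: algebra_simps)
      then show ?thesis using b by (simp add: divide_simps)
    qed
    have upper: "(?p k - u) / (y k - u) * (1 - 1 / t) \<le> ?p k / y k" if "k \<in> U" for k
    proof -
      note b = yU[OF that]
      have "y k * (1 - 1 / t) \<le> y k - u" using b(2) t1 by (simp add: field_simps)
      then have "(?p k - u) * (y k * (1 - 1 / t)) \<le> ?p k * (y k - u)"
        using b u0 zt by (intro mult_mono) auto
      then have "(?p k - u) * (1 - 1 / t) * y k \<le> ?p k * (y k - u)" by (simp only: ac_simps)
      then show ?thesis using b by (simp add: divide_simps)
    qed
    have nn: "0 \<le> ?p k / y k" "0 \<le> (?p k - u) / (y k - u)" if "k \<in> U" for k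
    proof -
      show "0 \<le> ?p k / y k" using yU[OF that] by (intro divide_nonneg_nonneg) auto
      then show "0 \<le> (?p k - u) / (y k - u)" using lower[OF that] by linarith
    qed
    show "A \<le> (\<Prod>k\<in>U. (?p k - u) / (y k - u))" unfolding A_eq using lower nn by (intro prod_mono) auto
    have "(\<Prod>k\<in>U. (?p k - u) / (y k - u)) * (1 - 1 / t) ^ n \<le> (\<Prod>k\<in>U. (?p k - u) / (y k - u)) * (1 - 1 / t) ^ card U"
      using zt nn r by (intro mult_left_mono power_decreasing prod_nonneg) (auto simp: U_def)
    also have "\<dots> = (\<Prod>k\<in>U. (?p k - u) / (y k - u) * (1 - 1 / t))" by (simp only: prod.distrib prod_constant)
    also have "\<dots> \<le> A" unfolding A_eq
    proof (rule prod_mono)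
      fix k assume "k \<in> U"
      then show "0 \<le> (?p k - u) / (y k - u) * (1 - 1 / t) \<and> (?p k - u) / (y k - u) * (1 - 1 / t) \<le> ?p k / y k"
        using upper mult_nonneg_nonneg[OF nn(2) less_imp_le[OF zt(3)]] by blast
    qed
    finally show "(\<Prod>k\<in>U. (?p k - u) / (y k - u)) * (1 - 1 / t) ^ n \<le> A" .
  qed
  have F_upper: "F * (1 - 1 / t) ^ n \<le> A"
  proof -
    have "F * (1 - 1 / t) ^ n \<le> 1 * ((\<Prod>k\<in>U. (?p k - u) / (y k - u)) * (1 - 1 / t) ^ n)"
      unfolding F_split mult.assoc using D1 U1 A0 zt by (intro mult_right_mono) auto
    then show ?thesis using U2 by simp
  qed
  have F_lower: "A * (1 - z / t) ^ n \<le> F"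
  proof -
    have "(1 - z / t) ^ n * A \<le> F"
      unfolding F_split
      by (intro mult_mono D2 U1 order_trans[OF zero_le_power[OF less_imp_le[OF zt(1)]] D2] less_imp_le[OF A0])
    then show ?thesis by (simp only: mult.commute)
  qed
  let ?e = "eta n y z x"
  have e: "0 < ?e i" if "i \<in> {1..n}" for i using eta_pos[OF ch z x that] .
  \<comment> \<open>Partial fraction form in simplex coordinates: the weights are close to 1 on the
    upper block and at most \<open>1 / (t - 1)\<close> on the lower one.\<close>
  have F_eta: "F = 1 + (z - 1) * ((\<Sum>i\<in>U. ?e i * (y i / (y i - u))) - (\<Sum>i\<in>D. ?e i * (y i / (u - y i))))"
  proof -
    have "u \<notin> y ` {1..n}" using yD(3) yU(3) split(1) by force
    then have "F = 1 + (\<Sum>i\<in>{1..n}. xi n y ?p i / (y i - u))"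
      unfolding F_def by (rule xi_partial_fractions[OF ch])
    also have "(\<Sum>i\<in>{1..n}. xi n y ?p i / (y i - u)) = (\<Sum>i\<in>{1..n}. (z - 1) * (?e i * (y i / (y i - u))))"
    proof (intro sum.cong refl)
      fix i assume "i \<in> {1..n}"
      then show "xi n y ?p i / (y i - u) = (z - 1) * (?e i * (y i / (y i - u)))"
        using chain_pos[OF ch \<open>i \<in> {1..n}\<close>] z by (simp add: eta_def)
    qed
    also have "\<dots> = (z - 1) * (\<Sum>i\<in>{1..n}. ?e i * (y i / (y i - u)))" by (rule sum_distrib_left[symmetric])
    also have "(\<Sum>i\<in>{1..n}. ?e i * (y i / (y i - u))) = (\<Sum>i\<in>D. ?e i * (y i / (y i - u))) + (\<Sum>i\<in>U. ?e i * (y i / (y i - u)))"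
      unfolding split(1) using split by (intro sum.union_disjoint)
    also have "(\<Sum>i\<in>D. ?e i * (y i / (y i - u))) = - (\<Sum>i\<in>D. ?e i * (y i / (u - y i)))"
      unfolding sum_negf[symmetric]
      by (intro sum.cong refl) (metis minus_diff_eq minus_divide_right mult_minus_right)
    finally show ?thesis by simp
  qed
  have T_eq: "T = 1 + (z - 1) * (\<Sum>i\<in>U. ?e i)" by (simp add: T_def ladder_def U_def)
  have eU: "0 \<le> (\<Sum>i\<in>U. ?e i)" by (intro sum_nonneg less_imp_le[OF e]) (auto simp: U_def)
  have T1: "1 \<le> T" unfolding T_eq using eU z by simp
  then show "1 \<le> ladder n y z x r" by (simp add: T_def)
  have sum_U: "(\<Sum>i\<in>U. ?e i) \<le> (\<Sum>i\<in>U. ?e i * (y i / (y i - u)))" "(\<Sum>i\<in>U. ?e i * (y i / (y i - u))) * (1 - 1 / t) \<le> (\<Sum>i\<in>U. ?e i)"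
  proof -
    have b: "1 \<le> y i / (y i - u)" "y i / (y i - u) * (1 - 1 / t) \<le> 1" if "i \<in> U" for i
    proof -
      note b = yU[OF that]
      show "1 \<le> y i / (y i - u)" using b u0 by simp
      have "y i * (1 - 1 / t) \<le> y i - u" using b(2) t1 by (simp add: field_simps)
      then show "y i / (y i - u) * (1 - 1 / t) \<le> 1" using b by (simp add: divide_simps)
    qed
    have eU: "0 \<le> ?e i" if "i \<in> U" for i by (rule less_imp_le[OF e]) (use that in \<open>auto simp: U_def\<close>)
    show "(\<Sum>i\<in>U. ?e i) \<le> (\<Sum>i\<in>U. ?e i * (y i / (y i - u)))"
      using mult_left_mono[OF b(1) eU] by (intro sum_mono) simp
    show "(\<Sum>i\<in>U. ?e i * (y i / (y i - u))) * (1 - 1 / t) \<le> (\<Sum>i\<in>U. ?e i)"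
      unfolding sum_distrib_right using mult_left_mono[OF b(2) eU] by (intro sum_mono) (simp add: mult.assoc)
  qed
  have sum_D: "0 \<le> (\<Sum>i\<in>D. ?e i * (y i / (u - y i)))" "(\<Sum>i\<in>D. ?e i * (y i / (u - y i))) \<le> 1 / (t - 1)"
  proof -
    have eD: "0 \<le> ?e i" if "i \<in> D" for i by (rule less_imp_le[OF e]) (use that in \<open>auto simp: D_def\<close>)
    show "0 \<le> (\<Sum>i\<in>D. ?e i * (y i / (u - y i)))"
      using eD yD by (intro sum_nonneg mult_nonneg_nonneg divide_nonneg_nonneg) (auto simp: less_imp_le)
    have "(\<Sum>i\<in>D. ?e i * (y i / (u - y i))) \<le> (\<Sum>i\<in>D. ?e i * (1 / (t - 1)))"
    proof (intro sum_mono mult_left_mono eD)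
      fix i assume "i \<in> D"
      note b = yD[OF this]
      have "y i * (t - 1) \<le> u - y i" using b by (simp add: algebra_simps)
      then show "y i / (u - y i) \<le> 1 / (t - 1)" using b t1 by (simp add: divide_simps mult.commute)
    qed
    also have "\<dots> = (\<Sum>i\<in>D. ?e i) * (1 / (t - 1))" by (rule sum_distrib_right[symmetric])
    also have "\<dots> \<le> 1 * (1 / (t - 1))"
    proof (rule mult_right_mono)
      have "(\<Sum>i\<in>D. ?e i) \<le> (\<Sum>i\<in>{1..n}. ?e i)"
        by (intro sum_mono2 less_imp_le[OF e]) (auto simp: D_def)
      then show "(\<Sum>i\<in>D. ?e i) \<le> 1" using sum_eta[OF ch n z x] by simp
    qed (use t1 in auto)
    finally show "(\<Sum>i\<in>D. ?e i * (y i / (u - y i))) \<le> 1 / (t - 1)" by simp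
  qed
  let ?SU = "\<Sum>i\<in>U. ?e i * (y i / (y i - u))" and ?SD = "\<Sum>i\<in>D. ?e i * (y i / (u - y i))"
  have FT_lower: "(1 - (z - 1) / (t - 1)) * T \<le> F"
  proof -
    have "(z - 1) * ((\<Sum>i\<in>U. ?e i) - 1 / (t - 1)) \<le> (z - 1) * (?SU - ?SD)"
      using sum_U sum_D z by (intro mult_left_mono) auto
    then have "T - (z - 1) / (t - 1) \<le> F" unfolding F_eta T_eq by (simp add: algebra_simps)
    moreover have "(z - 1) / (t - 1) \<le> (z - 1) / (t - 1) * T"
      using T1 z t1 mult_left_mono[of 1 T "(z - 1) / (t - 1)"] by simp
    ultimately show ?thesis by (simp add: left_diff_distrib)
  qed
  have FT_upper: "F * (1 - 1 / t) \<le> T"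
  proof -
    have "F \<le> 1 + (z - 1) * ?SU" unfolding F_eta using sum_D z by (simp add: mult_left_mono)
    then have "F * (1 - 1 / t) \<le> (1 + (z - 1) * ?SU) * (1 - 1 / t)" using zt by (intro mult_right_mono) auto
    also have "\<dots> = (1 - 1 / t) + (z - 1) * (?SU * (1 - 1 / t))" by (simp only: distrib_right mult_1 mult.assoc)
    also have "\<dots> \<le> 1 + (z - 1) * (\<Sum>i\<in>U. ?e i)"
      using zt sum_U z by (intro add_mono mult_left_mono) auto
    finally show ?thesis by (simp add: T_eq)
  qed
  have "(1 - (z - 1) / (t - 1)) * T * (1 - 1 / t) ^ n \<le> F * (1 - 1 / t) ^ n"
    using FT_lower zt by (intro mult_right_mono) auto
  with F_upper show "(1 - (z - 1) / (t - 1)) * (1 - 1 / t) ^ n * ladder n y z x r \<le> top_ratio n y z x r"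
    unfolding A_def[symmetric] T_def[symmetric] by (simp add: ac_simps)
  have "A * (1 - z / t) ^ n * (1 - 1 / t) \<le> F * (1 - 1 / t)"
    using F_lower zt by (intro mult_right_mono) auto
  with FT_upper have "A * ((1 - 1 / t) * (1 - z / t) ^ n) \<le> T" by (simp add: ac_simps)
  then show "top_ratio n y z x r \<le> 1 / ((1 - 1 / t) * (1 - z / t) ^ n) * ladder n y z x r"
    unfolding A_def[symmetric] T_def[symmetric] using zt by (simp add: pos_le_divide_eq)
qed

section \<open>Dominance order and the leading monomial\<close>

text \<open>The largest index in \<open>S\<close> is at least \<open>card S\<close>, so its entry is
  at most \<open>mu (card S)\<close>; it is removed and the rest is treated by induction.\<close>

lemma sum_le_initial_sum:
  fixes mu :: "nat \<Rightarrow> nat"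
  assumes "\<And>i j. 1 \<le> i \<Longrightarrow> i \<le> j \<Longrightarrow> j \<le> n \<Longrightarrow> mu j \<le> mu i" "S \<subseteq> {1..n}"
  shows "(\<Sum>i\<in>S. mu i) \<le> (\<Sum>j\<in>{1..card S}. mu j)"
  using assms(2)
proof (induction "card S" arbitrary: S)
  case 0
  then have "finite S" by (meson finite_atLeastAtMost finite_subset)
  with 0 show ?case by simp
next
  case (Suc k)
  have fin: "finite S" using Suc.prems by (meson finite_atLeastAtMost finite_subset)
  have ne: "S \<noteq> {}" using Suc by auto
  define s where "s = Max S"
  have s: "s \<in> S" unfolding s_def using fin ne by (rule Max_in)
  have "S \<subseteq> {1..s}" using Suc.prems fin by (auto simp: s_def)
  then have "card S \<le> card {1..s}" by (intro card_mono) auto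
  then have "Suc k \<le> s" using Suc by simp
  then have mu: "mu s \<le> mu (Suc k)" using s Suc.prems by (intro assms(1)) auto
  have card: "k = card (S - {s})" using Suc s fin by simp
  then have "(\<Sum>i\<in>S - {s}. mu i) \<le> (\<Sum>j\<in>{1..k}. mu j)"
    using Suc.hyps(1)[of "S - {s}"] Suc.prems by auto
  moreover have "(\<Sum>i\<in>S. mu i) = mu s + (\<Sum>i\<in>S - {s}. mu i)" using fin s by (rule sum.remove)
  ultimately show ?case unfolding Suc.hyps(2)[symmetric] using mu by simp
qed

lemma partitions_antimono:
  assumes "mu \<in> partitions n" "1 \<le> i" "i \<le> j" "j \<le> n"
  shows "mu j \<le> mu i"
  using assms(3,4)
proof (induction j rule: dec_induct)
  case (step j)
  then have "mu (j + 1) \<le> mu j" using assms(1,2) by (auto simp: partitions_def)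
  with step show ?case by simp
qed simp

text \<open>Each index \<open>i\<close> lies in exactly \<open>i\<close> of the tails. Tails are
  what dominance can compare, while the weighted sum is half the growth exponent of a monomial at
  the points \<open>y i = t ^ (2 * i)\<close>.\<close>

lemma weighted_sum_tails:
  fixes nu :: "nat \<Rightarrow> nat"
  shows "(\<Sum>i\<in>{1..n}. i * nu i) = (\<Sum>k\<in>{1..n}. \<Sum>i\<in>{k..n}. nu i)"
proof -
  have "(\<Sum>k\<in>{1..n}. \<Sum>i\<in>{k..n}. nu i) = (\<Sum>k\<in>{1..n}. \<Sum>i | i \<in> {1..n} \<and> k \<le> i. nu i)"
    by (intro sum.cong refl) auto
  also have "\<dots> = (\<Sum>i\<in>{1..n}. \<Sum>k | k \<in> {1..n} \<and> k \<le> i. nu i)"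
    by (rule sum.swap_restrict) auto
  also have "\<dots> = (\<Sum>i\<in>{1..n}. i * nu i)"
  proof (intro sum.cong refl)
    fix i assume "i \<in> {1..n}"
    then have "{k. k \<in> {1..n} \<and> k \<le> i} = {1..i}" by auto
    then show "(\<Sum>k | k \<in> {1..n} \<and> k \<le> i. nu i) = i * nu i" by simp
  qed
  finally show ?thesis ..
qed

text \<open>Tail by tail, a sum over the permuted \<open>mu\<close> is at most an initial sum of
  \<open>mu\<close>, hence by dominance at most an initial sum of \<open>lam\<close>, which is a
  tail of the reversed \<open>lam\<close>. Equality of the totals forces equality in every tail, and
  differences of consecutive tails give the entries.\<close>

lemma weight_dominated:
  assumes lam: "lam \<in> partitions n" and mu: "mu \<in> partitions n" and dom: "dominated n mu lam"
    and \<sigma>: "\<sigma> permutes {1..n}"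
  shows "(\<Sum>i\<in>{1..n}. i * mu (\<sigma> i)) \<le> (\<Sum>i\<in>{1..n}. i * lam (n + 1 - i))"
    and "(\<Sum>i\<in>{1..n}. i * mu (\<sigma> i)) = (\<Sum>i\<in>{1..n}. i * lam (n + 1 - i)) \<Longrightarrow>
      mu = lam \<and> (\<forall>i\<in>{1..n}. mu (\<sigma> i) = lam (n + 1 - i))"
proof -
  have a: "(\<Sum>i\<in>{k..n}. mu (\<sigma> i)) \<le> (\<Sum>j\<in>{1..n + 1 - k}. mu j)" if "k \<in> {1..n}" for k
  proof -
    have inj: "inj_on \<sigma> {k..n}" using permutes_inj_on[OF \<sigma>] .
    have "(\<Sum>i\<in>{k..n}. mu (\<sigma> i)) = (\<Sum>i\<in>\<sigma> ` {k..n}. mu i)" by (simp add: sum.reindex[OF inj])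
    also have "\<dots> \<le> (\<Sum>j\<in>{1..card (\<sigma> ` {k..n})}. mu j)"
    proof (rule sum_le_initial_sum[where n = n])
      have "\<sigma> ` {k..n} \<subseteq> \<sigma> ` {1..n}" using that by auto
      then show "\<sigma> ` {k..n} \<subseteq> {1..n}" unfolding permutes_image[OF \<sigma>] .
    qed (use partitions_antimono[OF mu] in auto)
    finally show ?thesis using that by (simp add: card_image[OF inj] Suc_diff_le)
  qed
  have b: "(\<Sum>j\<in>{1..m}. mu j) \<le> (\<Sum>j\<in>{1..m}. lam j)" if "m \<in> {1..n}" for m
    using dom that by (cases "m = n") (auto simp: dominated_def)
  have c: "(\<Sum>j\<in>{1..n + 1 - k}. lam j) = (\<Sum>i\<in>{k..n}. lam (n + 1 - i))" if "k \<in> {1..n}" for k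
    by (rule sum.reindex_bij_witness[of _ "\<lambda>i. n + 1 - i" "\<lambda>i. n + 1 - i"]) (use that in auto)
  have le: "(\<Sum>i\<in>{k..n}. mu (\<sigma> i)) \<le> (\<Sum>i\<in>{k..n}. lam (n + 1 - i))" if "k \<in> {1..n}" for k
  proof -
    have "n + 1 - k \<in> {1..n}" using that by auto
    from b[OF this] show ?thesis using a[OF that] c[OF that] by linarith
  qed
  then show "(\<Sum>i\<in>{1..n}. i * mu (\<sigma> i)) \<le> (\<Sum>i\<in>{1..n}. i * lam (n + 1 - i))"
    unfolding weighted_sum_tails by (rule sum_mono)
  assume "(\<Sum>i\<in>{1..n}. i * mu (\<sigma> i)) = (\<Sum>i\<in>{1..n}. i * lam (n + 1 - i))"
  then have "(\<Sum>k\<in>{1..n}. \<Sum>i\<in>{k..n}. mu (\<sigma> i)) = (\<Sum>k\<in>{1..n}. \<Sum>i\<in>{k..n}. lam (n + 1 - i))"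
    unfolding weighted_sum_tails .
  then have eq: "(\<Sum>i\<in>{k..n}. mu (\<sigma> i)) = (\<Sum>i\<in>{k..n}. lam (n + 1 - i))" if "k \<in> {1..n}" for k
    using sum_mono_inv[of "\<lambda>k. \<Sum>i\<in>{k..n}. mu (\<sigma> i)" "{1..n}" "\<lambda>k. \<Sum>i\<in>{k..n}. lam (n + 1 - i)" k] le that by auto
  have eq_mu: "(\<Sum>j\<in>{1..m}. mu j) = (\<Sum>j\<in>{1..m}. lam j)" if "m \<in> {1..n}" for m
  proof -
    have m: "n + 1 - m \<in> {1..n}" "n + 1 - (n + 1 - m) = m" using that by auto
    from a[OF m(1)] b[OF that] c[OF m(1)] eq[OF m(1)] show ?thesis unfolding m(2) by linarith
  qed
  have mu_lam: "mu i = lam i" for i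
  proof (cases "i \<in> {1..n}")
    case True
    then obtain j where i: "i = Suc j" by (cases i) auto
    have "(\<Sum>j\<in>{1..j}. mu j) = (\<Sum>j\<in>{1..j}. lam j)" using eq_mu[of j] True i by (cases "j = 0") auto
    then show ?thesis using eq_mu[OF True] by (simp add: i)
  next
    case False
    then show ?thesis using lam mu by (auto simp: partitions_def)
  qed
  moreover have "mu (\<sigma> i) = lam (n + 1 - i)" if "i \<in> {1..n}" for i
  proof -
    have "(\<Sum>i\<in>{Suc i..n}. mu (\<sigma> i)) = (\<Sum>i\<in>{Suc i..n}. lam (n + 1 - i))"
      using eq[of "Suc i"] that by (cases "i = n") auto
    then show ?thesis using eq[OF that] that by (simp add: sum.atLeast_Suc_atMost)
  qed
  ultimately show "mu = lam \<and> (\<forall>i\<in>{1..n}. mu (\<sigma> i) = lam (n + 1 - i))" by (auto intro!: ext)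
qed

lemma lookup_exponent: "Poly_Mapping.lookup (exponent n nu) i = (if i \<in> {1..n} then nu i else 0)"
  by (simp add: exponent_def lookup_sum lookup_single when_def)

lemma keys_exponent: "Poly_Mapping.keys (exponent n nu) \<subseteq> {1..n}"
  by (auto simp: in_keys_iff lookup_exponent split: if_splits)

definition orbit :: "nat \<Rightarrow> (nat \<Rightarrow> nat) \<Rightarrow> (nat \<Rightarrow>\<^sub>0 nat) set" where
  "orbit n mu = {exponent n (mu \<circ> \<sigma>) | \<sigma>. \<sigma> permutes {1..n}}"

lemma finite_orbit: "finite (orbit n mu)"
  unfolding orbit_def using finite_permutations[of "{1..n}"]
  by (simp add: setcompr_eq_image)

lemma monomial_sym_orbit: "monomial_sym n mu = (\<Sum>e\<in>orbit n mu. Poly_Mapping.single e 1)"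
  by (simp add: monomial_sym_def orbit_def)

lemma lookup_monomial_sym: "Poly_Mapping.lookup (monomial_sym n mu) e = (if e \<in> orbit n mu then 1 else 0)"
  using finite_orbit[of n mu] by (simp add: monomial_sym_orbit lookup_sum lookup_single when_def)

lemma map_key_orbit:
  assumes "\<tau> permutes {1..n}" "e \<in> orbit n mu"
  shows "Poly_Mapping.map_key \<tau> e \<in> orbit n mu"
proof -
  obtain \<sigma> where \<sigma>: "\<sigma> permutes {1..n}" "e = exponent n (mu \<circ> \<sigma>)" using assms(2) by (auto simp: orbit_def)
  have "Poly_Mapping.map_key \<tau> e = exponent n (mu \<circ> (\<sigma> \<circ> \<tau>))"
    by (rule poly_mapping_eqI)
      (simp only: lookup_map_key_permutes[OF assms(1)] \<sigma>(2) lookup_exponent permutes_in_image[OF assms(1)] comp_apply)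
  then show ?thesis unfolding orbit_def using permutes_compose[OF assms(1) \<sigma>(1)] by blast
qed

lemma monomial_sym_in_sym_polys: "monomial_sym n mu \<in> sym_polys n"
proof (rule sym_polysI)
  show "vars_in n (monomial_sym n mu)"
    unfolding vars_in_def
  proof
    fix e assume "e \<in> Poly_Mapping.keys (monomial_sym n mu)"
    then have "e \<in> orbit n mu" by (simp add: in_keys_iff lookup_monomial_sym split: if_splits)
    then obtain \<sigma> where "e = exponent n (mu \<circ> \<sigma>)" unfolding orbit_def by blast
    then show "Poly_Mapping.keys e \<subseteq> {1..n}" by (simp only: keys_exponent)
  qed
  fix \<sigma> and x :: "nat \<Rightarrow> complex" assume \<sigma>: "\<sigma> permutes {1..n}"
  have k: "Poly_Mapping.keys e \<subseteq> {1..n}" if "e \<in> orbit n mu" for e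
  proof -
    obtain \<sigma> where "e = exponent n (mu \<circ> \<sigma>)" using \<open>e \<in> orbit n mu\<close> unfolding orbit_def by blast
    then show ?thesis by (simp only: keys_exponent)
  qed
  have "eval_mpoly x (monomial_sym n mu) = (\<Sum>e\<in>orbit n mu. monom_eval (\<lambda>i. x (\<sigma> i)) (Poly_Mapping.map_key \<sigma> e))"
    unfolding monomial_sym_orbit eval_mpoly_sum by (intro sum.cong refl) (simp add: monom_eval_permute[OF \<sigma> k])
  also have "\<dots> = (\<Sum>e\<in>orbit n mu. monom_eval (\<lambda>i. x (\<sigma> i)) e)"
    by (rule sum.reindex_bij_witness[where i = "Poly_Mapping.map_key (inv \<sigma>)" and j = "Poly_Mapping.map_key \<sigma>"])
      (auto simp: map_key_inv[OF \<sigma>] map_key_orbit[OF \<sigma>] map_key_orbit[OF permutes_inv[OF \<sigma>]])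
  also have "\<dots> = eval_mpoly (\<lambda>i. x (\<sigma> i)) (monomial_sym n mu)"
    unfolding monomial_sym_orbit eval_mpoly_sum by simp
  finally show "eval_mpoly (\<lambda>i. x (\<sigma> i)) (monomial_sym n mu) = eval_mpoly x (monomial_sym n mu)" ..
qed

lemma sym_polys_add: "p \<in> sym_polys n \<Longrightarrow> q \<in> sym_polys n \<Longrightarrow> p + q \<in> sym_polys n"
  by (rule sym_polysI) (auto intro: vars_in_add sym_polys_vars_in simp: eval_mpoly_permute)

lemma sym_polys_cmult: "p \<in> sym_polys n \<Longrightarrow> const c * p \<in> sym_polys n"
  by (rule sym_polysI) (auto intro: vars_in_mult vars_in_const sym_polys_vars_in simp: eval_mpoly_permute)

lemma sym_polys_sum: "(\<And>i. i \<in> I \<Longrightarrow> p i \<in> sym_polys n) \<Longrightarrow> (\<Sum>i\<in>I. p i) \<in> sym_polys n"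
proof (induction I rule: infinite_finite_induct)
  case (insert i I)
  then show ?case by (auto intro: sym_polys_add)
qed (use vars_in_const[of n 0] in \<open>auto intro!: sym_polysI simp: const_def\<close>)

lemma lookup_const_mult: "Poly_Mapping.lookup (const c * p) e = c * Poly_Mapping.lookup p e"
proof -
  have "const c * p = (\<Sum>k\<in>Poly_Mapping.keys p. Poly_Mapping.single k (c * Poly_Mapping.lookup p k))"
    by (subst poly_mapping_eq_sum_single[of p]) (simp add: const_def sum_distrib_left mult_single)
  then show ?thesis by (simp add: lookup_sum lookup_single when_def in_keys_iff)
qed

text \<open>The leading exponent is \<open>lam\<close> reversed, because the largest of the points
  \<open>y i\<close> carries the largest index while partitions decrease. By
  \<open>weight_dominated\<close> every other monomial has strictly smaller weight, whichever
  \<open>monomial_sym\<close> it comes from.\<close>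

lemma jack_leading_term:
  assumes P: "is_jack n g lam P" and lam: "lam \<in> partitions n"
  defines "tp \<equiv> exponent n (\<lambda>i. lam (n + 1 - i))"
  shows "P \<in> sym_polys n" and "Poly_Mapping.lookup P tp = 1"
    and "\<And>e. e \<in> Poly_Mapping.keys P \<Longrightarrow> e \<noteq> tp \<Longrightarrow>
      (\<Sum>i\<in>{1..n}. i * Poly_Mapping.lookup e i) < (\<Sum>i\<in>{1..n}. i * lam (n + 1 - i))"
proof -
  let ?M = "{mu. mu \<in> partitions n \<and> dominated n mu lam \<and> mu \<noteq> lam}"
  obtain v where v: "P = monomial_sym n lam + (\<Sum>mu\<in>?M. const (v mu) * monomial_sym n mu)"
    using P unfolding is_jack_def by blast
  show "P \<in> sym_polys n" unfolding v
    by (intro sym_polys_add sym_polys_sum sym_polys_cmult monomial_sym_in_sym_polys)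
  have lookup: "Poly_Mapping.lookup P e = (if e \<in> orbit n lam then 1 else 0) + (\<Sum>mu\<in>?M. v mu * (if e \<in> orbit n mu then 1 else 0))" for e
    unfolding v by (simp add: lookup_add lookup_sum lookup_const_mult lookup_monomial_sym)
  have dom: "dominated n lam lam" by (simp add: dominated_def)
  have weight: "(\<Sum>i\<in>{1..n}. i * Poly_Mapping.lookup e i) < (\<Sum>i\<in>{1..n}. i * lam (n + 1 - i)) \<or> mu = lam \<and> e = tp"
    if e: "e \<in> orbit n mu" and mu: "mu \<in> partitions n" "dominated n mu lam" for e mu
  proof -
    obtain \<sigma> where \<sigma>: "\<sigma> permutes {1..n}" "e = exponent n (mu \<circ> \<sigma>)" using e by (auto simp: orbit_def)
    have w: "(\<Sum>i\<in>{1..n}. i * Poly_Mapping.lookup e i) = (\<Sum>i\<in>{1..n}. i * mu (\<sigma> i))"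
      by (intro sum.cong refl) (simp add: \<sigma>(2) lookup_exponent)
    have "e = tp" if "\<forall>i\<in>{1..n}. mu (\<sigma> i) = lam (n + 1 - i)"
      unfolding \<sigma>(2) tp_def by (rule poly_mapping_eqI) (use that in \<open>simp add: lookup_exponent\<close>)
    then show ?thesis
      using weight_dominated[OF lam mu \<sigma>(1)] unfolding w le_less by blast
  qed
  have top_orbit: "tp \<in> orbit n lam"
  proof -
    define \<rho> where "\<rho> = (\<lambda>i. if i \<in> {1..n} then n + 1 - i else i)"
    have "\<rho> permutes {1..n}"
      by (rule bij_imp_permutes) (auto simp: \<rho>_def intro!: bij_betw_byWitness[where f' = \<rho>])
    moreover have "tp = exponent n (lam \<circ> \<rho>)"
      unfolding tp_def by (rule poly_mapping_eqI) (simp add: lookup_exponent \<rho>_def)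
    ultimately show ?thesis unfolding orbit_def by blast
  qed
  have top_weight: "(\<Sum>i\<in>{1..n}. i * Poly_Mapping.lookup tp i) = (\<Sum>i\<in>{1..n}. i * lam (n + 1 - i))"
    by (intro sum.cong refl) (simp add: tp_def lookup_exponent)
  have "tp \<notin> orbit n mu" if "mu \<in> ?M" for mu
    using weight[of tp mu] that top_weight by auto
  then show "Poly_Mapping.lookup P tp = 1" unfolding lookup using top_orbit by simp
  fix e assume e: "e \<in> Poly_Mapping.keys P" "e \<noteq> tp"
  then have "Poly_Mapping.lookup P e \<noteq> 0" by (simp add: in_keys_iff)
  then have "e \<in> orbit n lam \<or> (\<exists>mu\<in>?M. e \<in> orbit n mu)"
  proof (rule contrapos_np)
    assume "\<not> (e \<in> orbit n lam \<or> (\<exists>mu\<in>?M. e \<in> orbit n mu))"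
    then have "(\<Sum>mu\<in>?M. v mu * (if e \<in> orbit n mu then 1 else 0)) = 0" "e \<notin> orbit n lam"
      by (auto intro!: sum.neutral)
    then show "Poly_Mapping.lookup P e = 0" unfolding lookup by simp
  qed
  then show "(\<Sum>i\<in>{1..n}. i * Poly_Mapping.lookup e i) < (\<Sum>i\<in>{1..n}. i * lam (n + 1 - i))"
    using weight[of e] e(2) lam dom by auto
qed

text \<open>Any other monomial has weight smaller by at least 1, which costs a factor
  \<open>t ^ 2\<close> at the points \<open>y\<close>, while passing from \<open>y\<close> to
  \<open>x\<close> gains at most \<open>z\<close> to the power of its degree. The constant
  \<open>C\<close> depends on neither \<open>t\<close> nor \<open>x\<close>, so the error is uniform
  over the slice.\<close>

lemma leading_term_estimate:
  fixes x y :: "nat \<Rightarrow> real"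
  assumes P: "is_jack n g lam P" and lam: "lam \<in> partitions n" and t: "1 < t" and z: "1 \<le> z"
    and y: "y = (\<lambda>i. t ^ (2 * i))" and x: "\<And>i. i \<in> {1..n} \<Longrightarrow> y i \<le> x i \<and> x i \<le> z * y i"
  defines "C \<equiv> (\<Sum>e\<in>Poly_Mapping.keys P. norm (Poly_Mapping.lookup P e) * z ^ (\<Sum>i\<in>{1..n}. Poly_Mapping.lookup e i))"
  shows "norm (eval_mpoly (\<lambda>i. of_real (x i)) P / of_real (\<Prod>i\<in>{1..n}. y i ^ lam (n + 1 - i)) -
    of_real (\<Prod>i\<in>{1..n}. (x i / y i) ^ lam (n + 1 - i))) \<le> C / t"
proof -
  define tp where "tp = exponent n (\<lambda>i. lam (n + 1 - i))"
  note J = jack_leading_term[OF P lam, folded tp_def]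
  let ?l = Poly_Mapping.lookup
  let ?K = "Poly_Mapping.keys P - {tp}"
  define Y where "Y = (\<Prod>i\<in>{1..n}. y i ^ lam (n + 1 - i))"
  define W where "W = (\<Sum>i\<in>{1..n}. i * lam (n + 1 - i))"
  have y0: "0 < y i" for i using t by (simp add: y)
  have Y0: "0 < Y" unfolding Y_def using y0 by (intro prod_pos) auto
  have ypow: "(\<Prod>i\<in>{1..n}. y i ^ e i) = t ^ (2 * (\<Sum>i\<in>{1..n}. i * e i))" for e :: "nat \<Rightarrow> nat"
    by (simp add: y power_mult[symmetric] power_sum[symmetric] sum_distrib_left mult.assoc)
  have YW: "Y = t ^ (2 * W)" unfolding Y_def W_def by (rule ypow)
  have tp: "tp \<in> Poly_Mapping.keys P" using J(2) by (simp add: in_keys_iff)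
  have xi: "0 < x i" if "i \<in> {1..n}" for i using x[OF that] y0[of i] by linarith
  have "eval_mpoly (\<lambda>i. of_real (x i)) P = (\<Sum>e\<in>Poly_Mapping.keys P. ?l P e * of_real (\<Prod>i\<in>{1..n}. x i ^ ?l e i))"
    unfolding eval_mpoly_vars_in[OF sym_polys_vars_in[OF J(1)]] by simp
  also have "\<dots> = ?l P tp * of_real (\<Prod>i\<in>{1..n}. x i ^ ?l tp i) + (\<Sum>e\<in>?K. ?l P e * of_real (\<Prod>i\<in>{1..n}. x i ^ ?l e i))"
    using tp by (intro sum.remove) auto
  also have "(\<Prod>i\<in>{1..n}. x i ^ ?l tp i) = (\<Prod>i\<in>{1..n}. x i ^ lam (n + 1 - i))"
    by (intro prod.cong refl) (simp add: tp_def lookup_exponent)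
  finally have ev: "eval_mpoly (\<lambda>i. of_real (x i)) P = of_real (\<Prod>i\<in>{1..n}. x i ^ lam (n + 1 - i)) +
     (\<Sum>e\<in>?K. ?l P e * of_real (\<Prod>i\<in>{1..n}. x i ^ ?l e i))" by (simp add: J(2))
  have "(\<Prod>i\<in>{1..n}. (x i / y i) ^ lam (n + 1 - i)) = (\<Prod>i\<in>{1..n}. x i ^ lam (n + 1 - i)) / Y"
    by (simp add: Y_def power_divide prod_dividef)
  then have "eval_mpoly (\<lambda>i. of_real (x i)) P / of_real Y - of_real (\<Prod>i\<in>{1..n}. (x i / y i) ^ lam (n + 1 - i)) =
    (\<Sum>e\<in>?K. ?l P e * of_real ((\<Prod>i\<in>{1..n}. x i ^ ?l e i) / Y))"
    unfolding ev by (simp add: add_divide_distrib sum_divide_distrib)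
  also have "norm \<dots> \<le> (\<Sum>e\<in>?K. norm (?l P e) * z ^ (\<Sum>i\<in>{1..n}. ?l e i) / t)"
  proof (rule order_trans[OF norm_sum], rule sum_mono)
    fix e assume e: "e \<in> ?K"
    let ?X = "\<Prod>i\<in>{1..n}. x i ^ ?l e i"
    define w where "w = (\<Sum>i\<in>{1..n}. i * ?l e i)"
    define s where "s = (\<Sum>i\<in>{1..n}. ?l e i)"
    have w: "w < W" unfolding w_def W_def by (rule J(3)) (use e in auto)
    have X0: "0 \<le> ?X" using xi by (intro prod_nonneg) (auto intro!: zero_le_power less_imp_le)
    have "?X \<le> (\<Prod>i\<in>{1..n}. (z * y i) ^ ?l e i)"
      by (intro prod_mono conjI power_mono zero_le_power less_imp_le[OF xi] conjunct2[OF x])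
    also have "\<dots> = z ^ s * t ^ (2 * w)"
      unfolding power_mult_distrib prod.distrib ypow s_def w_def by (simp add: power_sum)
    finally have "?X * t \<le> z ^ s * t ^ (2 * w) * t" using t by (intro mult_right_mono) auto
    also have "\<dots> = z ^ s * t ^ (2 * w + 1)" by simp
    also have "\<dots> \<le> z ^ s * Y"
      unfolding YW using w t z by (intro mult_left_mono power_increasing) auto
    finally have "?X / Y \<le> z ^ s / t" using Y0 t by (simp add: divide_simps mult.commute)
    then have "norm (?l P e) * (?X / Y) \<le> norm (?l P e) * (z ^ s / t)" by (intro mult_left_mono) auto
    moreover have "norm (?l P e * complex_of_real (?X / Y)) = norm (?l P e) * (?X / Y)"
      using X0 Y0 by (simp only: norm_mult norm_of_real) simp
    ultimately show "norm (?l P e * complex_of_real (?X / Y)) \<le> norm (?l P e) * z ^ (\<Sum>i\<in>{1..n}. ?l e i) / t"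
      by (simp add: s_def)
  qed
  also have "\<dots> \<le> (\<Sum>e\<in>Poly_Mapping.keys P. norm (?l P e) * z ^ (\<Sum>i\<in>{1..n}. ?l e i) / t)"
    using z t by (intro sum_mono2) (auto intro!: divide_nonneg_nonneg mult_nonneg_nonneg)
  also have "\<dots> = C / t" by (simp add: C_def sum_divide_distrib)
  finally show ?thesis by (simp add: Y_def)
qed

section \<open>The eigenvalue\<close>

text \<open>Summation by parts in multiplicative form: the step \<open>lam r - lam (r + 1)\<close>
  enters the exponent of \<open>w i\<close> exactly for the \<open>r\<close> largest indices
  \<open>i\<close>, and \<open>lam n\<close> enters all exponents.\<close>

lemma leading_ratio_top_ratio:
  fixes w :: "nat \<Rightarrow> real"
  assumes lam: "lam \<in> partitions n" and w: "(\<Prod>i\<in>{1..n}. w i) = z"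
  shows "(\<Prod>i\<in>{1..n}. w i ^ lam (n + 1 - i)) =
    z ^ lam n * (\<Prod>r\<in>{1..<n}. (\<Prod>i\<in>{n - r + 1..n}. w i) ^ (lam r - lam (r + 1)))"
proof -
  let ?d = "\<lambda>r. lam r - lam (r + 1)"
  have "(\<Prod>i\<in>{1..n}. w i ^ lam (n + 1 - i)) = (\<Prod>i\<in>{1..n}. w i ^ lam n * (\<Prod>r | r \<in> {1..<n} \<and> n + 1 - i \<le> r. w i ^ ?d r))"
  proof (intro prod.cong refl)
    fix i assume i: "i \<in> {1..n}"
    have "lam (n + 1 - i) = lam n + (\<Sum>j\<in>{n + 1 - i..<n}. ?d j)"
      by (rule partition_step_sum[OF lam]) (use i in auto)
    moreover have "{n + 1 - i..<n} = {r. r \<in> {1..<n} \<and> n + 1 - i \<le> r}" using i by auto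
    ultimately show "w i ^ lam (n + 1 - i) = w i ^ lam n * (\<Prod>r | r \<in> {1..<n} \<and> n + 1 - i \<le> r. w i ^ ?d r)"
      by (simp only: power_add power_sum)
  qed
  also have "\<dots> = z ^ lam n * (\<Prod>i\<in>{1..n}. \<Prod>r | r \<in> {1..<n} \<and> n + 1 - i \<le> r. w i ^ ?d r)"
    unfolding w[symmetric] prod.distrib prod_power_distrib ..
  also have "(\<Prod>i\<in>{1..n}. \<Prod>r | r \<in> {1..<n} \<and> n + 1 - i \<le> r. w i ^ ?d r) =
    (\<Prod>r\<in>{1..<n}. \<Prod>i | i \<in> {1..n} \<and> n + 1 - i \<le> r. w i ^ ?d r)"
    by (rule prod.swap_restrict) auto
  also have "\<dots> = (\<Prod>r\<in>{1..<n}. (\<Prod>i\<in>{n - r + 1..n}. w i) ^ ?d r)"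
  proof (intro prod.cong refl)
    fix r assume "r \<in> {1..<n}"
    then have "{i. i \<in> {1..n} \<and> n + 1 - i \<le> r} = {n - r + 1..n}" by auto
    then show "(\<Prod>i | i \<in> {1..n} \<and> n + 1 - i \<le> r. w i ^ ?d r) = (\<Prod>i\<in>{n - r + 1..n}. w i) ^ ?d r"
      by (simp only: prod_power_distrib)
  qed
  finally show ?thesis .
qed

lemma integrable_bounded_slice:
  fixes f :: "(nat \<Rightarrow> real) \<Rightarrow> 'b::{banach, second_countable_topology}"
  assumes "chain n y" "n \<ge> 1" "0 < g" "1 < z" and "f \<in> borel_measurable (\<Pi>\<^sub>M i\<in>{1..<n}. lborel)"
    and "\<And>x. slice_point 1 n y z x \<in> Omega n y \<Longrightarrow> norm (f x) \<le> B"
  shows "integrable (slice_prob n g y z) f"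
proof -
  interpret finite_measure "slice_prob n g y z" by (rule finite_measure_slice_prob[OF assms(1-4)])
  show ?thesis
  proof (rule integrable_const_bound[where B = B])
    show "AE x in slice_prob n g y z. norm (f x) \<le> B"
      using AE_slice_prob[OF assms(2), where g = g and y = y and z = z] by eventually_elim (rule assms(6))
    show "f \<in> borel_measurable (slice_prob n g y z)"
      using assms(5) by (simp add: measurable_cong_sets[OF sets_slice_prob refl])
  qed
qed

lemma measure_slice_prob:
  assumes "chain n y" "n \<ge> 1" "0 < g" "1 < z"
  shows "measure (slice_prob n g y z) (space (slice_prob n g y z)) = 1"
  by (simp add: measure_def emeasure_slice_prob[OF assms])

lemma norm_integral_le_slice:
  fixes f :: "(nat \<Rightarrow> real) \<Rightarrow> complex"
  assumes "chain n y" "n \<ge> 1" "0 < g" "1 < z" and "integrable (slice_prob n g y z) f"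
    and "\<And>x. slice_point 1 n y z x \<in> Omega n y \<Longrightarrow> norm (f x) \<le> B"
  shows "norm (\<integral>x. f x \<partial>slice_prob n g y z) \<le> B"
proof -
  interpret finite_measure "slice_prob n g y z" by (rule finite_measure_slice_prob[OF assms(1-4)])
  have "norm (\<integral>x. f x \<partial>slice_prob n g y z) \<le> (\<integral>x. norm (f x) \<partial>slice_prob n g y z)"
    by (rule integral_norm_bound)
  also have "\<dots> \<le> (\<integral>x. B \<partial>slice_prob n g y z)"
  proof (rule integral_mono_AE)
    show "AE x in slice_prob n g y z. norm (f x) \<le> B"
      using AE_slice_prob[OF assms(2), where g = g and y = y and z = z] by eventually_elim (rule assms(6))
  qed (use assms(5) in auto)
  also have "\<dots> = B" by (simp add: measure_slice_prob[OF assms(1-4)])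
  finally show ?thesis .
qed

lemma beta_pos:
  assumes "0 < g" shows "0 < beta n g lam"
  unfolding beta_def using assms by (intro prod_pos divide_pos_pos ballI pochhammer_pos) auto

text \<open>The eigenvalue equation at the points \<open>y t\<close> is divided by the leading
  monomial. One side becomes \<open>q\<close> times \<open>PE t\<close>, which tends to
  \<open>q\<close>; the other is within \<open>C / t\<close> of the expectation of
  \<open>M t\<close>, which lies between \<open>lo t * V\<close> and \<open>hi t * V\<close>, where
  \<open>V\<close> does not depend on \<open>t\<close>.\<close>

theorem jack_eigenvalue_real:
  fixes P :: mpoly and q :: "complex \<Rightarrow> complex"
  assumes n: "n \<ge> 1" and g: "0 < g" and lam: "lam \<in> partitions n" and P: "is_jack n g lam P"
    and q: "\<And>z. Q_op n g z P = const (q z) * P" and z: "1 < z"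
  shows "poly (f_poly n g lam) (of_real z) = of_real (beta n g lam) * q (of_real z)"
proof -
  have sym: "P \<in> sym_polys n" by (rule jack_leading_term(1)[OF P lam])
  define y :: "real \<Rightarrow> nat \<Rightarrow> real" where "y = (\<lambda>t i. t ^ (2 * i))"
  define d where "d = (\<lambda>r. lam r - lam (r + 1))"
  define D where "D = (\<Sum>r\<in>{1..<n}. d r)"
  define E where "E = (\<lambda>t. \<integral>x. (\<Prod>r\<in>{1..<n}. ladder n (y t) z x r ^ d r) \<partial>slice_prob n g (y t) z)"
  \<comment> \<open>\<open>E t\<close> is the same for all \<open>t > z\<close>; the point
    \<open>z + 1\<close> merely fixes a representative.\<close>
  define V where "V = z ^ lam n * E (z + 1)"
  define M where "M = (\<lambda>t x. \<Prod>i\<in>{1..n}. (slice_point 1 n (y t) z x i / y t i) ^ lam (n + 1 - i))"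
  define Y where "Y = (\<lambda>t. \<Prod>i\<in>{1..n}. y t i ^ lam (n + 1 - i))"
  define C where "C = (\<Sum>e\<in>Poly_Mapping.keys P. norm (Poly_Mapping.lookup P e) * z ^ (\<Sum>i\<in>{1..n}. Poly_Mapping.lookup e i))"
  define lo hi where "lo = (\<lambda>t. ((1 - (z - 1) / (t - 1)) * (1 - 1 / t) ^ n) ^ D)"
    and "hi = (\<lambda>t. (1 / ((1 - 1 / t) * (1 - z / t) ^ n)) ^ D)"
  define PE where "PE = (\<lambda>t. eval_mpoly (\<lambda>i. of_real (y t i)) P / of_real (Y t))"
  have ch: "chain n (y t)" if "z < t" for t unfolding y_def using that z by (intro chain_powers) auto
  have beta: "beta n g lam \<noteq> 0" using beta_pos[OF g, of n lam] by simp
  have f_E: "poly (f_poly n g lam) (of_real z) = of_real (beta n g lam) * of_real (z ^ lam n * E t)" if "z < t" for t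
    unfolding E_def d_def by (rule integral_ladder(1)[OF ch[OF that] n g z lam])
  \<comment> \<open>The formula for \<open>f_poly\<close> holds at every such \<open>t\<close> with
    the same left side, and \<open>beta\<close> can be cancelled.\<close>
  have V: "z ^ lam n * E t = V" if "z < t" for t
  proof -
    have "of_real (beta n g lam) * complex_of_real (z ^ lam n * E t) = of_real (beta n g lam) * complex_of_real V"
      unfolding V_def f_E[OF that, symmetric] by (rule f_E) simp
    then show ?thesis using beta by (simp only: mult_cancel_left of_real_eq_0_iff of_real_eq_iff) simp
  qed
  have Y0: "0 < Y t" if "z < t" for t
    unfolding Y_def using chain_pos[OF ch[OF that]] by (intro prod_pos) auto
  have M_meas: "M t \<in> borel_measurable (\<Pi>\<^sub>M i\<in>{1..<n}. lborel)" for t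
    unfolding M_def
    by (intro borel_measurable_prod borel_measurable_power borel_measurable_divide borel_measurable_const
        slice_point_measurable n)
  have M_eq: "M t x = z ^ lam n * (\<Prod>r\<in>{1..<n}. top_ratio n (y t) z x r ^ d r)"
    if "z < t" "slice_point 1 n (y t) z x \<in> Omega n (y t)" for t x
    unfolding M_def top_ratio_def d_def
    by (rule leading_ratio_top_ratio[OF lam slice_ratio_prod[OF ch[OF that(1)] n that(2)]])
  have sandwich: "lo t * (z ^ lam n * (\<Prod>r\<in>{1..<n}. ladder n (y t) z x r ^ d r)) \<le> M t x"
    "M t x \<le> hi t * (z ^ lam n * (\<Prod>r\<in>{1..<n}. ladder n (y t) z x r ^ d r))"
    if t: "z < t" and x: "slice_point 1 n (y t) z x \<in> Omega n (y t)" for t x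
  proof -
    let ?l = "(1 - (z - 1) / (t - 1)) * (1 - 1 / t) ^ n" and ?h = "1 / ((1 - 1 / t) * (1 - z / t) ^ n)"
    have yt: "y t = (\<lambda>i. t ^ (2 * i))" by (simp add: y_def)
    note b = top_ratio_ladder[OF n z t _ yt x]
    have zt: "0 \<le> 1 - 1 / t" "0 \<le> 1 - z / t" "0 \<le> 1 - (z - 1) / (t - 1)" using t z by auto
    have l0: "0 \<le> ?l" using zt by (intro mult_nonneg_nonneg zero_le_power)
    have lad: "0 \<le> ladder n (y t) z x r" if "r \<in> {1..<n}" for r using b(3)[OF that] by linarith
    have tr: "0 \<le> top_ratio n (y t) z x r" if "r \<in> {1..<n}" for r
      using mult_nonneg_nonneg[OF l0 lad[OF that]] b(1)[OF that] by linarith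
    have D: "(\<Prod>r\<in>{1..<n}. c ^ d r) = c ^ D" for c :: real by (simp add: D_def power_sum)
    have "lo t * (\<Prod>r\<in>{1..<n}. ladder n (y t) z x r ^ d r) = (\<Prod>r\<in>{1..<n}. (?l * ladder n (y t) z x r) ^ d r)"
      by (simp only: lo_def power_mult_distrib[of ?l] prod.distrib D)
    also have "\<dots> \<le> (\<Prod>r\<in>{1..<n}. top_ratio n (y t) z x r ^ d r)"
    proof (intro prod_mono conjI)
      fix r assume r: "r \<in> {1..<n}"
      have "0 \<le> ?l * ladder n (y t) z x r" by (rule mult_nonneg_nonneg[OF l0 lad[OF r]])
      then show "0 \<le> (?l * ladder n (y t) z x r) ^ d r" "(?l * ladder n (y t) z x r) ^ d r \<le> top_ratio n (y t) z x r ^ d r"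
        using b(1)[OF r] by (auto intro: power_mono)
    qed
    finally have "z ^ lam n * (lo t * (\<Prod>r\<in>{1..<n}. ladder n (y t) z x r ^ d r)) \<le> M t x"
      unfolding M_eq[OF t x] using z by (intro mult_left_mono) auto
    then show "lo t * (z ^ lam n * (\<Prod>r\<in>{1..<n}. ladder n (y t) z x r ^ d r)) \<le> M t x"
      by (simp only: mult.left_commute)
    have "(\<Prod>r\<in>{1..<n}. top_ratio n (y t) z x r ^ d r) \<le> (\<Prod>r\<in>{1..<n}. (?h * ladder n (y t) z x r) ^ d r)"
      using b(2) tr by (intro prod_mono conjI power_mono zero_le_power)
    also have "\<dots> = hi t * (\<Prod>r\<in>{1..<n}. ladder n (y t) z x r ^ d r)"
      by (simp only: hi_def power_mult_distrib[of ?h] prod.distrib D)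
    finally have "M t x \<le> z ^ lam n * (hi t * (\<Prod>r\<in>{1..<n}. ladder n (y t) z x r ^ d r))"
      unfolding M_eq[OF t x] using z by (intro mult_left_mono) auto
    then show "M t x \<le> hi t * (z ^ lam n * (\<Prod>r\<in>{1..<n}. ladder n (y t) z x r ^ d r))"
      by (simp only: mult.left_commute)
  qed
  have M_bound: "norm (M t x) \<le> z ^ (\<Sum>i\<in>{1..n}. lam (n + 1 - i))"
    if t: "z < t" and x: "slice_point 1 n (y t) z x \<in> Omega n (y t)" for t x
  proof -
    have b: "0 \<le> slice_point 1 n (y t) z x i / y t i" "slice_point 1 n (y t) z x i / y t i \<le> z" if i: "i \<in> {1..n}" for i
      using slice_ratio_bounds[OF ch[OF t] n x i] chain_pos[OF ch[OF t] i] by (auto simp: pos_divide_le_eq)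
    have "M t x \<le> (\<Prod>i\<in>{1..n}. z ^ lam (n + 1 - i))"
      unfolding M_def using b by (intro prod_mono conjI power_mono zero_le_power)
    moreover have "0 \<le> M t x" unfolding M_def using b by (intro prod_nonneg zero_le_power)
    ultimately show ?thesis by (simp add: power_sum)
  qed
  have M_int: "integrable (slice_prob n g (y t) z) (M t)" if "z < t" for t
    by (rule integrable_bounded_slice[OF ch[OF that] n g z M_meas M_bound[OF that]])
  have ladder_int: "integrable (slice_prob n g (y t) z) (\<lambda>x. c * (z ^ lam n * (\<Prod>r\<in>{1..<n}. ladder n (y t) z x r ^ d r)))"
    "(\<integral>x. c * (z ^ lam n * (\<Prod>r\<in>{1..<n}. ladder n (y t) z x r ^ d r)) \<partial>slice_prob n g (y t) z) = c * V"
    if "z < t" for t c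
    using integral_ladder(2)[OF ch[OF that] n g z lam, folded d_def] V[OF that] unfolding d_def[symmetric]
    by (auto simp: E_def d_def)
  have M_lower: "lo t * V \<le> (\<integral>x. M t x \<partial>slice_prob n g (y t) z)"
    and M_upper: "(\<integral>x. M t x \<partial>slice_prob n g (y t) z) \<le> hi t * V" if t: "z < t" for t
  proof -
    have AE: "AE x in slice_prob n g (y t) z. slice_point 1 n (y t) z x \<in> Omega n (y t)" by (rule AE_slice_prob[OF n])
    have "(\<integral>x. lo t * (z ^ lam n * (\<Prod>r\<in>{1..<n}. ladder n (y t) z x r ^ d r)) \<partial>slice_prob n g (y t) z) \<le> (\<integral>x. M t x \<partial>slice_prob n g (y t) z)"
      by (rule integral_mono_AE[OF ladder_int(1)[OF t] M_int[OF t]]) (use AE in eventually_elim, rule sandwich(1)[OF t])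
    then show "lo t * V \<le> (\<integral>x. M t x \<partial>slice_prob n g (y t) z)" unfolding ladder_int(2)[OF t] .
    have "(\<integral>x. M t x \<partial>slice_prob n g (y t) z) \<le> (\<integral>x. hi t * (z ^ lam n * (\<Prod>r\<in>{1..<n}. ladder n (y t) z x r ^ d r)) \<partial>slice_prob n g (y t) z)"
      by (rule integral_mono_AE[OF M_int[OF t] ladder_int(1)[OF t]]) (use AE in eventually_elim, rule sandwich(2)[OF t])
    then show "(\<integral>x. M t x \<partial>slice_prob n g (y t) z) \<le> hi t * V" unfolding ladder_int(2)[OF t] .
  qed
  have estimate: "norm (eval_mpoly (\<lambda>i. of_real (slice_point 1 n (y t) z x i)) P / of_real (Y t) - of_real (M t x)) \<le> C / t"
    if t: "z < t" and x: "slice_point 1 n (y t) z x \<in> Omega n (y t)" for t x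
    unfolding Y_def M_def C_def
    by (rule leading_term_estimate[OF P lam, where y = "y t" and z = z])
      (use t z slice_ratio_bounds[OF ch[OF t] n x] in \<open>auto simp: y_def less_imp_le\<close>)
  \<comment> \<open>The same estimate with \<open>x = y\<close>, where all ratios are 1.\<close>
  have PE: "norm (PE t - 1) \<le> C / t" if t: "z < t" for t
  proof -
    have y0: "0 < y t i" for i using t z by (simp add: y_def)
    have "(\<Prod>i\<in>{1..n}. (y t i / y t i) ^ lam (n + 1 - i)) = 1"
      using y0 by (simp add: less_imp_neq[THEN not_sym])
    moreover have "norm (eval_mpoly (\<lambda>i. of_real (y t i)) P / of_real (\<Prod>i\<in>{1..n}. y t i ^ lam (n + 1 - i)) -
        of_real (\<Prod>i\<in>{1..n}. (y t i / y t i) ^ lam (n + 1 - i))) \<le> C / t"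
      unfolding C_def
      by (rule leading_term_estimate[OF P lam, where y = "y t" and z = z])
        (use t z y0 in \<open>auto simp: y_def\<close>)
    ultimately show ?thesis by (simp add: PE_def Y_def)
  qed
  have eigen: "norm (q (of_real z) * PE t - of_real (\<integral>x. M t x \<partial>slice_prob n g (y t) z)) \<le> C / t" if t: "z < t" for t
  proof -
    let ?e = "\<lambda>x. eval_mpoly (\<lambda>i. complex_of_real (slice_point 1 n (y t) z x i)) P"
    have meas: "(\<lambda>x. ?e x / of_real (Y t) - of_real (M t x)) \<in> borel_measurable (\<Pi>\<^sub>M i\<in>{1..<n}. lborel)"
      using eval_mpoly_slice_measurable[OF n sym] M_meas by measurable
    have int: "integrable (slice_prob n g (y t) z) (\<lambda>x. ?e x / of_real (Y t) - of_real (M t x))"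
      by (rule integrable_bounded_slice[OF ch[OF t] n g z meas estimate[OF t]])
    have M_int': "integrable (slice_prob n g (y t) z) (\<lambda>x. complex_of_real (M t x))" using M_int[OF t] by simp
    have "q (of_real z) * PE t = (\<integral>x. ?e x \<partial>slice_prob n g (y t) z) / of_real (Y t)"
      unfolding eval_Q_op[OF n g sym z ch[OF t], symmetric] q by (simp add: PE_def)
    also have "\<dots> = (\<integral>x. (?e x / of_real (Y t) - of_real (M t x)) + of_real (M t x) \<partial>slice_prob n g (y t) z)"
      by simp
    also have "\<dots> = (\<integral>x. ?e x / of_real (Y t) - of_real (M t x) \<partial>slice_prob n g (y t) z) + of_real (\<integral>x. M t x \<partial>slice_prob n g (y t) z)"
      unfolding Bochner_Integration.integral_add[OF int M_int'] by simp
    finally have "q (of_real z) * PE t - of_real (\<integral>x. M t x \<partial>slice_prob n g (y t) z) =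
      (\<integral>x. ?e x / of_real (Y t) - of_real (M t x) \<partial>slice_prob n g (y t) z)" by simp
    then show ?thesis using norm_integral_le_slice[OF ch[OF t] n g z int estimate[OF t]] by simp
  qed
  have inv: "((\<lambda>t::real. c / t) \<longlongrightarrow> 0) at_top" for c :: real
    by (rule tendsto_divide_0[OF tendsto_const filterlim_at_top_imp_at_infinity[OF filterlim_ident]])
  have "filterlim (\<lambda>t::real. - 1 + t) at_top at_top"
    by (rule filterlim_tendsto_add_at_top[OF tendsto_const filterlim_ident])
  then have "filterlim (\<lambda>t::real. t - 1) at_top at_top" by (simp add: add.commute)
  then have inv1: "((\<lambda>t::real. c / (t - 1)) \<longlongrightarrow> 0) at_top" for c :: real
    by (rule tendsto_divide_0[OF tendsto_const filterlim_at_top_imp_at_infinity])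
  have "(lo \<longlongrightarrow> ((1 - 0) * (1 - 0) ^ n) ^ D) at_top"
    unfolding lo_def by (intro tendsto_intros inv inv1)
  then have lo: "((\<lambda>t. lo t * V) \<longlongrightarrow> V) at_top" using tendsto_mult_right[of lo 1 at_top V] by simp
  have "(hi \<longlongrightarrow> (1 / ((1 - 0) * (1 - 0) ^ n)) ^ D) at_top"
    unfolding hi_def by (intro tendsto_intros inv) auto
  then have hi: "((\<lambda>t. hi t * V) \<longlongrightarrow> V) at_top" using tendsto_mult_right[of hi 1 at_top V] by simp
  have ev: "eventually (\<lambda>t. z < t) at_top" by (rule eventually_gt_at_top)
  have M_lim: "((\<lambda>t. \<integral>x. M t x \<partial>slice_prob n g (y t) z) \<longlongrightarrow> V) at_top"
    by (rule tendsto_sandwich[OF _ _ lo hi]) (use ev in eventually_elim, simp add: M_lower M_upper)+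
  have "((\<lambda>t. PE t - 1) \<longlongrightarrow> 0) at_top"
    by (rule Lim_null_comparison[OF _ inv[of C]]) (use ev in eventually_elim, rule PE)
  then have "((\<lambda>t. PE t) \<longlongrightarrow> 1) at_top" by (simp add: LIM_zero_iff)
  then have "((\<lambda>t. q (of_real z) * PE t) \<longlongrightarrow> q (of_real z) * 1) at_top" by (intro tendsto_intros)
  moreover have "((\<lambda>t. q (of_real z) * PE t - of_real (\<integral>x. M t x \<partial>slice_prob n g (y t) z)) \<longlongrightarrow> 0) at_top"
    by (rule Lim_null_comparison[OF _ inv[of C]]) (use ev in eventually_elim, rule eigen)
  ultimately have "((\<lambda>t. q (of_real z) * PE t - (q (of_real z) * PE t - of_real (\<integral>x. M t x \<partial>slice_prob n g (y t) z))) \<longlongrightarrow> q (of_real z) * 1 - 0) at_top"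
    by (rule tendsto_diff)
  then have "((\<lambda>t. complex_of_real (\<integral>x. M t x \<partial>slice_prob n g (y t) z)) \<longlongrightarrow> q (of_real z)) at_top" by simp
  moreover have "((\<lambda>t. complex_of_real (\<integral>x. M t x \<partial>slice_prob n g (y t) z)) \<longlongrightarrow> of_real V) at_top"
    by (intro tendsto_intros M_lim)
  ultimately have "q (of_real z) = of_real V"
    by (rule tendsto_unique[OF trivial_limit_at_top_linorder])
  then show ?thesis unfolding V_def using f_E[of "z + 1"] by simp
qed

theorem theorem5p3:
  fixes n :: nat and g :: real and lam :: "nat \<Rightarrow> nat" and P :: mpoly and q :: "complex \<Rightarrow> complex"
  assumes "n \<ge> 1" and "g > 0" and "lam \<in> partitions n"
    and "is_jack n g lam P"
    and "\<And>z. Q_op n g z P = const (q z) * P"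
  shows "(\<forall>z. poly (f_poly n g lam) z = of_real (beta n g lam) * q z) \<and>
         ((\<forall>i\<in>{1..<n}. hyp_b n g lam i \<notin> \<int>\<^sub>\<le>\<^sub>0) \<longrightarrow>
            (\<forall>z. norm z < 1 \<longrightarrow> f_hyp n g lam z = of_real (beta n g lam) * q z))"
proof -
  have sym: "P \<in> sym_polys n" and "P \<noteq> 0"
    using jack_leading_term(1,2)[OF assms(4,3)] by auto
  then obtain y where y: "chain n y" "eval_mpoly (\<lambda>i. of_real (y i)) P \<noteq> 0"
    using mpoly_zero_on_chains[OF sym_polys_vars_in[OF sym]] by blast
  define e where "e = eval_mpoly (\<lambda>i. of_real (y i)) P"
  \<comment> \<open>Evaluating the eigenvalue equation at a point where \<open>P\<close> does not
    vanish shows that \<open>q\<close> is a polynomial in \<open>z\<close>; this is what allows the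
    identity for real \<open>z > 1\<close> to be extended to all complex \<open>z\<close>.\<close>
  define r where "r = smult (1 / e) (map_poly (eval_mpoly (\<lambda>i. of_real (y i))) (Q_poly n g P))"
  have q: "q z = poly r z" for z
  proof -
    have "q z * e = eval_mpoly (\<lambda>i. of_real (y i)) (Q_op n g z P)" by (simp add: assms(5) e_def)
    also have "\<dots> = poly (map_poly (eval_mpoly (\<lambda>i. of_real (y i))) (Q_poly n g P)) z"
      unfolding Q_op_def by (rule eval_mpoly_poly_const)
    finally show ?thesis using y(2) by (simp add: r_def e_def field_simps)
  qed
  have "f_poly n g lam - smult (of_real (beta n g lam)) r = 0"
  proof (rule Poly_zero_of_infinite_roots[where T = 1])
    fix z :: real assume "1 < z"
    from jack_eigenvalue_real[OF assms(1-5) this]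
    show "poly (f_poly n g lam - smult (of_real (beta n g lam)) r) (of_real z) = 0" by (simp add: q)
  qed
  then have f: "poly (f_poly n g lam) z = of_real (beta n g lam) * q z" for z by (simp add: q)
  then show ?thesis using f_hyp_eq_f_poly[OF assms(1,3)] by simp
qed



end
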